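(* For every integer $d>0$, the sequence of box graphs $\mathcal{G}_N=[N]^d$, $N\ge1$, has asymptotically dense delocalization.
   Context: $[N]^d=\{1,\dots,N\}^d$ is regarded as a graph in which two vertices are joined by an edge iff their distance is exactly $1$ (nearest neighbours in $\mathbb{Z}^d$). For a finite graph $\mathcal{G}$ and a potential $V:\mathcal{V}(\mathcal{G})\to[-\lambda,\lambda]$, the Schr\"odinger operator $H_{\mathcal{G},V}$ on $\ell^2(\mathcal{V}(\mathcal{G}))$ is $(H_{\mathcal{G},V}\phi)(v)=\sum_{v'\sim v}[\phi(v')-\phi(v)]+V(v)\phi(v)$. $\sigma_{V,v}$ denotes the spectral measure of $H_{\mathcal{G},V}$ at $\delta_v$, i.e. $\langle\delta_v,g(H_{\mathcal{G},V})\delta_v\rangle=\int g\,d\sigma_{V,v}$. A family $\mathcal{F}$ of finite graphs has asymptotically dense delocalization if for all $\lambda,\varepsilon,\delta>0$ there is $N_{\mathcal{F}}(\lambda,\varepsilon,\delta)>0$ such that for every $\mathcal{G}\in\mathcal{F}$ with $\#\mathcal{V}(\mathcal{G})>N_{\mathcal{F}}(\lambda,\varepsilon,\delta)$ and every $V:\mathcal{V}(\mathcal{G})\to[-\lambda,\lambda]$ there is a potential $W:\mathcal{V}(\mathcal{G})\to[-\lambda,\lambda]$ with $\|V-W\|_\infty<\delta$ such that, for at least $(1-\delta)\#\mathcal{V}(\mathcal{G})$ vertices $v$, the spectral measure $\sigma_{W,v}$ has no atom of weight larger than $\varepsilon$. *)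

theory Defs
  imports "HOL-Analysis.Analysis" "Graph_Theory.Pair_Digraph"
begin

section \<open>Operators on the Hilbert space of a finite set\<close>

definition ell2 :: "'a set \<Rightarrow> ('a \<Rightarrow> complex) set" where
  "ell2 X = {\<phi>. \<forall>x. x \<notin> X \<longrightarrow> \<phi> x = 0}"

definition inner_on :: "'a set \<Rightarrow> ('a \<Rightarrow> complex) \<Rightarrow> ('a \<Rightarrow> complex) \<Rightarrow> complex" where
  "inner_on X \<phi> \<psi> = (\<Sum>x\<in>X. cnj (\<phi> x) * \<psi> x)"

definition delta :: "'a \<Rightarrow> 'a \<Rightarrow> complex" where
  "delta v = (\<lambda>x. if x = v then 1 else 0)"

definition eigenspace ::
  "'a set \<Rightarrow> (('a \<Rightarrow> complex) \<Rightarrow> 'a \<Rightarrow> complex) \<Rightarrow> real \<Rightarrow> ('a \<Rightarrow> complex) set" where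
  "eigenspace X H E = {\<phi> \<in> ell2 X. \<forall>x\<in>X. H \<phi> x = complex_of_real E * \<phi> x}"

definition eigenvalues ::
  "'a set \<Rightarrow> (('a \<Rightarrow> complex) \<Rightarrow> 'a \<Rightarrow> complex) \<Rightarrow> real set" where
  "eigenvalues X H = {E. \<exists>\<phi>\<in>eigenspace X H E. \<exists>x\<in>X. \<phi> x \<noteq> 0}"

definition orth_proj ::
  "'a set \<Rightarrow> ('a \<Rightarrow> complex) set \<Rightarrow> ('a \<Rightarrow> complex) \<Rightarrow> 'a \<Rightarrow> complex" where
  "orth_proj X M \<phi> =
     (THE \<psi>. \<psi> \<in> M \<and> (\<forall>\<eta>\<in>M. inner_on X \<eta> (\<lambda>x. \<phi> x - \<psi> x) = 0))"

text \<open>The operator \<open>g(H)\<close>, through the spectral decomposition of \<open>H\<close>. This is meant for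
  finite \<open>X\<close> and \<open>H\<close> self-adjoint on \<open>\<ell>\<^sup>2(X)\<close>, so that all eigenvalues are real and
  there are only finitely many of them.\<close>

definition functional_calculus ::
  "'a set \<Rightarrow> (('a \<Rightarrow> complex) \<Rightarrow> 'a \<Rightarrow> complex) \<Rightarrow> (real \<Rightarrow> complex) \<Rightarrow>
   ('a \<Rightarrow> complex) \<Rightarrow> 'a \<Rightarrow> complex" where
  "functional_calculus X H g \<phi> =
     (\<lambda>x. \<Sum>E\<in>eigenvalues X H. g E * orth_proj X (eigenspace X H E) \<phi> x)"

definition is_spectral_measure ::
  "'a set \<Rightarrow> (('a \<Rightarrow> complex) \<Rightarrow> 'a \<Rightarrow> complex) \<Rightarrow> 'a \<Rightarrow> real measure \<Rightarrow> bool" where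
  "is_spectral_measure X H v \<mu> \<longleftrightarrow>
     sets \<mu> = sets borel \<and> finite_measure \<mu> \<and>
     (\<forall>g :: real \<Rightarrow> complex. g \<in> borel_measurable borel \<and> bounded (range g) \<longrightarrow>
        inner_on X (delta v) (functional_calculus X H g (delta v)) = integral\<^sup>L \<mu> g)"

definition spectral_measure ::
  "'a set \<Rightarrow> (('a \<Rightarrow> complex) \<Rightarrow> 'a \<Rightarrow> complex) \<Rightarrow> 'a \<Rightarrow> real measure" where
  "spectral_measure X H v = (THE \<mu>. is_spectral_measure X H v \<mu>)"


section \<open>Schroedinger operators on finite graphs\<close>

text \<open>A finite simple graph is a \<^locale>\<open>pair_graph\<close>; each edge is stored as its two arcs.\<close>

definition schroedinger ::
  "'a pair_pre_digraph \<Rightarrow> ('a \<Rightarrow> real) \<Rightarrow> ('a \<Rightarrow> complex) \<Rightarrow> 'a \<Rightarrow> complex" where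
  "schroedinger G V \<phi> =
     (\<lambda>v. if v \<in> pverts G
          then (\<Sum>v' | (v, v') \<in> parcs G. \<phi> v' - \<phi> v) + complex_of_real (V v) * \<phi> v
          else 0)"

definition schroedinger_spectral_measure ::
  "'a pair_pre_digraph \<Rightarrow> ('a \<Rightarrow> real) \<Rightarrow> 'a \<Rightarrow> real measure" where
  "schroedinger_spectral_measure G V v = spectral_measure (pverts G) (schroedinger G V) v"

text \<open>Potentials are total functions, of which only the values on the vertices matter.\<close>

definition asymptotically_dense_delocalization :: "'a pair_pre_digraph set \<Rightarrow> bool" where
  "asymptotically_dense_delocalization \<F> \<longleftrightarrow>
     (\<forall>G\<in>\<F>. pair_graph G) \<and>
     (\<forall>\<Lambda>>0. \<forall>\<epsilon>>0. \<forall>\<delta>>0. \<exists>N\<^sub>0::nat. N\<^sub>0 > 0 \<and>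
       (\<forall>G\<in>\<F>. card (pverts G) > N\<^sub>0 \<longrightarrow>
         (\<forall>V. V \<in> pverts G \<rightarrow> {-\<Lambda>..\<Lambda>} \<longrightarrow>
           (\<exists>W. W \<in> pverts G \<rightarrow> {-\<Lambda>..\<Lambda>} \<and>
             (SUP v\<in>pverts G. \<bar>V v - W v\<bar>) < \<delta> \<and>
             real (card {v \<in> pverts G.
               \<not> (\<exists>E. measure (schroedinger_spectral_measure G W v) {E} > \<epsilon>)})
               \<ge> (1 - \<delta>) * real (card (pverts G))))))"


section \<open>Box graphs\<close>

text \<open>Points of \<open>\<int>\<^sup>d\<close> are functions on the index set \<open>{..<d}\<close>, extensional outside it;
  the distance is the Euclidean one.\<close>

definition box_vertices :: "nat \<Rightarrow> nat \<Rightarrow> (nat \<Rightarrow> int) set" where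
  "box_vertices d N = {..<d} \<rightarrow>\<^sub>E {1..int N}"

definition box_graph :: "nat \<Rightarrow> nat \<Rightarrow> (nat \<Rightarrow> int) pair_pre_digraph" where
  "box_graph d N =
     \<lparr> pverts = box_vertices d N,
       parcs = {(x, y). x \<in> box_vertices d N \<and> y \<in> box_vertices d N \<and>
                        L2_set (\<lambda>i. real_of_int (x i - y i)) {..<d} = 1} \<rparr>"

end

theory Submission
  imports Defs
begin

text \<open>
  For a bounded smooth \<open>f\<close>, the derivative of \<open>tr f(H\<^sub>W)\<close> with respect to \<open>W(v)\<close> is the integral of \<open>f'\<close>
  against the spectral measure \<open>\<sigma>\<^sub>v\<close>. Since \<open>|tr f(H\<^sub>W)| \<le> n sup |f|\<close>, ascending along the gradient
  reaches, within sup distance of order \<open>sup |f|\<close>, a potential for which \<open>\<integral>f' d\<sigma>\<^sub>v\<close> is small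
  at most \<open>v\<close>. A rapidly oscillating \<open>f\<close> has small sup norm although \<open>f'\<close> is nearly a \<open>\<plusminus>1\<close> valued
  square wave, so this halves \<open>\<sigma>\<^sub>v\<close> between the two signs. Repeating it with \<open>f' = \<rho> \<cdot> wave\<close>, where \<open>\<rho>\<close>
  localizes to one of the pieces obtained so far, splits \<open>\<sigma>\<^sub>v\<close> into \<open>2\<^sup>r\<close> pieces of equal mass. An atom
  sits in one piece and is therefore small, unless it lies in one of the short windows where some wave
  changes sign. In a box these windows carry few eigenvalues: a solution of the eigenvalue equation
  is determined by its values on two adjacent layers, and quantitatively so on a slab of bounded thickness.
\<close>

section \<open>Eigenbases of real symmetric operators\<close>

text \<open>Three circularities have to be broken. The potential reached by one ascent is the start
  of the next, which may spoil what was already flat; so every ascent travels less than the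
  Lipschitz constants of all earlier functions tolerate, and the frequency is raised until the sup
  norm of the new primitive allows so short a path. The windows where a wave changes sign must be
  thin, which needs a steep wave, while the ascent needs a small primitive; \<open>wave c a\<close>
  separates the two demands, since its primitive is bounded by pi / a for every c > 1, so
  \<open>a\<close> is chosen for the ascent and c afterwards for the windows. Finally, all functions
  must be fixed before the graph and the final potential are known; hence the estimates for paths
  and windows are uniform in the size of the graph and in the potentials concerned. One split halves
  the mass, but outside the windows one of the pieces keeps at least 3/4 of the height, so r rounds
  bound an atom by a multiple of (2/3)^r.\<close>

lemma homogeneous_system_nontrivial:
  fixes M :: "'k \<Rightarrow> 'x \<Rightarrow> real"
  assumes "finite S" "finite K" "card S < card K"
  shows "\<exists>c. (\<exists>k\<in>K. c k \<noteq> 0) \<and> (\<forall>x\<in>S. (\<Sum>k\<in>K. c k * M k x) = 0)"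
  using assms
proof (induction S arbitrary: K M rule: finite_induct)
  case empty
  then have "K \<noteq> {}" by auto
  then show ?case by (intro exI[of _ "\<lambda>_. 1"]) auto
next
  case (insert s S)
  show ?case
  proof (cases "\<forall>k\<in>K. M k s = 0")
    case True
    have "card S < card K" using insert by simp
    from insert.IH[OF insert.prems(1) this, of M] True show ?thesis by auto
  next
    case False
    then obtain j where j: "j \<in> K" "M j s \<noteq> 0" by auto
    \<comment> \<open>One round of Gaussian elimination: vector j is the pivot for coordinate s,
      \<open>M'\<close> is the rest with that coordinate cleared, and \<open>c'\<close> gives j the
      coefficient that accounts for the subtraction.\<close>
    define K' where "K' = K - {j}"
    define M' where "M' k x = M k x - M k s / M j s * M j x" for k x
    have fK': "finite K'" and "card S < card K'"
      using insert j by (auto simp: K'_def)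
    from insert.IH[OF this, of M'] obtain c where
      c: "\<exists>k\<in>K'. c k \<noteq> 0" "\<forall>x\<in>S. (\<Sum>k\<in>K'. c k * M' k x) = 0" by auto
    define c' where "c' = c(j := - (\<Sum>k\<in>K'. c k * M k s / M j s))"
    have K: "K = insert j K'" "j \<notin> K'" using j by (auto simp: K'_def)
    have sum_eq: "(\<Sum>k\<in>K. c' k * M k x) = (\<Sum>k\<in>K'. c k * M' k x)" for x
    proof -
      have "(\<Sum>k\<in>K. c' k * M k x) = c' j * M j x + (\<Sum>k\<in>K'. c' k * M k x)"
        using K fK' by simp
      also have "(\<Sum>k\<in>K'. c' k * M k x) = (\<Sum>k\<in>K'. c k * M k x)"
        using K by (intro sum.cong) (auto simp: c'_def)
      also have "c' j * M j x = - (\<Sum>k\<in>K'. c k * (M k s / M j s * M j x))"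
        by (simp add: c'_def sum_distrib_right mult.assoc)
      finally show ?thesis
        by (simp add: M'_def sum_subtractf right_diff_distrib)
    qed
    have "\<exists>k\<in>K. c' k \<noteq> 0" using c(1) K by (auto simp: c'_def)
    moreover have "M' k s = 0" for k using j by (simp add: M'_def)
    ultimately show ?thesis using c(2) sum_eq by (intro exI[of _ c']) auto
  qed
qed

text \<open>The vectors are labelled by X itself, used merely as an index set of the right size. The
  first two clauses make \<psi> an orthogonal matrix, by rows and by columns; values off X are
  unconstrained.\<close>

definition eigenbasis ::
  "'a set \<Rightarrow> ('a \<Rightarrow> 'a \<Rightarrow> real) \<Rightarrow> ('a \<Rightarrow> 'a \<Rightarrow> real) \<Rightarrow> ('a \<Rightarrow> real) \<Rightarrow> bool" where
  "eigenbasis X A \<psi> E \<longleftrightarrow>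
     (\<forall>k\<in>X. \<forall>l\<in>X. (\<Sum>x\<in>X. \<psi> k x * \<psi> l x) = of_bool (k = l)) \<and>
     (\<forall>x\<in>X. \<forall>y\<in>X. (\<Sum>k\<in>X. \<psi> k x * \<psi> k y) = of_bool (x = y)) \<and>
     (\<forall>k\<in>X. \<forall>x\<in>X. (\<Sum>y\<in>X. A x y * \<psi> k y) = E k * \<psi> k x)"

text \<open>Adjoining the delta function at y to card X orthonormal vectors forces a linear
  dependence. Pairing it with each vector expresses all coefficients through that of the delta
  function, which therefore cannot vanish.\<close>

lemma orthonormal_complete:
  fixes \<psi> :: "'a \<Rightarrow> 'a \<Rightarrow> real"
  assumes X: "finite X"
    and on: "\<And>k l. k \<in> X \<Longrightarrow> l \<in> X \<Longrightarrow> (\<Sum>x\<in>X. \<psi> k x * \<psi> l x) = of_bool (k = l)"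
    and y: "y \<in> X" and z: "z \<in> X"
  shows "(\<Sum>k\<in>X. \<psi> k y * \<psi> k z) = of_bool (y = z)"
proof -
  define M where "M k x = (case k of None \<Rightarrow> of_bool (x = y) | Some k \<Rightarrow> \<psi> k x)" for k x
  let ?K = "insert None (Some ` X)"
  have "card X < card ?K" using X by (simp add: card_image)
  from homogeneous_system_nontrivial[OF X _ this, of M] X obtain c where
    c: "\<exists>k\<in>?K. c k \<noteq> 0" "\<forall>x\<in>X. (\<Sum>k\<in>?K. c k * M k x) = 0" by auto
  have rel: "c None * of_bool (x = y) + (\<Sum>k\<in>X. c (Some k) * \<psi> k x) = 0" if "x \<in> X" for x
    using c(2) that X by (simp add: M_def sum.reindex)
  have coeff: "c (Some l) = - c None * \<psi> l y" if l: "l \<in> X" for l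
  proof -
    have "0 = (\<Sum>x\<in>X. \<psi> l x * (c None * of_bool (x = y) + (\<Sum>k\<in>X. c (Some k) * \<psi> k x)))"
      using rel by simp
    also have "\<dots> = (\<Sum>x\<in>X. \<psi> l x * (c None * of_bool (x = y)))
        + (\<Sum>x\<in>X. \<Sum>k\<in>X. c (Some k) * (\<psi> l x * \<psi> k x))"
      by (simp add: distrib_left sum.distrib sum_distrib_left mult_ac)
    also have "(\<Sum>x\<in>X. \<psi> l x * (c None * of_bool (x = y))) = c None * \<psi> l y"
      using X y by (simp add: of_bool_def if_distrib sum.delta cong: if_cong)
    also have "(\<Sum>x\<in>X. \<Sum>k\<in>X. c (Some k) * (\<psi> l x * \<psi> k x))
        = (\<Sum>k\<in>X. c (Some k) * (\<Sum>x\<in>X. \<psi> l x * \<psi> k x))"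
      by (subst sum.swap) (simp add: sum_distrib_left)
    also have "\<dots> = (\<Sum>k\<in>X. c (Some k) * of_bool (l = k))"
      using on l by (intro sum.cong) auto
    also have "\<dots> = c (Some l)"
      using X l by (simp add: of_bool_def if_distrib sum.delta cong: if_cong)
    finally show ?thesis by simp
  qed
  have "c None \<noteq> 0" using c(1) coeff by auto
  moreover have "c None * (of_bool (z = y) - (\<Sum>k\<in>X. \<psi> k y * \<psi> k z)) = 0"
  proof -
    have "(\<Sum>k\<in>X. c (Some k) * \<psi> k z) = - c None * (\<Sum>k\<in>X. \<psi> k y * \<psi> k z)"
      by (simp add: coeff sum_distrib_left mult.assoc)
    then show ?thesis using rel[OF z] by (simp add: algebra_simps)
  qed
  ultimately show ?thesis by (simp only: mult_eq_0_iff eq_commute[of z y]) simp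
qed

text \<open>The domain for maximizing a quadratic form. Vectors are total functions, and pinning
  them to 0 off X makes the cube compact in the product topology.\<close>

lemma compact_zero_extended_cube:
  "compact {\<phi> :: 'a \<Rightarrow> real. \<forall>x. \<phi> x \<in> (if x \<in> X then {-1..1} else {0})}"
proof -
  have "compactin (product_topology (\<lambda>i. euclidean) UNIV)
      (\<Pi>\<^sub>E x\<in>(UNIV::'a set). (if x \<in> X then {-1..1} else {0::real}))"
    by (subst compactin_PiE) auto
  then have "compact (\<Pi>\<^sub>E x\<in>(UNIV::'a set). (if x \<in> X then {-1..1} else {0::real}))"
    by (simp add: euclidean_product_topology)
  then show ?thesis by (simp add: PiE_def Pi_def)
qed

lemma symmetric_form_swap:
  fixes A :: "'a \<Rightarrow> 'a \<Rightarrow> real"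
  assumes "\<And>x y. x \<in> X \<Longrightarrow> y \<in> X \<Longrightarrow> A x y = A y x"
  shows "(\<Sum>x\<in>X. u x * (\<Sum>y\<in>X. A x y * v y)) = (\<Sum>x\<in>X. (\<Sum>y\<in>X. A x y * u y) * v x)"
proof -
  have "(\<Sum>x\<in>X. u x * (\<Sum>y\<in>X. A x y * v y)) = (\<Sum>y\<in>X. \<Sum>x\<in>X. u x * (A x y * v y))"
    by (subst sum.swap) (simp add: sum_distrib_left)
  also have "\<dots> = (\<Sum>x\<in>X. (\<Sum>y\<in>X. A x y * u y) * v x)"
    unfolding sum_distrib_right
    by (intro sum.cong refl) (simp add: assms mult_ac)
  finally show ?thesis .
qed

text \<open>A maximizer of the quadratic form on the unit sphere of the orthogonal complement of the
  eigenvectors found so far is an eigenvector, because symmetry keeps that complement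
  invariant.\<close>

lemma next_eigenvector:
  fixes A :: "'a \<Rightarrow> 'a \<Rightarrow> real" and \<psi> :: "'a \<Rightarrow> 'a \<Rightarrow> real"
  assumes X: "finite X" and K: "K \<subseteq> X" "card K < card X"
    and sym: "\<And>x y. x \<in> X \<Longrightarrow> y \<in> X \<Longrightarrow> A x y = A y x"
    and eig: "\<And>k x. k \<in> K \<Longrightarrow> x \<in> X \<Longrightarrow> (\<Sum>y\<in>X. A x y * \<psi> k y) = E k * \<psi> k x"
  shows "\<exists>\<phi> e. (\<Sum>x\<in>X. \<phi> x * \<phi> x) = 1 \<and> (\<forall>k\<in>K. (\<Sum>x\<in>X. \<psi> k x * \<phi> x) = 0) \<and>
    (\<forall>x\<in>X. (\<Sum>y\<in>X. A x y * \<phi> y) = e * \<phi> x)"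
proof -
  define sp where "sp u v = (\<Sum>x\<in>X. u x * v x)" for u v :: "'a \<Rightarrow> real"
  define ap where "ap u = (\<lambda>x. \<Sum>y\<in>X. A x y * u y)" for u
  have lin: "sp (\<lambda>x. u x + t * w x) v = sp u v + t * sp w v"
       "sp v (\<lambda>x. u x + t * w x) = sp v u + t * sp v w"
       "sp v (\<lambda>x. t * w x) = t * sp v w" "sp (\<lambda>x. t * w x) v = t * sp w v" for u v w t
    by (simp_all add: sp_def algebra_simps sum.distrib sum_distrib_left)
  have aplin: "ap (\<lambda>x. u x + t * w x) = (\<lambda>x. ap u x + t * ap w x)"
     "ap (\<lambda>x. t * w x) = (\<lambda>x. t * ap w x)" for u w t
    by (simp_all add: ap_def algebra_simps sum.distrib sum_distrib_left)
  have sp_ap: "sp u (ap v) = sp (ap u) v" for u v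
    unfolding sp_def ap_def by (rule symmetric_form_swap[OF sym])
  have sp_comm: "sp u v = sp v u" for u v by (simp add: sp_def mult.commute)
  have sp_cong: "sp u v = sp u' v'" if "\<And>x. x \<in> X \<Longrightarrow> u x = u' x" "\<And>x. x \<in> X \<Longrightarrow> v x = v' x" for u v u' v'
    using that by (auto simp: sp_def)
  have ap_cong: "ap u = ap v" if "\<And>x. x \<in> X \<Longrightarrow> u x = v x" for u v
    using that by (auto simp: ap_def)
  have sp_pos: "sp u u \<ge> 0" for u by (simp add: sp_def sum_nonneg)
  have sp_zero: "u x = 0" if "sp u u = 0" "x \<in> X" for u x
    using that X by (simp add: sp_def sum_nonneg_eq_0_iff)
  define U where "U = {\<phi>. \<forall>x. \<phi> x \<in> (if x \<in> X then {-1..1::real} else {0})}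
      \<inter> ({\<phi>. sp \<phi> \<phi> = 1} \<inter> (\<Inter>k\<in>K. {\<phi>. sp (\<psi> k) \<phi> = 0}))"
  have cont: "continuous_on UNIV (\<lambda>\<phi>. sp (f \<phi>) (g \<phi>))"
    if "\<And>x. continuous_on UNIV (\<lambda>\<phi>. f \<phi> x)" "\<And>x. continuous_on UNIV (\<lambda>\<phi>. g \<phi> x)"
    for f g :: "('a \<Rightarrow> real) \<Rightarrow> ('a \<Rightarrow> real)"
    unfolding sp_def using that by (intro continuous_intros)
  have contap: "continuous_on UNIV (\<lambda>\<phi>. ap \<phi> x)" for x
    unfolding ap_def by (intro continuous_intros) auto
  have "compact U"
    unfolding U_def
    by (intro compact_Int_closed compact_zero_extended_cube closed_Int closed_INT ballI closed_Collect_eq cont)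
       (auto intro: continuous_intros)
  have norm_in: "\<exists>t>0. (\<lambda>x. t * (if x \<in> X then u x else 0)) \<in> U \<and> t * t * sp u u = 1"
    if u: "sp u u \<noteq> 0" "\<And>k. k \<in> K \<Longrightarrow> sp (\<psi> k) u = 0" for u
  proof -
    have pos: "sp u u > 0" using u sp_pos[of u] by simp
    define t where "t = 1 / sqrt (sp u u)"
    have t: "t > 0" "t * t * sp u u = 1"
      using pos by (auto simp: t_def)
    let ?u = "\<lambda>x. t * (if x \<in> X then u x else 0)"
    have s1: "sp ?u ?u = 1"
    proof -
      have "sp ?u ?u = sp (\<lambda>x. t * u x) (\<lambda>x. t * u x)" by (rule sp_cong) auto
      then show ?thesis using t by (simp add: lin)
    qed
    have "sp (\<psi> k) ?u = 0" if "k \<in> K" for k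
    proof -
      have "sp (\<psi> k) ?u = sp (\<psi> k) (\<lambda>x. t * u x)" by (rule sp_cong) auto
      then show ?thesis using u that by (simp add: lin)
    qed
    moreover have "\<bar>?u x\<bar> \<le> 1" if "x \<in> X" for x
    proof -
      have "?u x * ?u x \<le> sp ?u ?u" unfolding sp_def
        by (rule member_le_sum[OF that _ X]) auto
      then have "(?u x)\<^sup>2 \<le> 1" using s1 by (simp add: power2_eq_square)
      then show ?thesis using abs_square_le_1 by blast
    qed
    ultimately have "?u \<in> U" using s1 by (auto simp: U_def abs_le_iff)
    then show ?thesis using t by blast
  qed
  have fK: "finite K" using K X finite_subset by auto
  \<comment> \<open>Fewer than card X orthogonality conditions leave a nonzero vector, so the sphere
    is nonempty.\<close>
  obtain c where c: "\<exists>k\<in>X. c k \<noteq> 0" "\<forall>k\<in>K. (\<Sum>x\<in>X. c x * \<psi> k x) = 0"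
    using homogeneous_system_nontrivial[OF fK X K(2), of "\<lambda>x k. \<psi> k x"] by auto
  have "sp c c \<noteq> 0" using c(1) sp_zero by blast
  moreover have "sp (\<psi> k) c = 0" if "k \<in> K" for k using c(2) that by (simp add: sp_def mult.commute)
  ultimately have "U \<noteq> {}" using norm_in[of c] by auto
  moreover have "continuous_on U (\<lambda>\<phi>. sp \<phi> (ap \<phi>))"
    by (rule continuous_on_subset[OF cont]) (auto simp: contap)
  ultimately obtain \<phi> where \<phi>: "\<phi> \<in> U" and mx: "\<And>u. u \<in> U \<Longrightarrow> sp u (ap u) \<le> sp \<phi> (ap \<phi>)"
    using continuous_attains_sup[OF \<open>compact U\<close>] by blast
  define e where "e = sp \<phi> (ap \<phi>)"
  have \<phi>1: "sp \<phi> \<phi> = 1" and \<phi>K: "\<And>k. k \<in> K \<Longrightarrow> sp (\<psi> k) \<phi> = 0" using \<phi> by (auto simp: U_def)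
  have ray: "sp u (ap u) \<le> e * sp u u" if orth: "\<And>k. k \<in> K \<Longrightarrow> sp (\<psi> k) u = 0" for u
  proof (cases "sp u u = 0")
    case True
    then have "sp u (ap u) = sp (\<lambda>x. 0) (ap u)" by (intro sp_cong) (auto simp: sp_zero)
    then show ?thesis using True by (simp add: sp_def)
  next
    case False
    from norm_in[OF this orth] obtain t where t: "t > 0" "t * t * sp u u = 1"
      "(\<lambda>x. t * (if x \<in> X then u x else 0)) \<in> U" by auto
    let ?u = "\<lambda>x. t * (if x \<in> X then u x else 0)"
    have "ap ?u = ap (\<lambda>x. t * u x)" by (rule ap_cong) auto
    then have "sp ?u (ap ?u) = sp (\<lambda>x. t * u x) (ap (\<lambda>x. t * u x))" by (intro sp_cong) auto
    also have "\<dots> = t * t * sp u (ap u)" by (simp add: aplin lin)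
    finally have "t * t * sp u (ap u) \<le> e * (t * t * sp u u)"
      using mx[OF t(3)] t(2) by (simp add: e_def)
    then have "t * t * sp u (ap u) \<le> t * t * (e * sp u u)" by (simp add: mult_ac)
    then show ?thesis using t(1) by simp
  qed
  \<comment> \<open>The residual of \<phi> is again orthogonal to the old eigenvectors and serves as
    direction of variation: along \<open>\<phi> + t w\<close> the form minus e times the squared
    norm equals \<open>2 t b + t t c\<close>, and this can stay nonpositive for all t only if b =
    0.\<close>
  define w where "w = (\<lambda>x. ap \<phi> x + (- e) * \<phi> x)"
  have wK: "sp (\<psi> k) w = 0" if k: "k \<in> K" for k
  proof -
    have "sp (\<psi> k) (ap \<phi>) = sp (\<lambda>x. E k * \<psi> k x) \<phi>"
      unfolding sp_ap by (rule sp_cong) (auto simp: ap_def eig[OF k])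
    then show ?thesis unfolding w_def lin(2) by (simp add: lin \<phi>K[OF k])
  qed
  define b where "b = sp w w"
  define c where "c = sp w (ap w) - e * sp w w"
  have ineq: "2 * t * b + t * t * c \<le> 0" for t
  proof -
    have "sp (\<lambda>x. \<phi> x + t * w x) (ap (\<lambda>x. \<phi> x + t * w x))
        \<le> e * sp (\<lambda>x. \<phi> x + t * w x) (\<lambda>x. \<phi> x + t * w x)"
      by (rule ray) (simp add: lin \<phi>K wK)
    moreover have "sp \<phi> (ap w) = sp w (ap \<phi>)" by (simp only: sp_ap[of \<phi> w] sp_comm[of "ap \<phi>" w])
    moreover have "sp w (ap \<phi>) = b + e * sp w \<phi>"
    proof -
      have "b = sp w (ap \<phi>) + (-e) * sp w \<phi>" unfolding b_def by (subst (2) w_def) (rule lin(2))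
      then show ?thesis by simp
    qed
    ultimately show ?thesis
      by (simp add: aplin lin \<phi>1 e_def[symmetric] sp_comm[of \<phi> w] c_def algebra_simps)
  qed
  have "b = 0"
  proof (rule ccontr)
    assume "b \<noteq> 0"
    then have b: "b > 0" using sp_pos by (simp add: b_def less_le)
    define t where "t = b / (\<bar>c\<bar> + 1)"
    have t: "t > 0" using b by (simp add: t_def add_nonneg_pos)
    have tc: "t * (\<bar>c\<bar> + 1) = b" by (simp add: t_def add_nonneg_eq_0_iff)
    have "t * \<bar>c\<bar> < b" using tc t by (simp add: algebra_simps)
    then have "2 * b + t * c > 0"
    proof -
      have "t * - \<bar>c\<bar> \<le> t * c" using t by (intro mult_left_mono) auto
      with b \<open>t * \<bar>c\<bar> < b\<close> show ?thesis by simp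
    qed
    then have "t * (2 * b + t * c) > 0" using t by simp
    then show False using ineq[of t] by (simp add: algebra_simps)
  qed
  then have "ap \<phi> x = e * \<phi> x" if "x \<in> X" for x
    using sp_zero[of w x] that by (simp add: b_def w_def)
  then show ?thesis using \<phi>1 \<phi>K unfolding sp_def ap_def by blast
qed

theorem ex_eigenbasis:
  fixes A :: "'a \<Rightarrow> 'a \<Rightarrow> real"
  assumes X: "finite X" and sym: "\<And>x y. x \<in> X \<Longrightarrow> y \<in> X \<Longrightarrow> A x y = A y x"
  shows "\<exists>\<psi> E. eigenbasis X A \<psi> E"
proof -
  have "\<exists>\<psi> E. (\<forall>k\<in>K. \<forall>l\<in>K. (\<Sum>x\<in>X. \<psi> k x * \<psi> l x) = of_bool (k = l)) \<and>
      (\<forall>k\<in>K. \<forall>x\<in>X. (\<Sum>y\<in>X. A x y * \<psi> k y) = E k * \<psi> k x)" if "K \<subseteq> X" for K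
    using finite_subset[OF that X] that
  proof (induction K rule: finite_induct)
    case (insert j K)
    then obtain \<psi> E where
      on: "\<forall>k\<in>K. \<forall>l\<in>K. (\<Sum>x\<in>X. \<psi> k x * \<psi> l x) = of_bool (k = l)" and
      eig: "\<forall>k\<in>K. \<forall>x\<in>X. (\<Sum>y\<in>X. A x y * \<psi> k y) = E k * \<psi> k x"
      by blast
    have KX: "K \<subseteq> X" and "card K < card X"
      using insert X by (auto intro!: psubset_card_mono)
    have "\<exists>\<phi> e. (\<Sum>x\<in>X. \<phi> x * \<phi> x) = 1 \<and> (\<forall>k\<in>K. (\<Sum>x\<in>X. \<psi> k x * \<phi> x) = 0) \<and>
        (\<forall>x\<in>X. (\<Sum>y\<in>X. A x y * \<phi> y) = e * \<phi> x)"
      by (rule next_eigenvector[OF X \<open>K \<subseteq> X\<close> \<open>card K < card X\<close> sym, where E = E and \<psi> = \<psi>]) (use eig in blast)+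
    then obtain \<phi> e where
      \<phi>: "(\<Sum>x\<in>X. \<phi> x * \<phi> x) = 1" "\<And>k. k \<in> K \<Longrightarrow> (\<Sum>x\<in>X. \<psi> k x * \<phi> x) = 0"
        "\<And>x. x \<in> X \<Longrightarrow> (\<Sum>y\<in>X. A x y * \<phi> y) = e * \<phi> x"
      by blast
    have \<phi>': "(\<Sum>x\<in>X. \<phi> x * \<psi> k x) = 0" if "k \<in> K" for k
      using \<phi>(2)[OF that] by (simp add: mult.commute)
    show ?case
      using on eig \<phi> \<phi>' insert.hyps
      by (intro exI[of _ "\<psi>(j := \<phi>)"] exI[of _ "E(j := e)"]) auto
  qed simp
  from this[OF order.refl] obtain \<psi> E where
    on: "\<forall>k\<in>X. \<forall>l\<in>X. (\<Sum>x\<in>X. \<psi> k x * \<psi> l x) = of_bool (k = l)" and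
    eig: "\<forall>k\<in>X. \<forall>x\<in>X. (\<Sum>y\<in>X. A x y * \<psi> k y) = E k * \<psi> k x"
    by blast
  have "(\<Sum>k\<in>X. \<psi> k y * \<psi> k z) = of_bool (y = z)" if "y \<in> X" "z \<in> X" for y z
    by (rule orthonormal_complete[OF X _ that]) (rule on[rule_format])
  with on eig have "eigenbasis X A \<psi> E" unfolding eigenbasis_def by simp
  then show ?thesis by blast
qed

section \<open>Perturbation by a diagonal matrix\<close>

definition add_diag :: "('a \<Rightarrow> 'a \<Rightarrow> real) \<Rightarrow> ('a \<Rightarrow> real) \<Rightarrow> 'a \<Rightarrow> 'a \<Rightarrow> real" where
  "add_diag A W x y = A x y + of_bool (x = y) * W x"

text \<open>Weights and nodes are arbitrary, so that inequalities between means can be stated before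
  the potential and its eigenbasis are known.\<close>

definition weighted_sum :: "'a set \<Rightarrow> ('a \<Rightarrow> real) \<Rightarrow> ('a \<Rightarrow> real) \<Rightarrow> (real \<Rightarrow> real) \<Rightarrow> real" where
  "weighted_sum X p e q = (\<Sum>k\<in>X. p k * q (e k))"

text \<open>The integral of q against the spectral measure at v, that is the diagonal entry of q(H)
  at v, written in an eigenbasis.\<close>

definition local_mean ::
  "'a set \<Rightarrow> ('a \<Rightarrow> 'a \<Rightarrow> real) \<Rightarrow> ('a \<Rightarrow> real) \<Rightarrow> (real \<Rightarrow> real) \<Rightarrow> 'a \<Rightarrow> real" where
  "local_mean X \<psi> E q v = weighted_sum X (\<lambda>k. (\<psi> k v)\<^sup>2) E q"

lemma sum_of_bool_mult:
  fixes f :: "'a \<Rightarrow> real"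
  assumes "finite X" "y \<in> X"
  shows "(\<Sum>x\<in>X. f x * of_bool (x = y)) = f y" "(\<Sum>x\<in>X. of_bool (x = y) * f x) = f y"
    "(\<Sum>x\<in>X. f x * of_bool (y = x)) = f y" "(\<Sum>x\<in>X. of_bool (y = x) * f x) = f y"
proof -
  have "(\<Sum>x\<in>X. f x * of_bool (x = y)) = (\<Sum>x\<in>X. if x = y then f x else 0)"
    by (rule sum.cong) auto
  also have "\<dots> = f y" using assms by simp
  finally show 1: "(\<Sum>x\<in>X. f x * of_bool (x = y)) = f y" .
  then show 2: "(\<Sum>x\<in>X. of_bool (x = y) * f x) = f y" by (simp add: mult.commute)
  have "(y = x) = (x = y)" for x by auto
  with 1 2 show "(\<Sum>x\<in>X. f x * of_bool (y = x)) = f y" "(\<Sum>x\<in>X. of_bool (y = x) * f x) = f y"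
    by simp_all
qed

lemma parseval:
  assumes X: "finite X" and eb: "eigenbasis X B \<phi> F"
  shows "(\<Sum>l\<in>X. (\<Sum>x\<in>X. u x * \<phi> l x) * (\<Sum>x\<in>X. w x * \<phi> l x)) = (\<Sum>x\<in>X. u x * w x)"
proof -
  have comp: "\<And>x y. x \<in> X \<Longrightarrow> y \<in> X \<Longrightarrow> (\<Sum>l\<in>X. \<phi> l x * \<phi> l y) = of_bool (x = y)"
    using eb by (simp add: eigenbasis_def)
  have "(\<Sum>l\<in>X. (\<Sum>x\<in>X. u x * \<phi> l x) * (\<Sum>x\<in>X. w x * \<phi> l x))
      = (\<Sum>l\<in>X. \<Sum>x\<in>X. \<Sum>y\<in>X. u x * w y * (\<phi> l x * \<phi> l y))"
    by (simp add: sum_product mult_ac)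
  also have "\<dots> = (\<Sum>x\<in>X. \<Sum>l\<in>X. \<Sum>y\<in>X. u x * w y * (\<phi> l x * \<phi> l y))"
    by (rule sum.swap)
  also have "\<dots> = (\<Sum>x\<in>X. \<Sum>y\<in>X. \<Sum>l\<in>X. u x * w y * (\<phi> l x * \<phi> l y))"
    by (intro sum.cong refl sum.swap)
  also have "\<dots> = (\<Sum>x\<in>X. \<Sum>y\<in>X. u x * w y * of_bool (x = y))"
    by (intro sum.cong refl) (simp only: sum_distrib_left[symmetric] comp)
  also have "\<dots> = (\<Sum>x\<in>X. u x * w x)"
    using sum_of_bool_mult(3)[OF X] by (intro sum.cong refl) simp
  finally show ?thesis .
qed

lemma local_mean_abs_le:
  assumes X: "finite X" and eb: "eigenbasis X B \<psi> E" and v: "v \<in> X"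
    and q: "\<And>x. \<bar>q x\<bar> \<le> b"
  shows "\<bar>local_mean X \<psi> E q v\<bar> \<le> b"
proof -
  have "\<bar>local_mean X \<psi> E q v\<bar> \<le> (\<Sum>k\<in>X. \<bar>(\<psi> k v)\<^sup>2 * q (E k)\<bar>)"
    unfolding local_mean_def weighted_sum_def by (rule sum_abs)
  also have "\<dots> \<le> (\<Sum>k\<in>X. (\<psi> k v)\<^sup>2 * b)"
    using q by (intro sum_mono) (simp add: abs_mult mult_left_mono)
  also have "\<dots> = (\<Sum>k\<in>X. \<psi> k v * \<psi> k v) * b"
    by (simp add: sum_distrib_right power2_eq_square)
  also have "\<dots> = b" using eb v by (simp add: eigenbasis_def)
  finally show ?thesis .
qed

lemma weighted_sum_add: "weighted_sum X p e (\<lambda>x. q x + r x) = weighted_sum X p e q + weighted_sum X p e r"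
  by (simp add: weighted_sum_def distrib_left sum.distrib)

lemma weighted_sum_cmult: "weighted_sum X p e (\<lambda>x. c * q x) = c * weighted_sum X p e q"
  by (simp add: weighted_sum_def sum_distrib_left mult_ac)

section \<open>Comparing the eigenbases of two potentials\<close>

locale two_potentials =
  fixes X :: "'a set" and A :: "'a \<Rightarrow> 'a \<Rightarrow> real"
    and W \<psi> E W' \<phi> F
  assumes X: "finite X" and sym: "\<And>x y. x \<in> X \<Longrightarrow> y \<in> X \<Longrightarrow> A x y = A y x"
    and eb: "eigenbasis X (add_diag A W) \<psi> E" and eb': "eigenbasis X (add_diag A W') \<phi> F"
begin

definition overlap :: "'a \<Rightarrow> 'a \<Rightarrow> real" where
  "overlap k l = (\<Sum>x\<in>X. \<psi> k x * \<phi> l x)"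

text \<open>Both operators are evaluated between an old and a new eigenvector; the symmetric part A
  cancels and only the diagonal difference remains. Both moment identities below come from
  this.\<close>

lemma overlap_commutator:
  assumes k: "k \<in> X" and l: "l \<in> X"
  shows "(F l - E k) * overlap k l = (\<Sum>x\<in>X. (W' x - W x) * \<psi> k x * \<phi> l x)"
proof -
  have diag: "(\<Sum>y\<in>X. add_diag A W' x y * u y) - (\<Sum>y\<in>X. add_diag A W x y * u y) = (W' x - W x) * u x"
    if "x \<in> X" for x u
  proof -
    have "(\<Sum>y\<in>X. add_diag A W' x y * u y) - (\<Sum>y\<in>X. add_diag A W x y * u y)
        = (\<Sum>y\<in>X. of_bool (x = y) * ((W' x - W x) * u y))"
      unfolding sum_subtractf[symmetric] by (rule sum.cong) (auto simp: add_diag_def algebra_simps)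
    then show ?thesis using sum_of_bool_mult(4)[OF X that] by simp
  qed
  have "F l * overlap k l = (\<Sum>x\<in>X. \<psi> k x * (\<Sum>y\<in>X. add_diag A W' x y * \<phi> l y))"
    using eb' l by (auto simp: eigenbasis_def overlap_def sum_distrib_left mult_ac intro!: sum.cong)
  moreover have "E k * overlap k l = (\<Sum>x\<in>X. (\<Sum>y\<in>X. add_diag A W x y * \<psi> k y) * \<phi> l x)"
    using eb k by (auto simp: eigenbasis_def overlap_def sum_distrib_left mult_ac intro!: sum.cong)
  moreover have "\<dots> = (\<Sum>x\<in>X. \<psi> k x * (\<Sum>y\<in>X. add_diag A W x y * \<phi> l y))"
    by (rule symmetric_form_swap[symmetric]) (auto simp: add_diag_def sym)
  ultimately have "(F l - E k) * overlap k l
      = (\<Sum>x\<in>X. \<psi> k x * ((\<Sum>y\<in>X. add_diag A W' x y * \<phi> l y) - (\<Sum>y\<in>X. add_diag A W x y * \<phi> l y)))"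
    by (simp add: left_diff_distrib right_diff_distrib sum_subtractf)
  also have "\<dots> = (\<Sum>x\<in>X. (W' x - W x) * \<psi> k x * \<phi> l x)"
    using diag by (intro sum.cong refl) simp
  finally show ?thesis .
qed

lemma sum_overlap_right: "k \<in> X \<Longrightarrow> (\<Sum>l\<in>X. (overlap k l)\<^sup>2) = 1"
  using parseval[OF X eb', of "\<psi> k" "\<psi> k"] eb
  by (simp add: overlap_def power2_eq_square eigenbasis_def)

lemma sum_overlap_left: "l \<in> X \<Longrightarrow> (\<Sum>k\<in>X. (overlap k l)\<^sup>2) = 1"
  using parseval[OF X eb, of "\<phi> l" "\<phi> l"] eb'
  by (simp add: overlap_def power2_eq_square eigenbasis_def mult.commute)

text \<open>First-order perturbation theory, exact once averaged over the new eigenbasis, and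
  therefore valid also where eigenvalues cross.\<close>

lemma sum_overlap_first_moment:
  assumes k: "k \<in> X"
  shows "(\<Sum>l\<in>X. (F l - E k) * (overlap k l)\<^sup>2) = (\<Sum>x\<in>X. (W' x - W x) * (\<psi> k x)\<^sup>2)"
proof -
  have "(\<Sum>l\<in>X. (F l - E k) * (overlap k l)\<^sup>2)
      = (\<Sum>l\<in>X. (\<Sum>x\<in>X. (W' x - W x) * \<psi> k x * \<phi> l x) * (\<Sum>x\<in>X. \<psi> k x * \<phi> l x))"
    using overlap_commutator[OF k]
    by (intro sum.cong refl) (simp add: power2_eq_square mult.assoc[symmetric], simp add: overlap_def)
  also have "\<dots> = (\<Sum>x\<in>X. (W' x - W x) * \<psi> k x * \<psi> k x)"
    by (rule parseval[OF X eb'])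
  finally show ?thesis by (simp add: power2_eq_square mult.assoc)
qed

text \<open>The Hilbert-Schmidt norm of the diagonal matrix s, computed between two different
  orthonormal bases.\<close>

lemma sum_product_form_squares:
  "(\<Sum>k\<in>X. \<Sum>l\<in>X. (\<Sum>x\<in>X. s x * \<psi> k x * \<phi> l x)\<^sup>2) = (\<Sum>x\<in>X. (s x)\<^sup>2)"
proof -
  have "(\<Sum>k\<in>X. \<Sum>l\<in>X. (\<Sum>x\<in>X. s x * \<psi> k x * \<phi> l x)\<^sup>2)
      = (\<Sum>k\<in>X. \<Sum>x\<in>X. (s x * \<psi> k x) * (s x * \<psi> k x))"
    by (rule sum.cong[OF refl]) (simp only: power2_eq_square parseval[OF X eb'])
  also have "\<dots> = (\<Sum>x\<in>X. (s x)\<^sup>2 * (\<Sum>k\<in>X. \<psi> k x * \<psi> k x))"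
    by (subst sum.swap) (simp add: sum_distrib_left power2_eq_square mult_ac)
  also have "\<dots> = (\<Sum>x\<in>X. (s x)\<^sup>2)"
    using eb by (intro sum.cong refl) (simp add: eigenbasis_def)
  finally show ?thesis .
qed

lemma sum_overlap_second_moment:
  "(\<Sum>k\<in>X. \<Sum>l\<in>X. (F l - E k)\<^sup>2 * (overlap k l)\<^sup>2) = (\<Sum>x\<in>X. (W' x - W x)\<^sup>2)"
proof -
  have "(F l - E k)\<^sup>2 * (overlap k l)\<^sup>2 = (\<Sum>x\<in>X. (W' x - W x) * \<psi> k x * \<phi> l x)\<^sup>2"
    if "k \<in> X" "l \<in> X" for k l
    using overlap_commutator[OF that] by (metis power_mult_distrib)
  then have "(\<Sum>k\<in>X. \<Sum>l\<in>X. (F l - E k)\<^sup>2 * (overlap k l)\<^sup>2)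
      = (\<Sum>k\<in>X. \<Sum>l\<in>X. (\<Sum>x\<in>X. (W' x - W x) * \<psi> k x * \<phi> l x)\<^sup>2)"
    by (intro sum.cong refl) auto
  then show ?thesis using sum_product_form_squares[of "\<lambda>x. W' x - W x"] by simp
qed

text \<open>A second-order form of Klein's trace inequality: the scalar Taylor bound is integrated
  against the doubly stochastic weights \<open>(overlap k l)\<^sup>2\<close>.\<close>

lemma trace_second_order_lower_bound:
  assumes taylor: "\<And>x y. f y \<ge> f x + f' x * (y - x) - K * (y - x)\<^sup>2"
  shows "(\<Sum>k\<in>X. f (E k)) + (\<Sum>x\<in>X. (W' x - W x) * local_mean X \<psi> E f' x)
      - K * (\<Sum>x\<in>X. (W' x - W x)\<^sup>2) \<le> (\<Sum>l\<in>X. f (F l))"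
proof -
  let ?c = "\<lambda>k l. (overlap k l)\<^sup>2"
  have "(\<Sum>k\<in>X. \<Sum>l\<in>X. (f (E k) + f' (E k) * (F l - E k) - K * (F l - E k)\<^sup>2) * ?c k l)
      \<le> (\<Sum>k\<in>X. \<Sum>l\<in>X. f (F l) * ?c k l)"
    by (intro sum_mono mult_right_mono taylor) auto
  also have "\<dots> = (\<Sum>l\<in>X. f (F l) * (\<Sum>k\<in>X. ?c k l))"
    by (subst sum.swap) (simp add: sum_distrib_left)
  also have "\<dots> = (\<Sum>l\<in>X. f (F l))" by (simp add: sum_overlap_left)
  finally have 1: "(\<Sum>k\<in>X. \<Sum>l\<in>X. (f (E k) + f' (E k) * (F l - E k) - K * (F l - E k)\<^sup>2) * ?c k l)
      \<le> (\<Sum>l\<in>X. f (F l))" .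
  have "(\<Sum>k\<in>X. \<Sum>l\<in>X. (f (E k) + f' (E k) * (F l - E k) - K * (F l - E k)\<^sup>2) * ?c k l)
      = (\<Sum>k\<in>X. f (E k) * (\<Sum>l\<in>X. ?c k l) + f' (E k) * (\<Sum>l\<in>X. (F l - E k) * ?c k l))
        - K * (\<Sum>k\<in>X. \<Sum>l\<in>X. (F l - E k)\<^sup>2 * ?c k l)"
    by (simp add: sum_distrib_left sum.distrib sum_subtractf algebra_simps)
  also have "(\<Sum>k\<in>X. f (E k) * (\<Sum>l\<in>X. ?c k l) + f' (E k) * (\<Sum>l\<in>X. (F l - E k) * ?c k l))
      = (\<Sum>k\<in>X. f (E k)) + (\<Sum>k\<in>X. f' (E k) * (\<Sum>x\<in>X. (W' x - W x) * (\<psi> k x)\<^sup>2))"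
    by (simp add: sum_overlap_right sum_overlap_first_moment sum.distrib)
  also have "(\<Sum>k\<in>X. f' (E k) * (\<Sum>x\<in>X. (W' x - W x) * (\<psi> k x)\<^sup>2))
      = (\<Sum>x\<in>X. (W' x - W x) * local_mean X \<psi> E f' x)"
    unfolding local_mean_def weighted_sum_def sum_distrib_left
    by (subst sum.swap) (simp add: mult_ac)
  finally show ?thesis using 1 by (simp add: sum_overlap_second_moment)
qed

text \<open>Each of the two diagonal entries is expanded in the mixed products of old and new
  eigenvectors, as in a double operator integral, so that only differences of values of g
  remain.\<close>

lemma local_mean_overlap:
  assumes v: "v \<in> X"
  shows "local_mean X \<phi> F g v - local_mean X \<psi> E g v
    = (\<Sum>k\<in>X. \<Sum>l\<in>X. (g (F l) - g (E k)) * overlap k l * (\<psi> k v * \<phi> l v))"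
proof -
  have a: "\<phi> l v = (\<Sum>k\<in>X. overlap k l * \<psi> k v)" if "l \<in> X" for l
    using parseval[OF X eb, of "\<phi> l" "\<lambda>x. of_bool (x = v)"] sum_of_bool_mult[OF X v]
    by (simp add: overlap_def mult.commute)
  have b: "\<psi> k v = (\<Sum>l\<in>X. overlap k l * \<phi> l v)" if "k \<in> X" for k
    using parseval[OF X eb', of "\<psi> k" "\<lambda>x. of_bool (x = v)"] sum_of_bool_mult[OF X v]
    by (simp add: overlap_def mult.commute)
  have "local_mean X \<phi> F g v = (\<Sum>l\<in>X. g (F l) * \<phi> l v * (\<Sum>k\<in>X. overlap k l * \<psi> k v))"
    unfolding local_mean_def weighted_sum_def
    by (intro sum.cong refl) (simp add: a[symmetric] power2_eq_square)
  also have "\<dots> = (\<Sum>k\<in>X. \<Sum>l\<in>X. g (F l) * overlap k l * (\<psi> k v * \<phi> l v))"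
    by (subst sum.swap) (simp add: sum_distrib_left mult_ac)
  finally have 1: "local_mean X \<phi> F g v = \<dots>" .
  have "local_mean X \<psi> E g v = (\<Sum>k\<in>X. g (E k) * \<psi> k v * (\<Sum>l\<in>X. overlap k l * \<phi> l v))"
    unfolding local_mean_def weighted_sum_def
    by (intro sum.cong refl) (simp add: b[symmetric] power2_eq_square)
  also have "\<dots> = (\<Sum>k\<in>X. \<Sum>l\<in>X. g (E k) * overlap k l * (\<psi> k v * \<phi> l v))"
    by (simp add: sum_distrib_left mult_ac)
  finally show ?thesis using 1 by (simp add: left_diff_distrib sum_subtractf)
qed

text \<open>This holds because Lipschitz functions of self-adjoint operators are Lipschitz in the
  Hilbert-Schmidt norm, with the same constant.\<close>

lemma sum_local_mean_lipschitz:
  assumes lip: "\<And>x y. \<bar>g y - g x\<bar> \<le> L * \<bar>y - x\<bar>" and \<eta>: "\<eta> > 0"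
    and W: "\<And>x. x \<in> X \<Longrightarrow> \<bar>W' x - W x\<bar> \<le> \<eta>"
  shows "(\<Sum>v\<in>X. \<bar>local_mean X \<phi> F g v - local_mean X \<psi> E g v\<bar>) \<le> L * \<eta> * card X"
proof -
  have L: "L \<ge> 0" using lip[of 1 0] by (simp add: order_trans[OF abs_ge_zero])
  \<comment> \<open>Testing with signs replaces the absolute values by the trace of a diagonal sign
    matrix against the difference of the two operators.\<close>
  define s where "s v = sgn (local_mean X \<phi> F g v - local_mean X \<psi> E g v)" for v
  define d where "d k l = (\<Sum>v\<in>X. s v * \<psi> k v * \<phi> l v)" for k l
  have "(\<Sum>v\<in>X. \<bar>local_mean X \<phi> F g v - local_mean X \<psi> E g v\<bar>)
      = (\<Sum>v\<in>X. s v * (\<Sum>k\<in>X. \<Sum>l\<in>X. (g (F l) - g (E k)) * overlap k l * (\<psi> k v * \<phi> l v)))"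
    by (intro sum.cong refl) (simp only: local_mean_overlap[symmetric], simp only: s_def abs_sgn mult.commute)
  also have "\<dots> = (\<Sum>v\<in>X. \<Sum>k\<in>X. \<Sum>l\<in>X. (g (F l) - g (E k)) * overlap k l * (s v * \<psi> k v * \<phi> l v))"
    by (simp add: sum_distrib_left mult_ac)
  also have "\<dots> = (\<Sum>k\<in>X. \<Sum>v\<in>X. \<Sum>l\<in>X. (g (F l) - g (E k)) * overlap k l * (s v * \<psi> k v * \<phi> l v))"
    by (rule sum.swap)
  also have "\<dots> = (\<Sum>k\<in>X. \<Sum>l\<in>X. \<Sum>v\<in>X. (g (F l) - g (E k)) * overlap k l * (s v * \<psi> k v * \<phi> l v))"
    by (intro sum.cong refl sum.swap)
  also have "\<dots> = (\<Sum>k\<in>X. \<Sum>l\<in>X. (g (F l) - g (E k)) * overlap k l * d k l)"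
    by (simp add: d_def sum_distrib_left)
  \<comment> \<open>The arithmetic-geometric inequality with weight \<eta> balances the second
    moment, at most \<eta> squared per vertex, against the Hilbert-Schmidt norm of the signs, at
    most 1 per vertex.\<close>
  also have "\<dots> \<le> (\<Sum>k\<in>X. \<Sum>l\<in>X. L / 2 * (((F l - E k)\<^sup>2 * (overlap k l)\<^sup>2) / \<eta> + \<eta> * (d k l)\<^sup>2))"
  proof (intro sum_mono)
    fix k l
    have "(g (F l) - g (E k)) * overlap k l * d k l \<le> \<bar>g (F l) - g (E k)\<bar> * (\<bar>overlap k l\<bar> * \<bar>d k l\<bar>)"
      by (rule order_trans[OF abs_ge_self]) (simp add: abs_mult mult.assoc)
    also have "\<dots> \<le> L * \<bar>F l - E k\<bar> * (\<bar>overlap k l\<bar> * \<bar>d k l\<bar>)"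
      by (intro mult_right_mono lip) auto
    also have "\<dots> = L * ((\<bar>F l - E k\<bar> * \<bar>overlap k l\<bar>) * \<bar>d k l\<bar>)" by simp
    also have "\<dots> \<le> L * ((\<bar>F l - E k\<bar> * \<bar>overlap k l\<bar>)\<^sup>2 / \<eta> + \<eta> * \<bar>d k l\<bar>\<^sup>2) / 2"
    proof -
      define a where "a = \<bar>F l - E k\<bar> * \<bar>overlap k l\<bar>"
      define b where "b = \<bar>d k l\<bar>"
      have "0 \<le> (a - \<eta> * b)\<^sup>2 / \<eta>" using \<eta> by simp
      also have "\<dots> = a\<^sup>2 / \<eta> + \<eta> * b\<^sup>2 - 2 * (a * b)"
        using \<eta> by (simp add: power2_eq_square field_simps)
      finally have "a * b \<le> (a\<^sup>2 / \<eta> + \<eta> * b\<^sup>2) / 2" by simp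
      then have "L * (a * b) \<le> L * ((a\<^sup>2 / \<eta> + \<eta> * b\<^sup>2) / 2)" using L by (rule mult_left_mono)
      then show ?thesis by (simp add: a_def b_def)
    qed
    finally show "(g (F l) - g (E k)) * overlap k l * d k l
       \<le> L / 2 * (((F l - E k)\<^sup>2 * (overlap k l)\<^sup>2) / \<eta> + \<eta> * (d k l)\<^sup>2)"
      by (simp add: power_mult_distrib)
  qed
  also have "\<dots> = L / 2 * ((\<Sum>k\<in>X. \<Sum>l\<in>X. (F l - E k)\<^sup>2 * (overlap k l)\<^sup>2) / \<eta>
      + \<eta> * (\<Sum>k\<in>X. \<Sum>l\<in>X. (d k l)\<^sup>2))"
    by (simp only: sum.distrib sum_distrib_left[symmetric] sum_divide_distrib[symmetric])
  also have "\<dots> = L / 2 * ((\<Sum>x\<in>X. (W' x - W x)\<^sup>2) / \<eta> + \<eta> * (\<Sum>v\<in>X. (s v)\<^sup>2))"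
    unfolding d_def sum_product_form_squares sum_overlap_second_moment ..
  also have "\<dots> \<le> L / 2 * ((\<Sum>x\<in>X. \<eta>\<^sup>2) / \<eta> + \<eta> * (\<Sum>v\<in>X. 1))"
  proof (intro mult_left_mono add_mono divide_right_mono sum_mono)
    fix x assume "x \<in> X"
    then show "(W' x - W x)\<^sup>2 \<le> \<eta>\<^sup>2"
      using W[of x] \<eta> by (intro iffD1[OF abs_le_square_iff]) simp
    show "(s x)\<^sup>2 \<le> 1" by (simp add: s_def sgn_if)
  qed (use L \<eta> in auto)
  also have "\<dots> = L * \<eta> * card X" using \<eta> by (simp add: power2_eq_square)
  finally show ?thesis .
qed

end

section \<open>Smooth square waves\<close>

text \<open>Contains the waves, their primitives and all products of waves, consists of bounded
  functions and is closed under differentiation. So every member is globally Lipschitz and has a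
  uniformly quadratic Taylor remainder. The inverse root and the arcsine are generators for the sake
  of the wave and of its primitive.\<close>

inductive_set wave_algebra :: "(real \<Rightarrow> real) set" where
  const: "(\<lambda>_. c) \<in> wave_algebra"
| sin: "(\<lambda>x. sin (a * x)) \<in> wave_algebra"
| cos: "(\<lambda>x. cos (a * x)) \<in> wave_algebra"
| inverse_sqrt: "c > 1 \<Longrightarrow> (\<lambda>x. 1 / sqrt (c - (cos (a * x))\<^sup>2)) \<in> wave_algebra"
| arcsin: "c > 1 \<Longrightarrow> (\<lambda>x. arcsin (cos (a * x) / sqrt c)) \<in> wave_algebra"
| add: "q \<in> wave_algebra \<Longrightarrow> r \<in> wave_algebra \<Longrightarrow> (\<lambda>x. q x + r x) \<in> wave_algebra"
| mult: "q \<in> wave_algebra \<Longrightarrow> r \<in> wave_algebra \<Longrightarrow> (\<lambda>x. q x * r x) \<in> wave_algebra"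

text \<open>The radicand is (c - 1) plus the square of the sine, so this is a smooth version of the
  sign of sin (a x), steeper as c approaches 1.\<close>

definition wave :: "real \<Rightarrow> real \<Rightarrow> real \<Rightarrow> real" where
  "wave c a x = sin (a * x) * (1 / sqrt (c - (cos (a * x))\<^sup>2))"

text \<open>A smoothed triangle wave. Its range shrinks with the frequency and stays bounded as c
  approaches 1, which is why this particular smoothing is used.\<close>

definition wave_primitive :: "real \<Rightarrow> real \<Rightarrow> real \<Rightarrow> real" where
  "wave_primitive c a x = (- 1 / a) * arcsin (cos (a * x) / sqrt c)"

lemma cos_squared_le_1: "(cos (x::real))\<^sup>2 \<le> 1"
  by (simp add: abs_square_le_1)

lemma wave_in_algebra: "c > 1 \<Longrightarrow> wave c a \<in> wave_algebra"
  unfolding wave_def[abs_def] by (intro wave_algebra.intros)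

lemma wave_primitive_in_algebra: "c > 1 \<Longrightarrow> wave_primitive c a \<in> wave_algebra"
  unfolding wave_primitive_def[abs_def] by (intro wave_algebra.intros)

lemma cos_div_sqrt_bounds:
  fixes c x :: real
  assumes "c > 1"
  shows "- 1 < cos x / sqrt c" "cos x / sqrt c < 1"
proof -
  have "\<bar>cos x / sqrt c\<bar> < 1"
    using assms by (simp add: abs_divide le_less_trans[OF abs_cos_le_one])
  then show "- 1 < cos x / sqrt c" "cos x / sqrt c < 1" by linarith+
qed

lemma has_derivative_arcsin_cos:
  fixes c a x :: real
  assumes c: "c > 1"
  shows "((\<lambda>x. arcsin (cos (a * x) / sqrt c)) has_real_derivative
    - a * (sin (a * x) * (1 / sqrt (c - (cos (a * x))\<^sup>2)))) (at x)"
proof -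
  have "sqrt c * sqrt (1 - (cos (a * x) / sqrt c)\<^sup>2) = sqrt (c - (cos (a * x))\<^sup>2)"
    unfolding real_sqrt_mult[symmetric] using c by (simp add: power_divide field_simps)
  then have e: "inverse (sqrt (1 - (cos (a * x) / sqrt c)\<^sup>2)) * (1 / sqrt c) = 1 / sqrt (c - (cos (a * x))\<^sup>2)"
    by (simp only: inverse_eq_divide[symmetric] inverse_mult_distrib[symmetric] mult.commute)
  have inner: "((\<lambda>x. cos (a * x) / sqrt c) has_real_derivative - sin (a * x) * a / sqrt c) (at x)"
    by (rule DERIV_cdivide) (auto intro!: derivative_eq_intros)
  have "((\<lambda>x. arcsin (cos (a * x) / sqrt c)) has_real_derivative
      inverse (sqrt (1 - (cos (a * x) / sqrt c)\<^sup>2)) * (- sin (a * x) * a / sqrt c)) (at x)"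
    by (rule DERIV_chain2[OF DERIV_arcsin inner]) (use cos_div_sqrt_bounds[OF c, of "a * x"] in auto)
  moreover have "inverse (sqrt (1 - (cos (a * x) / sqrt c)\<^sup>2)) * (- sin (a * x) * a / sqrt c)
     = - a * (sin (a * x) * (1 / sqrt (c - (cos (a * x))\<^sup>2)))"
    unfolding e[symmetric] by simp
  ultimately show ?thesis by simp
qed

lemma wave_algebra_deriv:
  assumes "q \<in> wave_algebra"
  shows "\<exists>q'\<in>wave_algebra. \<forall>x. (q has_real_derivative q' x) (at x)"
  using assms
proof induction
  case (const c)
  show ?case by (rule bexI[OF _ wave_algebra.const[of 0]]) auto
next
  case (sin a)
  have "(\<lambda>x. a * cos (a * x)) \<in> wave_algebra" by (intro wave_algebra.intros)
  then show ?case by (rule bexI[rotated]) (auto intro!: derivative_eq_intros)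
next
  case (cos a)
  have "(\<lambda>x. - a * sin (a * x)) \<in> wave_algebra" by (intro wave_algebra.intros)
  then show ?case by (rule bexI[rotated]) (auto intro!: derivative_eq_intros)
next
  case (inverse_sqrt c a)
  define r where "r = (\<lambda>x. 1 / sqrt (c - (cos (a * x))\<^sup>2))"
  have pos: "c - (cos (a * x))\<^sup>2 > 0" for x
    using inverse_sqrt cos_squared_le_1[of "a * x"] by linarith
  have "r \<in> wave_algebra" unfolding r_def by (intro wave_algebra.intros inverse_sqrt)
  then have "(\<lambda>x. - a * (cos (a * x) * (sin (a * x) * (r x * (r x * r x))))) \<in> wave_algebra"
    by (intro wave_algebra.intros)
  moreover have "(r has_real_derivative - a * (cos (a * x) * (sin (a * x) * (r x * (r x * r x))))) (at x)" for x
  proof -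
    have p: "sqrt (c - (cos (a * x))\<^sup>2) > 0" using pos by simp
    show ?thesis
      unfolding r_def using pos[of x] p
      by (auto intro!: derivative_eq_intros simp: divide_simps power2_eq_square)
  qed
  ultimately have "\<exists>q'\<in>wave_algebra. \<forall>x. (r has_real_derivative q' x) (at x)"
    by (intro bexI[where x = "\<lambda>x. - a * (cos (a * x) * (sin (a * x) * (r x * (r x * r x))))"] allI)
  then show ?case by (simp only: r_def)
next
  case (arcsin c a)
  have "(\<lambda>x. - a * (sin (a * x) * (1 / sqrt (c - (cos (a * x))\<^sup>2)))) \<in> wave_algebra"
    by (intro wave_algebra.intros arcsin)
  then show ?case by (rule bexI[rotated]) (use has_derivative_arcsin_cos[OF arcsin] in auto)
next
  case (add q r)
  then obtain q' r' where d: "q' \<in> wave_algebra" "r' \<in> wave_algebra"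
    "\<And>x. (q has_real_derivative q' x) (at x)" "\<And>x. (r has_real_derivative r' x) (at x)" by auto
  have "(\<lambda>x. q' x + r' x) \<in> wave_algebra" using d by (intro wave_algebra.intros)
  then show ?case by (rule bexI[rotated]) (use d in \<open>auto intro!: derivative_eq_intros\<close>)
next
  case (mult q r)
  then obtain q' r' where d: "q' \<in> wave_algebra" "r' \<in> wave_algebra"
    "\<And>x. (q has_real_derivative q' x) (at x)" "\<And>x. (r has_real_derivative r' x) (at x)" by auto
  have "(\<lambda>x. q' x * r x + r' x * q x) \<in> wave_algebra" using d mult by (intro wave_algebra.intros)
  then show ?case by (rule bexI[rotated]) (use d in \<open>auto intro!: DERIV_mult\<close>)
qed

lemma wave_algebra_bounded:
  assumes "q \<in> wave_algebra"
  shows "\<exists>b>0. \<forall>x. \<bar>q x\<bar> \<le> b"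
  using assms
proof induction
  case (const c)
  show ?case by (rule exI[of _ "\<bar>c\<bar> + 1"]) (auto simp: add_nonneg_pos)
next
  case (sin a)
  show ?case by (rule exI[of _ 1]) auto
next
  case (cos a)
  show ?case by (rule exI[of _ 1]) auto
next
  case (inverse_sqrt c a)
  have "1 / sqrt (c - (cos (a * x))\<^sup>2) \<le> 1 / sqrt (c - 1)" for x
    using inverse_sqrt cos_squared_le_1[of "a * x"] by (intro divide_left_mono) auto
  moreover have "c - (cos (a * x))\<^sup>2 \<ge> 0" for x
    using inverse_sqrt cos_squared_le_1[of "a * x"] by linarith
  ultimately show ?case using inverse_sqrt by (intro exI[of _ "1 / sqrt (c - 1)"]) auto
next
  case (arcsin c a)
  have "\<bar>arcsin (cos (a * x) / sqrt c)\<bar> \<le> pi" for x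
    using arcsin_bounded[of "cos (a * x) / sqrt c"] cos_div_sqrt_bounds[OF arcsin, of "a * x"] pi_gt_zero
    by (simp add: abs_le_iff)
  then show ?case using pi_gt_zero by blast
next
  case (add q r)
  then obtain b d where "b > 0" "d > 0" and bd: "\<And>x. \<bar>q x\<bar> \<le> b" "\<And>x. \<bar>r x\<bar> \<le> d" by auto
  moreover have "\<bar>q x + r x\<bar> \<le> b + d" for x
    using abs_triangle_ineq[of "q x" "r x"] bd[of x] by linarith
  ultimately show ?case by (intro exI[of _ "b + d"]) auto
next
  case (mult q r)
  then obtain b d where "b > 0" "d > 0" "\<And>x. \<bar>q x\<bar> \<le> b" "\<And>x. \<bar>r x\<bar> \<le> d" by auto
  then show ?case by (intro exI[of _ "b * d"]) (auto simp: abs_mult intro!: mult_mono)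
qed

lemma lipschitz_of_deriv_bound:
  fixes q q' :: "real \<Rightarrow> real"
  assumes "\<And>x. (q has_real_derivative q' x) (at x)" "\<And>x. \<bar>q' x\<bar> \<le> L"
  shows "\<bar>q y - q x\<bar> \<le> L * \<bar>y - x\<bar>"
  using field_differentiable_bound[of UNIV q q' L y x] assms by auto

lemma wave_algebra_lipschitz:
  assumes "q \<in> wave_algebra"
  shows "\<exists>L>0. \<forall>x y. \<bar>q y - q x\<bar> \<le> L * \<bar>y - x\<bar>"
proof -
  obtain q' where q': "q' \<in> wave_algebra" "\<And>x. (q has_real_derivative q' x) (at x)"
    using wave_algebra_deriv[OF assms] by auto
  obtain L where "L > 0" "\<And>x. \<bar>q' x\<bar> \<le> L" using wave_algebra_bounded[OF q'(1)] by auto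
  then show ?thesis using lipschitz_of_deriv_bound[OF q'(2)] by blast
qed

text \<open>The mean value bound is applied on the segment to q minus the linear function of slope
  \<open>q' x\<close>; K is a Lipschitz constant of the derivative.\<close>

lemma wave_algebra_taylor:
  assumes "q \<in> wave_algebra" and d: "\<And>x. (q has_real_derivative q' x) (at x)"
  shows "\<exists>K>0. \<forall>x y. q y \<ge> q x + q' x * (y - x) - K * (y - x)\<^sup>2"
proof -
  obtain q1 where q1: "q1 \<in> wave_algebra" "\<And>x. (q has_real_derivative q1 x) (at x)"
    using wave_algebra_deriv[OF assms(1)] by auto
  have "q1 = q'" using q1(2) d DERIV_unique by blast
  obtain K where K: "K > 0" "\<And>x y. \<bar>q' y - q' x\<bar> \<le> K * \<bar>y - x\<bar>"
    using wave_algebra_lipschitz[OF q1(1)] unfolding \<open>q1 = q'\<close> by blast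
  have "q y \<ge> q x + q' x * (y - x) - K * (y - x)\<^sup>2" for x y
  proof -
    have "\<bar>(q y - q' x * y) - (q x - q' x * x)\<bar> \<le> (K * \<bar>y - x\<bar>) * \<bar>y - x\<bar>"
    proof -
      have "norm ((q y - q' x * y) - (q x - q' x * x)) \<le> (K * \<bar>y - x\<bar>) * norm (y - x)"
      proof (rule field_differentiable_bound[of "closed_segment x y" _ "\<lambda>z. q' z - q' x"])
        fix z assume z: "z \<in> closed_segment x y"
        show "((\<lambda>z. q z - q' x * z) has_field_derivative q' z - q' x) (at z within closed_segment x y)"
          by (rule has_field_derivative_at_within[OF DERIV_diff[OF d DERIV_cmult_Id]])
        have "\<bar>z - x\<bar> \<le> \<bar>y - x\<bar>"
          using z by (auto simp: closed_segment_eq_real_ivl split: if_splits)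
        then show "norm (q' z - q' x) \<le> K * \<bar>y - x\<bar>"
          using order_trans[OF K(2)[of z x] mult_left_mono] K(1) by simp
      qed auto
      then show ?thesis by simp
    qed
    then have "\<bar>(q y - q' x * y) - (q x - q' x * x)\<bar> \<le> K * (y - x)\<^sup>2"
      by (simp add: power2_eq_square mult.assoc flip: abs_mult)
    then show ?thesis by (simp add: abs_le_iff algebra_simps)
  qed
  then show ?thesis using K(1) by blast
qed

lemma has_derivative_wave_primitive:
  assumes "c > 1" "a > 0"
  shows "(wave_primitive c a has_real_derivative wave c a x) (at x)"
proof -
  have "(wave_primitive c a has_real_derivative
      (- 1 / a) * (- a * (sin (a * x) * (1 / sqrt (c - (cos (a * x))\<^sup>2))))) (at x)"
    unfolding wave_primitive_def[abs_def]
    by (rule DERIV_cmult[OF has_derivative_arcsin_cos[OF assms(1)]])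
  then show ?thesis using assms by (simp add: wave_def)
qed

lemma wave_primitive_bound:
  assumes "c > 1" "a > 0"
  shows "\<bar>wave_primitive c a x\<bar> \<le> pi / a"
proof -
  have "\<bar>arcsin (cos (a * x) / sqrt c)\<bar> \<le> pi"
    using arcsin_bounded[of "cos (a * x) / sqrt c"] cos_div_sqrt_bounds[OF assms(1), of "a * x"] pi_gt_zero
    by (simp add: abs_le_iff)
  then show ?thesis using assms by (simp add: wave_primitive_def abs_mult divide_right_mono)
qed

lemma abs_wave_le_1:
  assumes "c > 1"
  shows "\<bar>wave c a x\<bar> \<le> 1"
proof -
  have "(sin (a * x))\<^sup>2 \<le> c - (cos (a * x))\<^sup>2"
    using assms sin_cos_squared_add[of "a * x"] by linarith
  then have "\<bar>sin (a * x)\<bar> \<le> sqrt (c - (cos (a * x))\<^sup>2)"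
    by (simp add: real_le_rsqrt)
  moreover have "c - (cos (a * x))\<^sup>2 > 0"
    using assms cos_squared_le_1[of "a * x"] by linarith
  ultimately show ?thesis by (simp add: wave_def abs_mult)
qed

text \<open>For this c the radicand is m^2 plus the square of the sine, hence at most 4 times that
  square as soon as the sine reaches m. So the transition zones shrink to the zeros of the sine with
  m.\<close>

lemma wave_ge_half:
  assumes "m > 0" "\<bar>sin (a * x)\<bar> \<ge> m"
  shows "\<bar>wave (1 + m\<^sup>2) a x\<bar> \<ge> 1 / 2"
proof -
  have m: "m\<^sup>2 \<le> (sin (a * x))\<^sup>2"
    using assms power_mono[of m "\<bar>sin (a * x)\<bar>" 2] by simp
  have e: "1 + m\<^sup>2 - (cos (a * x))\<^sup>2 = m\<^sup>2 + (sin (a * x))\<^sup>2"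
    using sin_cos_squared_add[of "a * x"] by linarith
  have "1 + m\<^sup>2 - (cos (a * x))\<^sup>2 \<le> (2 * \<bar>sin (a * x)\<bar>)\<^sup>2"
  proof -
    have "m\<^sup>2 + (sin (a * x))\<^sup>2 \<le> 4 * (sin (a * x))\<^sup>2"
      using m zero_le_power2[of "sin (a * x)"] by linarith
    then show ?thesis unfolding e by (simp add: power_mult_distrib)
  qed
  then have "sqrt (1 + m\<^sup>2 - (cos (a * x))\<^sup>2) \<le> 2 * \<bar>sin (a * x)\<bar>"
    by (intro real_le_lsqrt) auto
  moreover have "1 + m\<^sup>2 - (cos (a * x))\<^sup>2 > 0" unfolding e using assms by (simp add: add_pos_nonneg)
  ultimately show ?thesis by (simp add: wave_def abs_mult field_simps)
qed

section \<open>Gradient ascent for the trace\<close>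

lemma abs_trace_le:
  assumes "\<And>x. \<bar>f x\<bar> \<le> (\<beta>::real)"
  shows "\<bar>\<Sum>k\<in>X. f (E k)\<bar> \<le> \<beta> * card X"
proof -
  have "\<bar>\<Sum>k\<in>X. f (E k)\<bar> \<le> (\<Sum>k\<in>X. \<bar>f (E k)\<bar>)" by (rule sum_abs)
  also have "\<dots> \<le> (\<Sum>k\<in>X. \<beta>)" by (intro sum_mono assms)
  finally show ?thesis by (simp add: mult.commute)
qed

text \<open>Discrete gradient ascent for the trace of \<open>f\<close>: as long as the gradient is large in \<open>\<ell>\<^sup>1\<close>,
  a step of size \<open>s\<close> gains a multiple of \<open>s\<close>, and the total gain is at most twice the
  sup norm of \<open>f\<close>. So the distance travelled is controlled by that norm alone.\<close>

lemma ex_small_gradient: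
  fixes A :: "'a \<Rightarrow> 'a \<Rightarrow> real"
  assumes X: "finite X" and sym: "\<And>x y. x \<in> X \<Longrightarrow> y \<in> X \<Longrightarrow> A x y = A y x"
    and bound: "\<And>x. \<bar>f x\<bar> \<le> \<beta>"
    and taylor: "\<And>x y. f y \<ge> f x + f' x * (y - x) - K * (y - x)\<^sup>2" and K: "K > 0"
    and \<theta>: "\<theta> > 0" and \<eta>: "\<eta> > 0" and \<beta>: "8 * \<beta> \<le> \<eta> * \<theta>"
  shows "\<exists>W \<psi> E. eigenbasis X (add_diag A W) \<psi> E \<and> (\<forall>x\<in>X. \<bar>W x - V x\<bar> \<le> \<eta>) \<and>
    (\<Sum>v\<in>X. \<bar>local_mean X \<psi> E f' v\<bar>) \<le> \<theta> * card X"
proof (cases "X = {}")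
  case True
  then show ?thesis by (simp add: eigenbasis_def)
next
  case False
  then have n: "real (card X) > 0" using X by (simp add: card_gt_0_iff)
  have ex: "\<exists>\<psi> E. eigenbasis X (add_diag A W) \<psi> E" for W
    by (rule ex_eigenbasis[OF X]) (auto simp: add_diag_def sym)
  obtain \<psi>\<^sub>0 E\<^sub>0 where eb0: "eigenbasis X (add_diag A V) \<psi>\<^sub>0 E\<^sub>0" using ex by blast
  \<comment> \<open>The quadratic Taylor loss \<open>K s s\<close> per vertex is then at most half
    of the linear gain \<open>s \<theta>\<close>, and \<eta> / 2 leaves room for one surplus
    step.\<close>
  define s where "s = min (\<theta> / (2 * K)) (\<eta> / 2)"
  have s: "s > 0" "s \<le> \<eta> / 2" using K \<theta> \<eta> by (auto simp: s_def)
  have "K * s \<le> K * (\<theta> / (2 * K))" using K by (intro mult_left_mono) (auto simp: s_def)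
  then have Ks: "K * s \<le> \<theta> / 2" using K by simp
  \<comment> \<open>Invariant: either a small gradient has been reached and the potential is kept,
    or each step so far has gained s \<theta> / 2 per vertex.\<close>
  have step: "\<exists>W \<psi> E. eigenbasis X (add_diag A W) \<psi> E \<and> (\<forall>x\<in>X. \<bar>W x - V x\<bar> \<le> real j * s) \<and>
    ((\<Sum>v\<in>X. \<bar>local_mean X \<psi> E f' v\<bar>) \<le> \<theta> * card X \<or>
     (\<Sum>k\<in>X. f (E\<^sub>0 k)) + real j * (s * \<theta> / 2 * card X) \<le> (\<Sum>k\<in>X. f (E k)))" for j
  proof (induction j)
    case 0
    show ?case
      by (rule exI[of _ V], rule exI[of _ \<psi>\<^sub>0], rule exI[of _ E\<^sub>0]) (use eb0 in simp)
  next
    case (Suc j)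
    then obtain W \<psi> E where eb: "eigenbasis X (add_diag A W) \<psi> E"
      and W: "\<And>x. x \<in> X \<Longrightarrow> \<bar>W x - V x\<bar> \<le> real j * s"
      and alt: "(\<Sum>v\<in>X. \<bar>local_mean X \<psi> E f' v\<bar>) \<le> \<theta> * card X \<or>
         (\<Sum>k\<in>X. f (E\<^sub>0 k)) + real j * (s * \<theta> / 2 * card X) \<le> (\<Sum>k\<in>X. f (E k))"
      by blast
    show ?case
    proof (cases "(\<Sum>v\<in>X. \<bar>local_mean X \<psi> E f' v\<bar>) \<le> \<theta> * card X")
      case True
      have "\<bar>W x - V x\<bar> \<le> real (Suc j) * s" if "x \<in> X" for x
        using W[OF that] s by (simp add: distrib_right)
      with True eb show ?thesis by blast
    next
      case large: False
      define W' where "W' x = W x + s * sgn (local_mean X \<psi> E f' x)" for x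
      obtain \<phi> F where eb': "eigenbasis X (add_diag A W') \<phi> F" using ex by blast
      interpret two_potentials X A W \<psi> E W' \<phi> F by unfold_locales (fact X sym eb eb')+
      have sgn1: "\<bar>sgn r\<bar> \<le> 1" for r :: real by (simp add: sgn_if)
      have "\<bar>W' x - V x\<bar> \<le> real (Suc j) * s" if "x \<in> X" for x
      proof -
        have "\<bar>s * sgn (local_mean X \<psi> E f' x)\<bar> \<le> s * 1"
          unfolding abs_mult using s sgn1 by (intro mult_mono) auto
        then show ?thesis using W[OF that] by (simp add: W'_def distrib_right)
      qed
      moreover have "(\<Sum>k\<in>X. f (E\<^sub>0 k)) + real (Suc j) * (s * \<theta> / 2 * card X) \<le> (\<Sum>l\<in>X. f (F l))"
      proof -
        have "(\<Sum>x\<in>X. (W' x - W x) * local_mean X \<psi> E f' x) = s * (\<Sum>v\<in>X. \<bar>local_mean X \<psi> E f' v\<bar>)"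
          by (simp add: W'_def sum_distrib_left abs_sgn mult_ac)
        moreover have "s * (\<Sum>v\<in>X. \<bar>local_mean X \<psi> E f' v\<bar>) \<ge> s * (\<theta> * card X)"
          using large s by (intro mult_left_mono) auto
        moreover have "K * (\<Sum>x\<in>X. (W' x - W x)\<^sup>2) \<le> s * (\<theta> / 2 * card X)"
        proof -
          have "(W' x - W x)\<^sup>2 \<le> s * s" for x
            using s sgn1 by (simp add: W'_def power2_eq_square sgn_if)
          then have "(\<Sum>x\<in>X. (W' x - W x)\<^sup>2) \<le> (\<Sum>x\<in>X. s * s)" by (intro sum_mono)
          then have "K * (\<Sum>x\<in>X. (W' x - W x)\<^sup>2) \<le> K * (\<Sum>x\<in>X. s * s)"
            using K by (intro mult_left_mono) auto
          also have "\<dots> = (K * s) * (s * card X)" by simp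
          also have "\<dots> \<le> (\<theta> / 2) * (s * card X)" using Ks s by (intro mult_right_mono) auto
          finally show ?thesis by (simp add: mult_ac)
        qed
        moreover have "(\<Sum>k\<in>X. f (E\<^sub>0 k)) + real j * (s * \<theta> / 2 * card X) \<le> (\<Sum>k\<in>X. f (E k))"
          using alt large by blast
        moreover have "s * (\<theta> * card X) = 2 * (s * (\<theta> / 2 * card X))"
          "real (Suc j) * (s * \<theta> / 2 * card X) = real j * (s * \<theta> / 2 * card X) + s * (\<theta> / 2 * card X)"
          by (simp_all add: algebra_simps)
        ultimately show ?thesis
          using trace_second_order_lower_bound[of f f' K, OF taylor] by linarith
      qed
      ultimately show ?thesis using eb' by blast
    qed
  qed
  have \<beta>0: "\<beta> \<ge> 0" using bound[of 0] by (simp add: order_trans[OF abs_ge_zero])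
  \<comment> \<open>Enough steps for the gain to exceed \<open>2 \<beta>\<close> per vertex, the
    largest possible variation of the trace, while
    \<open>j s \<le> 4 \<beta> / \<theta> + s \<le> \<eta>\<close> because of
    \<open>8 \<beta> \<le> \<eta> \<theta>\<close>.\<close>
  define j where "j = nat \<lfloor>4 * \<beta> / (s * \<theta>)\<rfloor> + 1"
  have j1: "real j > 4 * \<beta> / (s * \<theta>)" unfolding j_def by linarith
  have j2: "real j \<le> 4 * \<beta> / (s * \<theta>) + 1"
    using \<beta>0 s \<theta> by (simp add: j_def)
  obtain W \<psi> E where eb: "eigenbasis X (add_diag A W) \<psi> E"
    and W: "\<And>x. x \<in> X \<Longrightarrow> \<bar>W x - V x\<bar> \<le> real j * s"
    and alt: "(\<Sum>v\<in>X. \<bar>local_mean X \<psi> E f' v\<bar>) \<le> \<theta> * card X \<or>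
      (\<Sum>k\<in>X. f (E\<^sub>0 k)) + real j * (s * \<theta> / 2 * card X) \<le> (\<Sum>k\<in>X. f (E k))"
    using step[of j] by blast
  have "real j * s \<le> (4 * \<beta> / (s * \<theta>) + 1) * s" using j2 s by (intro mult_right_mono) auto
  also have "\<dots> = 4 * \<beta> / \<theta> + s" using s by (simp add: field_simps)
  also have "4 * \<beta> / \<theta> \<le> \<eta> / 2" using \<beta> \<theta> by (simp add: field_simps)
  finally have "real j * s \<le> \<eta>" using s by simp
  then have "\<forall>x\<in>X. \<bar>W x - V x\<bar> \<le> \<eta>" using W by force
  moreover have "(\<Sum>v\<in>X. \<bar>local_mean X \<psi> E f' v\<bar>) \<le> \<theta> * card X"
  proof (rule ccontr)
    assume "\<not> ?thesis"
    with alt have "(\<Sum>k\<in>X. f (E\<^sub>0 k)) + real j * (s * \<theta> / 2 * card X) \<le> (\<Sum>k\<in>X. f (E k))" by blast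
    then have "real j * (s * \<theta> / 2 * card X) \<le> 2 * \<beta> * card X"
      using abs_trace_le[of f \<beta> E X, OF bound] abs_trace_le[of f \<beta> E\<^sub>0 X, OF bound] by linarith
    then have "real j * (s * \<theta> / 2) \<le> 2 * \<beta>" using n by (simp add: mult.assoc[symmetric])
    moreover have "real j * (s * \<theta>) > 4 * \<beta>" using j1 s \<theta> by (simp add: field_simps)
    ultimately show False by simp
  qed
  ultimately show ?thesis using eb by blast
qed

section \<open>Flattening several functions at once\<close>

definition symmetric_family :: "('a set \<times> ('a \<Rightarrow> 'a \<Rightarrow> real)) set \<Rightarrow> bool" where
  "symmetric_family \<S> \<longleftrightarrow> (\<forall>(X, A)\<in>\<S>. finite X \<and> (\<forall>x\<in>X. \<forall>y\<in>X. A x y = A y x))"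

text \<open>One perturbation serves the whole list, with error measured per vertex, and the
  functions are the same for all members of the family and all starting potentials.\<close>

definition flattenable ::
  "('a set \<times> ('a \<Rightarrow> 'a \<Rightarrow> real)) set \<Rightarrow> (real \<Rightarrow> real) list \<Rightarrow> real \<Rightarrow> real \<Rightarrow> bool" where
  "flattenable \<S> gs \<eta> \<theta> \<longleftrightarrow> (\<forall>(X, A)\<in>\<S>. \<forall>V. \<exists>W \<psi> E.
     eigenbasis X (add_diag A W) \<psi> E \<and> (\<forall>x\<in>X. \<bar>W x - V x\<bar> \<le> \<eta>) \<and>
     (\<Sum>g\<leftarrow>gs. \<Sum>v\<in>X. \<bar>local_mean X \<psi> E g v\<bar>) \<le> \<theta> * card X)"

lemma flattenable_mono:
  assumes "flattenable \<S> gs \<eta> \<theta>" "\<eta> \<le> \<eta>'" "\<theta> \<le> \<theta>'"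
  shows "flattenable \<S> gs \<eta>' \<theta>'"
  unfolding flattenable_def
proof clarify
  fix X A and V :: "'a \<Rightarrow> real" assume "(X, A) \<in> \<S>"
  then obtain W \<psi> E where "eigenbasis X (add_diag A W) \<psi> E" "\<forall>x\<in>X. \<bar>W x - V x\<bar> \<le> \<eta>"
     "(\<Sum>g\<leftarrow>gs. \<Sum>v\<in>X. \<bar>local_mean X \<psi> E g v\<bar>) \<le> \<theta> * card X"
    using assms(1) unfolding flattenable_def by fast
  moreover have "\<theta> * card X \<le> \<theta>' * card X" using assms by (intro mult_right_mono) auto
  ultimately show "\<exists>W \<psi> E. eigenbasis X (add_diag A W) \<psi> E \<and> (\<forall>x\<in>X. \<bar>W x - V x\<bar> \<le> \<eta>') \<and>
     (\<Sum>g\<leftarrow>gs. \<Sum>v\<in>X. \<bar>local_mean X \<psi> E g v\<bar>) \<le> \<theta>' * card X"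
    using assms(2) by (intro exI[of _ W] exI[of _ \<psi>] exI[of _ E]) fastforce
qed

lemma wave_algebra_common_lipschitz:
  assumes "set gs \<subseteq> wave_algebra"
  shows "\<exists>L>0. \<forall>g\<in>set gs. \<forall>x y. \<bar>g y - g x\<bar> \<le> L * \<bar>y - x\<bar>"
  using assms
proof (induction gs)
  case Nil
  show ?case by (rule exI[of _ 1]) simp
next
  case (Cons g gs)
  then obtain L where L: "L > 0" "\<And>h x y. h \<in> set gs \<Longrightarrow> \<bar>h y - h x\<bar> \<le> L * \<bar>y - x\<bar>" by auto
  obtain M where M: "M > 0" "\<And>x y. \<bar>g y - g x\<bar> \<le> M * \<bar>y - x\<bar>"
    using wave_algebra_lipschitz[of g] Cons.prems by auto
  have "\<bar>h y - h x\<bar> \<le> (L + M) * \<bar>y - x\<bar>" if "h \<in> set (g # gs)" for h x y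
  proof -
    have "L * \<bar>y - x\<bar> \<ge> 0" "M * \<bar>y - x\<bar> \<ge> 0" using L M by auto
    then show ?thesis
      using that L(2)[of h y x] M(2)[of y x] by (auto simp: distrib_right)
  qed
  then show ?case using L M by (intro exI[of _ "L + M"]) auto
qed

text \<open>The old list is flattened first, and an ascent for \<rho> times the primitive of the
  wave starts from there. It is so short that the old functions, being Lipschitz, stay nearly flat.
  The frequency pays for the shortness, and it comes before c because the primitive is bounded
  independently of c.\<close>

lemma flattenable_Cons_wave:
  assumes fam: "symmetric_family \<S>" and flat: "flattenable \<S> gs \<eta> \<theta>"
    and gs: "set gs \<subseteq> wave_algebra" and \<rho>: "\<rho> \<in> wave_algebra" and less: "\<eta> < \<eta>'" "\<theta> < \<theta>'"
  shows "\<exists>a>0. \<forall>c>1. flattenable \<S> ((\<lambda>x. \<rho> x * wave c a x) # gs) \<eta>' \<theta>'"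
proof -
  \<comment> \<open>Thirds of the slack: the gradient left by the ascent, the term with
    \<open>\<rho>'\<close>, and the disturbance of the old list.\<close>
  define \<gamma> where "\<gamma> = (\<theta>' - \<theta>) / 3"
  have \<gamma>: "\<gamma> > 0" using less by (simp add: \<gamma>_def)
  obtain L where L: "L > 0" "\<And>g x y. g \<in> set gs \<Longrightarrow> \<bar>g y - g x\<bar> \<le> L * \<bar>y - x\<bar>"
    using wave_algebra_common_lipschitz[OF gs] by blast
  \<comment> \<open>The length of the ascent: it fits the remaining distance and disturbs all old
    functions together by at most \<gamma> per vertex. The added 1 covers the empty list.\<close>
  define \<zeta> where "\<zeta> = min (\<eta>' - \<eta>) (\<gamma> / (L * (real (length gs) + 1)))"
  have \<zeta>: "\<zeta> > 0" "\<zeta> \<le> \<eta>' - \<eta>" using less \<gamma> L by (auto simp: \<zeta>_def)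
  have L\<zeta>: "real (length gs) * (L * \<zeta>) \<le> \<gamma>"
  proof -
    have "real (length gs) * (L * \<zeta>) \<le> (L * (real (length gs) + 1)) * \<zeta>"
      using L \<zeta> by (simp add: algebra_simps)
    also have "\<dots> \<le> (L * (real (length gs) + 1)) * (\<gamma> / (L * (real (length gs) + 1)))"
      using L by (intro mult_left_mono) (auto simp: \<zeta>_def)
    also have "\<dots> = \<gamma>" using L(1) by (simp add: add_nonneg_eq_0_iff)
    finally show ?thesis .
  qed
  obtain \<rho>' where \<rho>': "\<rho>' \<in> wave_algebra" "\<And>x. (\<rho> has_real_derivative \<rho>' x) (at x)"
    using wave_algebra_deriv[OF \<rho>] by auto
  obtain b b' where b: "b > 0" "\<And>x. \<bar>\<rho> x\<bar> \<le> b" and b': "b' > 0" "\<And>x. \<bar>\<rho>' x\<bar> \<le> b'"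
    using wave_algebra_bounded[OF \<rho>] wave_algebra_bounded[OF \<rho>'(1)] by auto
  \<comment> \<open>The first summand makes the sup norm of f, at most b pi / a, small enough for an
    ascent of length \<zeta> to gradient \<gamma>; the second makes \<open>\<rho>'\<close> times the
    primitive at most \<gamma>.\<close>
  define a where "a = 8 * b * pi / (\<zeta> * \<gamma>) + b' * pi / \<gamma>"
  have pos: "8 * b * pi / (\<zeta> * \<gamma>) > 0" "b' * pi / \<gamma> > 0" using b b' \<zeta> \<gamma> pi_gt_zero by auto
  then have a: "a > 0" "8 * b * pi / (\<zeta> * \<gamma>) \<le> a" "b' * pi / \<gamma> \<le> a" by (auto simp: a_def)
  then have a': "8 * (b * (pi / a)) \<le> \<zeta> * \<gamma>" "b' * (pi / a) \<le> \<gamma>"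
    using \<zeta> \<gamma> by (simp_all add: field_simps)
  have "flattenable \<S> ((\<lambda>x. \<rho> x * wave c a x) # gs) \<eta>' \<theta>'" if c: "c > 1" for c
    unfolding flattenable_def
  proof clarify
    fix X A and V :: "'a \<Rightarrow> real" assume XA: "(X, A) \<in> \<S>"
    then have X: "finite X" and sym: "\<And>x y. x \<in> X \<Longrightarrow> y \<in> X \<Longrightarrow> A x y = A y x"
      using fam by (auto simp: symmetric_family_def)
    obtain U \<psi> E where U: "eigenbasis X (add_diag A U) \<psi> E" "\<And>x. x \<in> X \<Longrightarrow> \<bar>U x - V x\<bar> \<le> \<eta>"
       "(\<Sum>g\<leftarrow>gs. \<Sum>v\<in>X. \<bar>local_mean X \<psi> E g v\<bar>) \<le> \<theta> * card X"
      using flat XA unfolding flattenable_def by fast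
    define f where "f x = \<rho> x * wave_primitive c a x" for x
    define f' where "f' x = \<rho>' x * wave_primitive c a x + \<rho> x * wave c a x" for x
    have "f \<in> wave_algebra"
      unfolding f_def[abs_def] by (intro wave_algebra.mult \<rho> wave_primitive_in_algebra c)
    moreover have "(f has_real_derivative f' x) (at x)" for x
      unfolding f_def[abs_def] f'_def
      using DERIV_mult[OF \<rho>'(2) has_derivative_wave_primitive[OF c a(1)]] by (simp add: mult.commute)
    \<comment> \<open>K depends on c, but it only affects the step size of the ascent and not its
      length.\<close>
    ultimately obtain K where K: "K > 0" "\<And>x y. f y \<ge> f x + f' x * (y - x) - K * (y - x)\<^sup>2"
      using wave_algebra_taylor[of f f'] by blast
    have fb: "\<bar>f x\<bar> \<le> b * (pi / a)" for x
      unfolding f_def abs_mult using b wave_primitive_bound[OF c a(1)] by (intro mult_mono) auto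
    obtain W \<phi> F where W: "eigenbasis X (add_diag A W) \<phi> F" "\<And>x. x \<in> X \<Longrightarrow> \<bar>W x - U x\<bar> \<le> \<zeta>"
      "(\<Sum>v\<in>X. \<bar>local_mean X \<phi> F f' v\<bar>) \<le> \<gamma> * card X"
      using ex_small_gradient[where A = A and V = U, OF X sym fb K(2) K(1) \<gamma> \<zeta>(1) a'(1)] by blast
    interpret two_potentials X A U \<psi> E W \<phi> F by unfold_locales (fact X sym U(1) W(1))+
    have "\<bar>W x - V x\<bar> \<le> \<eta>'" if "x \<in> X" for x
      using W(2)[OF that] U(2)[OF that] \<zeta>(2) by linarith
    moreover have "(\<Sum>v\<in>X. \<bar>local_mean X \<phi> F (\<lambda>x. \<rho> x * wave c a x) v\<bar>) \<le> 2 * \<gamma> * card X"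
    proof -
      have prim: "\<bar>\<rho>' x * wave_primitive c a x\<bar> \<le> \<gamma>" for x
      proof -
        have "\<bar>\<rho>' x * wave_primitive c a x\<bar> \<le> b' * (pi / a)"
          unfolding abs_mult using b' wave_primitive_bound[OF c a(1)] by (intro mult_mono) auto
        then show ?thesis using a'(2) by simp
      qed
      have "\<bar>local_mean X \<phi> F (\<lambda>x. \<rho> x * wave c a x) v\<bar> \<le> \<bar>local_mean X \<phi> F f' v\<bar> + \<gamma>" if "v \<in> X" for v
      proof -
        have "local_mean X \<phi> F f' v = local_mean X \<phi> F (\<lambda>x. \<rho>' x * wave_primitive c a x) v
            + local_mean X \<phi> F (\<lambda>x. \<rho> x * wave c a x) v"
          unfolding f'_def[abs_def] local_mean_def by (rule weighted_sum_add)
        then show ?thesis using local_mean_abs_le[OF X W(1) that, where q = "\<lambda>x. \<rho>' x * wave_primitive c a x", OF prim] by linarith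
      qed
      then have "(\<Sum>v\<in>X. \<bar>local_mean X \<phi> F (\<lambda>x. \<rho> x * wave c a x) v\<bar>)
          \<le> (\<Sum>v\<in>X. \<bar>local_mean X \<phi> F f' v\<bar> + \<gamma>)"
        by (intro sum_mono)
      also have "\<dots> = (\<Sum>v\<in>X. \<bar>local_mean X \<phi> F f' v\<bar>) + \<gamma> * card X"
        by (simp add: sum.distrib)
      finally show ?thesis using W(3) by simp
    qed
    moreover have "(\<Sum>g\<leftarrow>gs. \<Sum>v\<in>X. \<bar>local_mean X \<phi> F g v\<bar>) \<le> \<theta> * card X + \<gamma> * card X"
    proof -
      have each: "(\<Sum>v\<in>X. \<bar>local_mean X \<phi> F g v\<bar>)
          \<le> (\<Sum>v\<in>X. \<bar>local_mean X \<psi> E g v\<bar>) + L * \<zeta> * card X" if g: "g \<in> set gs" for g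
      proof -
        have "(\<Sum>v\<in>X. \<bar>local_mean X \<phi> F g v\<bar>)
          \<le> (\<Sum>v\<in>X. \<bar>local_mean X \<psi> E g v\<bar> + \<bar>local_mean X \<phi> F g v - local_mean X \<psi> E g v\<bar>)"
          by (intro sum_mono) simp
        also have "\<dots> = (\<Sum>v\<in>X. \<bar>local_mean X \<psi> E g v\<bar>)
            + (\<Sum>v\<in>X. \<bar>local_mean X \<phi> F g v - local_mean X \<psi> E g v\<bar>)"
          by (rule sum.distrib)
        finally show ?thesis
          using sum_local_mean_lipschitz[of g L \<zeta>, OF L(2)[OF g] \<zeta>(1) W(2)] by simp
      qed
      have "(\<Sum>g\<leftarrow>gs. \<Sum>v\<in>X. \<bar>local_mean X \<phi> F g v\<bar>)
          \<le> (\<Sum>g\<leftarrow>gs. (\<Sum>v\<in>X. \<bar>local_mean X \<psi> E g v\<bar>) + L * \<zeta> * card X)"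
        using each by (intro sum_list_mono)
      also have "\<dots> = (\<Sum>g\<leftarrow>gs. \<Sum>v\<in>X. \<bar>local_mean X \<psi> E g v\<bar>) + real (length gs) * (L * \<zeta>) * card X"
        by (simp add: sum_list_addf sum_list_triv mult.assoc)
      also have "\<dots> \<le> \<theta> * card X + \<gamma> * card X"
        using U(3) L\<zeta> by (intro add_mono mult_right_mono) auto
      finally show ?thesis .
    qed
    moreover have "2 * \<gamma> * card X + (\<theta> * card X + \<gamma> * card X) = \<theta>' * card X"
      by (simp add: \<gamma>_def field_simps)
    ultimately show "\<exists>W \<psi> E. eigenbasis X (add_diag A W) \<psi> E \<and> (\<forall>x\<in>X. \<bar>W x - V x\<bar> \<le> \<eta>') \<and>
      (\<Sum>g\<leftarrow>(\<lambda>x. \<rho> x * wave c a x) # gs. \<Sum>v\<in>X. \<bar>local_mean X \<psi> E g v\<bar>) \<le> \<theta>' * card X"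
      using W(1) by (intro exI[of _ W] exI[of _ \<phi>] exI[of _ F]) auto
  qed
  then show ?thesis using a(1) by blast
qed

section \<open>Dyadic splitting of the local spectral measures\<close>

text \<open>The bound holds for every potential bounded by \<Lambda>, since B has to be fixed before
  the perturbed potential is found.\<close>

definition rare ::
  "('a set \<times> ('a \<Rightarrow> 'a \<Rightarrow> real)) set \<Rightarrow> real \<Rightarrow> real \<Rightarrow> real set \<Rightarrow> bool" where
  "rare \<S> \<Lambda> \<kappa> B \<longleftrightarrow> (\<exists>n\<^sub>0::nat. \<forall>(X, A)\<in>\<S>. n\<^sub>0 < card X \<longrightarrow>
     (\<forall>W \<psi> E. (\<forall>x\<in>X. \<bar>W x\<bar> \<le> \<Lambda>) \<longrightarrow> eigenbasis X (add_diag A W) \<psi> E \<longrightarrow>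
        real (card {k \<in> X. E k \<in> B}) \<le> \<kappa> * card X))"

lemma rareE:
  assumes "rare \<S> \<Lambda> \<kappa> B"
  obtains n :: nat where "\<And>X A W \<psi> E. (X, A) \<in> \<S> \<Longrightarrow> n < card X \<Longrightarrow> \<forall>x\<in>X. \<bar>W x\<bar> \<le> \<Lambda> \<Longrightarrow>
    eigenbasis X (add_diag A W) \<psi> E \<Longrightarrow> real (card {k \<in> X. E k \<in> B}) \<le> \<kappa> * card X"
proof -
  obtain n :: nat where n: "\<forall>(X, A)\<in>\<S>. n < card X \<longrightarrow>
     (\<forall>W \<psi> E. (\<forall>x\<in>X. \<bar>W x\<bar> \<le> \<Lambda>) \<longrightarrow> eigenbasis X (add_diag A W) \<psi> E \<longrightarrow>
        real (card {k \<in> X. E k \<in> B}) \<le> \<kappa> * card X)"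
    using assms unfolding rare_def by (elim exE)
  show thesis
  proof (rule that[of n])
    fix X A W \<psi> E
    assume "(X, A) \<in> \<S>" and X: "n < card X" "\<forall>x\<in>X. \<bar>W x\<bar> \<le> \<Lambda>" "eigenbasis X (add_diag A W) \<psi> E"
    from bspec[OF n this(1)] X show "real (card {k \<in> X. E k \<in> B}) \<le> \<kappa> * card X" by simp
  qed
qed

lemma rare_empty: "\<kappa> \<ge> 0 \<Longrightarrow> rare \<S> \<Lambda> \<kappa> {}"
  by (auto simp: rare_def)

lemma rare_Un:
  assumes fam: "symmetric_family \<S>" and 1: "rare \<S> \<Lambda> \<kappa> B" and 2: "rare \<S> \<Lambda> \<mu> C"
  shows "rare \<S> \<Lambda> (\<kappa> + \<mu>) (B \<union> C)"
proof -
  obtain m :: nat where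
    m: "\<And>X A W \<psi> E. (X, A) \<in> \<S> \<Longrightarrow> m < card X \<Longrightarrow> \<forall>x\<in>X. \<bar>W x\<bar> \<le> \<Lambda> \<Longrightarrow>
      eigenbasis X (add_diag A W) \<psi> E \<Longrightarrow> real (card {k \<in> X. E k \<in> B}) \<le> \<kappa> * card X"
    by (rule rareE[OF 1]) blast
  obtain n :: nat where
    n: "\<And>X A W \<psi> E. (X, A) \<in> \<S> \<Longrightarrow> n < card X \<Longrightarrow> \<forall>x\<in>X. \<bar>W x\<bar> \<le> \<Lambda> \<Longrightarrow>
      eigenbasis X (add_diag A W) \<psi> E \<Longrightarrow> real (card {k \<in> X. E k \<in> C}) \<le> \<mu> * card X"
    by (rule rareE[OF 2]) blast
  have "real (card {k \<in> X. E k \<in> B \<union> C}) \<le> (\<kappa> + \<mu>) * card X"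
    if X: "(X, A) \<in> \<S>" "max m n < card X" "\<forall>x\<in>X. \<bar>W x\<bar> \<le> \<Lambda>" "eigenbasis X (add_diag A W) \<psi> E" for X A W \<psi> E
  proof -
    have "card {k \<in> X. E k \<in> B \<union> C} \<le> card ({k \<in> X. E k \<in> B} \<union> {k \<in> X. E k \<in> C})"
      using fam X by (intro card_mono) (auto simp: symmetric_family_def)
    also have "\<dots> \<le> card {k \<in> X. E k \<in> B} + card {k \<in> X. E k \<in> C}" by (rule card_Un_le)
    finally have "real (card {k \<in> X. E k \<in> B \<union> C}) \<le> real (card {k \<in> X. E k \<in> B}) + real (card {k \<in> X. E k \<in> C})"
      by linarith
    also have "\<dots> \<le> \<kappa> * card X + \<mu> * card X"
      using m[OF X(1) _ X(3,4)] n[OF X(1) _ X(3,4)] X(2) by (intro add_mono) auto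
    finally show ?thesis by (simp add: distrib_right)
  qed
  then show ?thesis unfolding rare_def by (intro exI[of _ "max m n"]) auto
qed

lemma rare_mono:
  assumes fam: "symmetric_family \<S>" and "rare \<S> \<Lambda> \<kappa> B" "C \<subseteq> B" "\<kappa> \<le> \<mu>"
  shows "rare \<S> \<Lambda> \<mu> C"
proof -
  obtain m :: nat where
    m: "\<And>X A W \<psi> E. (X, A) \<in> \<S> \<Longrightarrow> m < card X \<Longrightarrow> \<forall>x\<in>X. \<bar>W x\<bar> \<le> \<Lambda> \<Longrightarrow>
      eigenbasis X (add_diag A W) \<psi> E \<Longrightarrow> real (card {k \<in> X. E k \<in> B}) \<le> \<kappa> * card X"
    by (rule rareE[OF assms(2)]) blast
  have "real (card {k \<in> X. E k \<in> C}) \<le> \<mu> * card X"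
    if X: "(X, A) \<in> \<S>" "m < card X" "\<forall>x\<in>X. \<bar>W x\<bar> \<le> \<Lambda>" "eigenbasis X (add_diag A W) \<psi> E" for X A W \<psi> E
  proof -
    have "card {k \<in> X. E k \<in> C} \<le> card {k \<in> X. E k \<in> B}"
      using fam X assms(3) by (intro card_mono) (auto simp: symmetric_family_def)
    then have "real (card {k \<in> X. E k \<in> C}) \<le> \<kappa> * card X" using m[OF X] by linarith
    also have "\<dots> \<le> \<mu> * card X" using assms(4) by (intro mult_right_mono) auto
    finally show ?thesis .
  qed
  then show ?thesis unfolding rare_def by (intro exI[of _ m]) auto
qed

lemma rare_UN:
  fixes \<kappa> :: real
  assumes fam: "symmetric_family \<S>" and "finite Z" and "\<And>z. z \<in> Z \<Longrightarrow> rare \<S> \<Lambda> \<kappa> (B z)"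
  shows "rare \<S> \<Lambda> (card Z * \<kappa>) (\<Union>z\<in>Z. B z)"
  using assms(2,3)
proof (induction Z rule: finite_induct)
  case (insert z Z)
  then have "rare \<S> \<Lambda> (\<kappa> + card Z * \<kappa>) (B z \<union> (\<Union>z\<in>Z. B z))" by (intro rare_Un[OF fam]) auto
  then show ?case using insert.hyps by (simp add: algebra_simps)
qed (simp add: rare_empty)

lemma finite_sin_zeros:
  fixes a C :: real
  assumes "a > 0"
  shows "finite {x \<in> {-C..C}. sin (a * x) = 0}"
proof -
  have "{x \<in> {-C..C}. sin (a * x) = 0} \<subseteq> (\<lambda>i::int. of_int i * pi / a) ` {- \<lceil>a * C / pi\<rceil>..\<lceil>a * C / pi\<rceil>}"
  proof
    fix x assume x: "x \<in> {x \<in> {-C..C}. sin (a * x) = 0}"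
    then obtain i :: int where i: "a * x = of_int i * pi" by (auto simp: sin_zero_iff_int2)
    have "\<bar>a * x\<bar> \<le> a * C" using x assms by (auto simp: abs_mult abs_le_iff)
    then have "\<bar>of_int i\<bar> * pi \<le> a * C" unfolding i by (simp add: abs_mult)
    then have "\<bar>real_of_int i\<bar> \<le> a * C / pi" using pi_gt_zero by (simp add: field_simps)
    then have "\<bar>real_of_int i\<bar> \<le> of_int \<lceil>a * C / pi\<rceil>" using le_of_int_ceiling order_trans by blast
    then have "i \<in> {- \<lceil>a * C / pi\<rceil>..\<lceil>a * C / pi\<rceil>}" by (auto simp: abs_le_iff)
    moreover have "x = of_int i * pi / a" using i assms by (simp add: field_simps)
    ultimately show "x \<in> (\<lambda>i::int. of_int i * pi / a) ` {- \<lceil>a * C / pi\<rceil>..\<lceil>a * C / pi\<rceil>}" by blast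
  qed
  then show ?thesis using finite_surj[OF finite_atLeastAtMost_int] by blast
qed

text \<open>Quantitative absence of atoms in the density of states, uniform over the bounded
  potentials.\<close>

definition rare_points :: "('a set \<times> ('a \<Rightarrow> 'a \<Rightarrow> real)) set \<Rightarrow> real \<Rightarrow> bool" where
  "rare_points \<S> \<Lambda> \<longleftrightarrow> (\<forall>\<kappa>>0. \<forall>e. \<exists>\<tau>>0. rare \<S> \<Lambda> \<kappa> (ball e \<tau>))"

text \<open>The sine has finitely many zeros in the bounded energy range, and each gets a ball with
  a small share of the eigenvalues. By compactness the sine is bounded below by some m > 0 on the
  rest, and this m determines c.\<close>

lemma rare_wave_transition:
  assumes fam: "symmetric_family \<S>" and pts: "rare_points \<S> \<Lambda>" and a: "a > 0" and \<kappa>: "\<kappa> > 0"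
  shows "\<exists>c>1. rare \<S> \<Lambda> \<kappa> {x \<in> {-C..C}. \<bar>wave c a x\<bar> < 1 / 2}"
proof -
  define Z where "Z = {x \<in> {-C..C}. sin (a * x) = 0}"
  have Z: "finite Z" unfolding Z_def by (rule finite_sin_zeros[OF a])
  have "\<forall>z\<in>Z. \<exists>\<tau>>0. rare \<S> \<Lambda> (\<kappa> / (card Z + 1)) (ball z \<tau>)"
    using pts \<kappa> unfolding rare_points_def by (simp add: add_nonneg_pos)
  then obtain \<tau> where \<tau>: "\<And>z. z \<in> Z \<Longrightarrow> \<tau> z > 0"
    "\<And>z. z \<in> Z \<Longrightarrow> rare \<S> \<Lambda> (\<kappa> / (card Z + 1)) (ball z (\<tau> z))" by metis
  define U where "U = (\<Union>z\<in>Z. ball z (\<tau> z))"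
  have "rare \<S> \<Lambda> (card Z * (\<kappa> / (card Z + 1))) U"
    unfolding U_def by (rule rare_UN[OF fam Z \<tau>(2)])
  moreover have "card Z * (\<kappa> / (card Z + 1)) \<le> \<kappa>" using \<kappa> by (simp add: field_simps)
  ultimately have U: "rare \<S> \<Lambda> \<kappa> U" using rare_mono[OF fam] by blast
  have "\<exists>m>0. \<forall>x\<in>{-C..C} - U. m \<le> \<bar>sin (a * x)\<bar>"
  proof (cases "{-C..C} - U = {}")
    case True
    then show ?thesis by (intro exI[of _ 1]) (simp only: True, simp)
  next
    case False
    have "compact ({-C..C} - U)" unfolding U_def by (intro compact_diff) auto
    moreover have "continuous_on ({-C..C} - U) (\<lambda>x. \<bar>sin (a * x)\<bar>)" by (intro continuous_intros)
    ultimately obtain y where y: "y \<in> {-C..C} - U" "\<And>x. x \<in> {-C..C} - U \<Longrightarrow> \<bar>sin (a * y)\<bar> \<le> \<bar>sin (a * x)\<bar>"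
      using continuous_attains_inf[of "{-C..C} - U" "\<lambda>x. \<bar>sin (a * x)\<bar>"] False by blast
    have "y \<notin> Z" using y(1) \<tau>(1) by (auto simp: U_def)
    then have "\<bar>sin (a * y)\<bar> > 0" using y(1) by (auto simp: Z_def)
    then show ?thesis using y(2) by blast
  qed
  then obtain m where m: "m > 0" "\<And>x. x \<in> {-C..C} - U \<Longrightarrow> m \<le> \<bar>sin (a * x)\<bar>" by blast
  have "{x \<in> {-C..C}. \<bar>wave (1 + m\<^sup>2) a x\<bar> < 1 / 2} \<subseteq> U"
  proof
    fix x assume "x \<in> {x \<in> {-C..C}. \<bar>wave (1 + m\<^sup>2) a x\<bar> < 1 / 2}"
    then show "x \<in> U" using m(2)[of x] wave_ge_half[OF m(1), of a x] by force
  qed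
  then have "rare \<S> \<Lambda> \<kappa> {x \<in> {-C..C}. \<bar>wave (1 + m\<^sup>2) a x\<bar> < 1 / 2}" by (rule rare_mono[OF fam U]) simp
  then show ?thesis using m(1) by (intro exI[of _ "1 + m\<^sup>2"]) simp
qed

text \<open>Every wave splits a bump \<open>\<rho>\<close> into the two halves \<open>\<rho> (1 \<plusminus> wave) / 2\<close>. Flattening \<open>\<rho> \<cdot> wave\<close>
  makes both halves carry the same spectral mass at most sites, so after \<open>r\<close> rounds each leaf
  has mass about \<open>2\<^sup>-\<^sup>r\<close>, while outside the rare transition zones one leaf is at least \<open>(3/4)\<^sup>r\<close>.\<close>

lemma dyadic_splitting:
  fixes \<S> :: "('a set \<times> ('a \<Rightarrow> 'a \<Rightarrow> real)) set"
  assumes fam: "symmetric_family \<S>" and pts: "rare_points \<S> \<Lambda>"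
    and "\<rho> \<in> wave_algebra" "\<And>x. 0 \<le> \<rho> x" "set gs \<subseteq> wave_algebra" "flattenable \<S> gs \<eta> \<theta>"
    and "\<eta> < \<eta>'" "\<theta> < \<theta>'" "\<kappa> > 0"
  shows "\<exists>hs leaves B. set hs \<subseteq> wave_algebra \<and> flattenable \<S> (hs @ gs) \<eta>' \<theta>' \<and> rare \<S> \<Lambda> \<kappa> B \<and>
    (\<forall>x\<in>{-C..C} - B. \<exists>l\<in>leaves. (3 / 4) ^ r * \<rho> x \<le> l x) \<and>
    (\<forall>l\<in>leaves. (\<forall>x. 0 \<le> l x) \<and> (\<forall>(X::'a set) p e. weighted_sum X p e l
       \<le> weighted_sum X p e \<rho> / 2 ^ r + (\<Sum>h\<leftarrow>hs. \<bar>weighted_sum X p e h\<bar>)))"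
  using assms(3-)
proof (induction r arbitrary: \<rho> gs \<eta> \<theta> \<eta>' \<theta>' \<kappa>)
  case 0
  then have "flattenable \<S> ([] @ gs) \<eta>' \<theta>'" using flattenable_mono[of \<S> gs \<eta> \<theta> \<eta>' \<theta>'] by simp
  moreover have "rare \<S> \<Lambda> \<kappa> {}" using 0 by (simp add: rare_empty)
  ultimately show ?case
    using 0 by (intro exI[of _ "[]"] exI[of _ "{\<rho>}"] exI[of _ "{}"]) auto
next
  case (Suc r)
  note \<rho> = Suc.prems(1,2) and gs = Suc.prems(3)
  \<comment> \<open>Three stages share the slack: the wave itself, the subtree below its positive
    half and the subtree below its negative half.\<close>
  define \<eta>1 where "\<eta>1 = \<eta> + (\<eta>' - \<eta>) / 3"
  define \<eta>2 where "\<eta>2 = \<eta> + 2 * (\<eta>' - \<eta>) / 3"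
  define \<theta>1 where "\<theta>1 = \<theta> + (\<theta>' - \<theta>) / 3"
  define \<theta>2 where "\<theta>2 = \<theta> + 2 * (\<theta>' - \<theta>) / 3"
  have \<eta>: "\<eta> < \<eta>1" "\<eta>1 < \<eta>2" "\<eta>2 < \<eta>'" using Suc.prems(5) by (auto simp: \<eta>1_def \<eta>2_def field_simps)
  have \<theta>: "\<theta> < \<theta>1" "\<theta>1 < \<theta>2" "\<theta>2 < \<theta>'" using Suc.prems(6) by (auto simp: \<theta>1_def \<theta>2_def field_simps)
  have \<kappa>: "\<kappa> / 3 > 0" using Suc.prems(7) by simp
  obtain a where a: "a > 0" "\<And>c. c > 1 \<Longrightarrow> flattenable \<S> ((\<lambda>x. \<rho> x * wave c a x) # gs) \<eta>1 \<theta>1"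
    using flattenable_Cons_wave[OF fam Suc.prems(4) gs \<rho>(1) \<eta>(1) \<theta>(1)] by blast
  obtain c where c: "c > 1" "rare \<S> \<Lambda> (\<kappa> / 3) {x \<in> {-C..C}. \<bar>wave c a x\<bar> < 1 / 2}"
    using rare_wave_transition[OF fam pts a(1) \<kappa>] by blast
  define B\<^sub>0 where "B\<^sub>0 = {x \<in> {-C..C}. \<bar>wave c a x\<bar> < 1 / 2}"
  define g where "g = (\<lambda>x. \<rho> x * wave c a x)"
  define half where "half s = (\<lambda>x. 1 / 2 * \<rho> x + s / 2 * g x)" for s :: real
  have g: "g \<in> wave_algebra" unfolding g_def by (intro wave_algebra.mult \<rho> wave_in_algebra c)
  have half: "half s \<in> wave_algebra" for s
    unfolding half_def by (intro wave_algebra.add wave_algebra.mult wave_algebra.const \<rho> g)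
  have half_eq: "half s x = \<rho> x * ((1 + s * wave c a x) / 2)" for s x
    by (simp add: half_def g_def algebra_simps add_divide_distrib)
  have half_nonneg: "0 \<le> half s x" if "\<bar>s\<bar> = 1" for s x
  proof -
    have "\<bar>s * wave c a x\<bar> \<le> 1" using abs_wave_le_1[OF c(1)] that by (simp add: abs_mult)
    then show ?thesis unfolding half_eq using \<rho>(2) by (intro mult_nonneg_nonneg) auto
  qed
  have half_mean: "weighted_sum X p e (half s) \<le> weighted_sum X p e \<rho> / 2 + \<bar>weighted_sum X p e g\<bar> / 2"
    if "\<bar>s\<bar> = 1" for s and X :: "'a set" and p e
  proof -
    have "weighted_sum X p e (half s) = 1 / 2 * weighted_sum X p e \<rho> + s / 2 * weighted_sum X p e g"
      unfolding half_def by (simp only: weighted_sum_add weighted_sum_cmult)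
    moreover have "s * weighted_sum X p e g \<le> \<bar>weighted_sum X p e g\<bar>"
      using abs_ge_self[of "s * weighted_sum X p e g"] that by (simp add: abs_mult)
    ultimately show ?thesis by simp
  qed
  have flat1: "flattenable \<S> (g # gs) \<eta>1 \<theta>1" unfolding g_def by (rule a(2)[OF c(1)])
  have gs1: "set (g # gs) \<subseteq> wave_algebra" using g gs by simp
  have "\<And>x. 0 \<le> half 1 x" by (rule half_nonneg) simp
  from Suc.IH[OF half this gs1 flat1 \<eta>(2) \<theta>(2) \<kappa>] obtain hs1 L1 B1 where
    hs1: "set hs1 \<subseteq> wave_algebra" "flattenable \<S> (hs1 @ g # gs) \<eta>2 \<theta>2" "rare \<S> \<Lambda> (\<kappa> / 3) B1" and
    L1: "\<And>x. x \<in> {-C..C} - B1 \<Longrightarrow> \<exists>l\<in>L1. (3 / 4) ^ r * half 1 x \<le> l x" "\<And>l x. l \<in> L1 \<Longrightarrow> 0 \<le> l x"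
      "\<And>l (X::'a set) p e. l \<in> L1 \<Longrightarrow> weighted_sum X p e l
         \<le> weighted_sum X p e (half 1) / 2 ^ r + (\<Sum>h\<leftarrow>hs1. \<bar>weighted_sum X p e h\<bar>)" by blast
  have gs2: "set (hs1 @ g # gs) \<subseteq> wave_algebra" using hs1 gs1 by simp
  have "\<And>x. 0 \<le> half (- 1) x" by (rule half_nonneg) simp
  \<comment> \<open>The second subtree is built on top of everything flattened so far, so that one
    potential serves both subtrees in the end.\<close>
  from Suc.IH[OF half this gs2 hs1(2) \<eta>(3) \<theta>(3) \<kappa>] obtain hs2 L2 B2 where
    hs2: "set hs2 \<subseteq> wave_algebra" "flattenable \<S> (hs2 @ hs1 @ g # gs) \<eta>' \<theta>'" "rare \<S> \<Lambda> (\<kappa> / 3) B2" and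
    L2: "\<And>x. x \<in> {-C..C} - B2 \<Longrightarrow> \<exists>l\<in>L2. (3 / 4) ^ r * half (- 1) x \<le> l x" "\<And>l x. l \<in> L2 \<Longrightarrow> 0 \<le> l x"
      "\<And>l (X::'a set) p e. l \<in> L2 \<Longrightarrow> weighted_sum X p e l
         \<le> weighted_sum X p e (half (- 1)) / 2 ^ r + (\<Sum>h\<leftarrow>hs2. \<bar>weighted_sum X p e h\<bar>)" by blast
  define hs where "hs = hs2 @ hs1 @ [g]"
  have hs_sum: "(\<Sum>h\<leftarrow>hs. \<bar>weighted_sum X p e h\<bar>) = (\<Sum>h\<leftarrow>hs2. \<bar>weighted_sum X p e h\<bar>)
      + (\<Sum>h\<leftarrow>hs1. \<bar>weighted_sum X p e h\<bar>) + \<bar>weighted_sum X p e g\<bar>" for X :: "'a set" and p e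
    by (simp add: hs_def)
  have hs_nonneg: "0 \<le> (\<Sum>h\<leftarrow>ks. \<bar>weighted_sum X p e h\<bar>)" for X :: "'a set" and p e ks
    by (rule sum_list_nonneg) auto
  have halves: "weighted_sum X p e (half s) / 2 ^ r \<le> weighted_sum X p e \<rho> / 2 ^ Suc r + \<bar>weighted_sum X p e g\<bar>"
    if "\<bar>s\<bar> = 1" for s and X :: "'a set" and p e
  proof -
    have "weighted_sum X p e (half s) / 2 ^ r
        \<le> (weighted_sum X p e \<rho> / 2 + \<bar>weighted_sum X p e g\<bar> / 2) / 2 ^ r"
      using half_mean[OF that] by (intro divide_right_mono) auto
    also have "\<dots> = weighted_sum X p e \<rho> / 2 ^ Suc r + \<bar>weighted_sum X p e g\<bar> / 2 ^ Suc r"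
      by (simp add: field_simps)
    \<comment> \<open>The factor is given away so that each deviation enters the final sum with
      coefficient 1.\<close>
    also have "\<bar>weighted_sum X p e g\<bar> / 2 ^ Suc r \<le> \<bar>weighted_sum X p e g\<bar> / 1"
      by (intro divide_left_mono) (auto simp: one_le_power simp del: power_Suc)
    finally show ?thesis by simp
  qed
  have means: "weighted_sum X p e l \<le> weighted_sum X p e \<rho> / 2 ^ Suc r + (\<Sum>h\<leftarrow>hs. \<bar>weighted_sum X p e h\<bar>)"
    if "l \<in> L1 \<union> L2" for l and X :: "'a set" and p e
    using that
  proof
    assume l: "l \<in> L1"
    show ?thesis
      using L1(3)[OF l, of X p e] halves[of 1 X p e] hs_sum[where X = X and p = p and e = e] hs_nonneg[of X p e hs2] by simp
  next
    assume l: "l \<in> L2"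
    show ?thesis
      using L2(3)[OF l, of X p e] halves[of "- 1" X p e] hs_sum[where X = X and p = p and e = e] hs_nonneg[of X p e hs1] by simp
  qed
  have cover: "\<exists>l\<in>L1 \<union> L2. (3 / 4) ^ Suc r * \<rho> x \<le> l x" if x: "x \<in> {-C..C} - (B\<^sub>0 \<union> (B1 \<union> B2))" for x
  proof -
    have w: "\<bar>wave c a x\<bar> \<ge> 1 / 2" using x by (auto simp: B\<^sub>0_def)
    \<comment> \<open>Where the wave is at least 1/2 in absolute value, the half of matching sign
      keeps the fraction (1 + 1/2) / 2 = 3/4 of \<rho>.\<close>
    have big: "(3 / 4) ^ Suc r * \<rho> x \<le> (3 / 4) ^ r * half s x" if "s * wave c a x \<ge> 1 / 2" for s
    proof -
      have "\<rho> x * (3 / 4) \<le> half s x" unfolding half_eq using that \<rho>(2) by (intro mult_left_mono) auto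
      then have "(3 / 4) ^ r * (\<rho> x * (3 / 4)) \<le> (3 / 4) ^ r * half s x" by (intro mult_left_mono) auto
      then show ?thesis by (simp add: mult_ac)
    qed
    show ?thesis
    proof (cases "wave c a x \<ge> 0")
      case True
      then have "(3 / 4) ^ Suc r * \<rho> x \<le> (3 / 4) ^ r * half 1 x" using w by (intro big) simp
      moreover obtain l where "l \<in> L1" "(3 / 4) ^ r * half 1 x \<le> l x" using L1(1)[of x] x by blast
      ultimately have "(3 / 4) ^ Suc r * \<rho> x \<le> l x" by linarith
      then show ?thesis using \<open>l \<in> L1\<close> by blast
    next
      case False
      then have "(3 / 4) ^ Suc r * \<rho> x \<le> (3 / 4) ^ r * half (- 1) x" using w by (intro big) simp
      moreover obtain l where "l \<in> L2" "(3 / 4) ^ r * half (- 1) x \<le> l x" using L2(1)[of x] x by blast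
      ultimately have "(3 / 4) ^ Suc r * \<rho> x \<le> l x" by linarith
      then show ?thesis using \<open>l \<in> L2\<close> by blast
    qed
  qed
  have "rare \<S> \<Lambda> (\<kappa> / 3 + (\<kappa> / 3 + \<kappa> / 3)) (B\<^sub>0 \<union> (B1 \<union> B2))"
    using c(2) hs1(3) hs2(3) unfolding B\<^sub>0_def by (intro rare_Un[OF fam])
  then have "rare \<S> \<Lambda> \<kappa> (B\<^sub>0 \<union> (B1 \<union> B2))" by simp
  moreover have "flattenable \<S> (hs @ gs) \<eta>' \<theta>'" using hs2(2) by (simp add: hs_def)
  moreover have "set hs \<subseteq> wave_algebra" using hs1 hs2 g by (simp add: hs_def)
  moreover have "\<forall>l\<in>L1 \<union> L2. \<forall>x. 0 \<le> l x" using L1(2) L2(2) by blast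
  ultimately show ?case
    using means cover by (intro exI[of _ hs] exI[of _ "L1 \<union> L2"] exI[of _ "B\<^sub>0 \<union> (B1 \<union> B2)"]) blast
qed

section \<open>From balanced leaves to small atoms\<close>

lemma card_mult_le_sum:
  fixes f :: "'a \<Rightarrow> real"
  assumes X: "finite X" and f: "\<And>v. v \<in> X \<Longrightarrow> 0 \<le> f v"
  shows "c * card {v \<in> X. c < f v} \<le> (\<Sum>v\<in>X. f v)"
proof -
  have "c * card {v \<in> X. c < f v} = (\<Sum>v\<in>{v \<in> X. c < f v}. c)" by simp
  also have "\<dots> \<le> (\<Sum>v\<in>{v \<in> X. c < f v}. f v)" by (rule sum_mono) auto
  also have "\<dots> \<le> (\<Sum>v\<in>X. f v)" using X f by (intro sum_mono2) auto
  finally show ?thesis .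
qed

lemma sum_sum_list_swap:
  "(\<Sum>v\<in>X. \<Sum>h\<leftarrow>hs. f h v) = (\<Sum>h\<leftarrow>hs. \<Sum>v\<in>X. (f h v :: real))"
  by (induction hs) (auto simp: sum.distrib)

text \<open>The sum runs over the whole fibre of E, which gives the weight of e in the spectral
  measure at v also for a multiple eigenvalue.\<close>

definition atom_mass :: "'a set \<Rightarrow> ('a \<Rightarrow> 'a \<Rightarrow> real) \<Rightarrow> ('a \<Rightarrow> real) \<Rightarrow> real \<Rightarrow> 'a \<Rightarrow> real" where
  "atom_mass X \<psi> E e v = (\<Sum>k\<in>{k \<in> X. E k = e}. (\<psi> k v)\<^sup>2)"

lemma atom_mass_le_leaf:
  assumes X: "finite X" and l: "\<And>x. 0 \<le> l x"
  shows "atom_mass X \<psi> E e v * l e \<le> local_mean X \<psi> E l v"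
proof -
  have "atom_mass X \<psi> E e v * l e = (\<Sum>k\<in>{k \<in> X. E k = e}. (\<psi> k v)\<^sup>2 * l (E k))"
    by (simp add: atom_mass_def sum_distrib_right)
  also have "\<dots> \<le> local_mean X \<psi> E l v"
    unfolding local_mean_def weighted_sum_def using X l by (intro sum_mono2) auto
  finally show ?thesis .
qed

text \<open>A site is discarded if the flattened functions deviate there by more than 2^-r in total,
  or if the rare set carries more than \<epsilon> of its spectral mass. At the other sites an atom
  outside the rare set sits under a leaf that is at least (3/4)^r at its energy and has mean at most
  2 * 2^-r.\<close>

theorem ex_delocalizing_perturbation:
  fixes \<S> :: "('a set \<times> ('a \<Rightarrow> 'a \<Rightarrow> real)) set" and \<epsilon> \<delta> \<eta> :: real
  assumes fam: "symmetric_family \<S>" and pts: "rare_points \<S> \<Lambda>"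
    and spec: "\<And>X A W \<psi> E k. (X, A) \<in> \<S> \<Longrightarrow> \<forall>x\<in>X. \<bar>W x\<bar> \<le> \<Lambda> \<Longrightarrow>
      eigenbasis X (add_diag A W) \<psi> E \<Longrightarrow> k \<in> X \<Longrightarrow> E k \<in> {-C..C}"
    and \<epsilon>: "\<epsilon> > 0" and \<delta>: "\<delta> > 0" and \<eta>: "\<eta> > 0"
  shows "\<exists>n\<^sub>0::nat. \<forall>X A V. (X, A) \<in> \<S> \<longrightarrow> n\<^sub>0 < card X \<longrightarrow> (\<forall>x\<in>X. \<bar>V x\<bar> + \<eta> \<le> \<Lambda>) \<longrightarrow>
    (\<exists>W \<psi> E. eigenbasis X (add_diag A W) \<psi> E \<and> (\<forall>x\<in>X. \<bar>W x - V x\<bar> \<le> \<eta>) \<and>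
      real (card {v \<in> X. \<exists>e. \<epsilon> < atom_mass X \<psi> E e v}) \<le> \<delta> * card X)"
proof -
  have "(\<lambda>r. 2 * (2 / 3 :: real) ^ r) \<longlonglongrightarrow> 2 * 0"
    by (intro tendsto_mult tendsto_const LIMSEQ_realpow_zero) auto
  then have "\<forall>\<^sub>F r in sequentially. 2 * (2 / 3 :: real) ^ r < \<epsilon>"
    using \<epsilon> by (intro order_tendstoD) auto
  then obtain r :: nat where r: "2 * (2 / 3 :: real) ^ r < \<epsilon>" by (auto simp: eventually_sequentially)
  \<comment> \<open>By Markov's inequality, deviation \<theta> per vertex leaves at most a fraction
    \<delta> / 2 of the sites above 2^-r, and \<kappa> eigenvalues per vertex in the rare set leave
    at most a fraction \<delta> / 2 with mass above \<epsilon> there.\<close>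
  define \<theta> where "\<theta> = \<delta> / 2 / 2 ^ r"
  define \<kappa> where "\<kappa> = \<epsilon> * \<delta> / 2"
  have \<theta>: "\<theta> > 0" and \<kappa>: "\<kappa> > 0" using \<delta> \<epsilon> by (auto simp: \<theta>_def \<kappa>_def)
  \<comment> \<open>Half of each budget, because the splitting needs strict slack; with nothing to
    flatten, V itself is a witness.\<close>
  have "flattenable \<S> [] (\<eta> / 2) (\<theta> / 2)"
    unfolding flattenable_def
  proof clarify
    fix X A and V :: "'a \<Rightarrow> real" assume "(X, A) \<in> \<S>"
    then have "\<exists>\<psi> E. eigenbasis X (add_diag A V) \<psi> E"
      using fam by (intro ex_eigenbasis) (auto simp: symmetric_family_def add_diag_def)
    then show "\<exists>W \<psi> E. eigenbasis X (add_diag A W) \<psi> E \<and> (\<forall>x\<in>X. \<bar>W x - V x\<bar> \<le> \<eta> / 2) \<and>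
        (\<Sum>g\<leftarrow>[]. \<Sum>v\<in>X. \<bar>local_mean X \<psi> E g v\<bar>) \<le> \<theta> / 2 * card X"
      using \<eta> \<theta> by (intro exI[of _ V]) auto
  qed
  from dyadic_splitting[OF fam pts wave_algebra.const[of 1] _ _ this, of \<eta> \<theta> \<kappa> C r] \<eta> \<theta> \<kappa>
  have "\<exists>hs leaves B. set hs \<subseteq> wave_algebra \<and> flattenable \<S> (hs @ []) \<eta> \<theta> \<and> rare \<S> \<Lambda> \<kappa> B \<and>
    (\<forall>x\<in>{-C..C} - B. \<exists>l\<in>leaves. (3 / 4) ^ r * 1 \<le> l x) \<and>
    (\<forall>l\<in>leaves. (\<forall>x. 0 \<le> l x) \<and> (\<forall>(X::'a set) p e. weighted_sum X p e l
       \<le> weighted_sum X p e (\<lambda>_. 1) / 2 ^ r + (\<Sum>h\<leftarrow>hs. \<bar>weighted_sum X p e h\<bar>)))"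
    by simp
  then obtain hs leaves B where
    flat: "flattenable \<S> (hs @ []) \<eta> \<theta>" and B: "rare \<S> \<Lambda> \<kappa> B" and
    cover: "\<forall>x\<in>{-C..C} - B. \<exists>l\<in>leaves. (3 / 4) ^ r * 1 \<le> l x" and
    leaves: "\<forall>l\<in>leaves. (\<forall>x. 0 \<le> l x) \<and> (\<forall>(X::'a set) p e. weighted_sum X p e l
       \<le> weighted_sum X p e (\<lambda>_. 1) / 2 ^ r + (\<Sum>h\<leftarrow>hs. \<bar>weighted_sum X p e h\<bar>))"
    by (elim exE conjE)
  have leaf: "0 \<le> l x" "weighted_sum X p e l
      \<le> weighted_sum X p e (\<lambda>_. 1) / 2 ^ r + (\<Sum>h\<leftarrow>hs. \<bar>weighted_sum X p e h\<bar>)"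
    if "l \<in> leaves" for l x and X :: "'a set" and p e
    using leaves that by blast+
  obtain n :: nat where
    n: "\<And>X A W \<psi> E. (X, A) \<in> \<S> \<Longrightarrow> n < card X \<Longrightarrow> \<forall>x\<in>X. \<bar>W x\<bar> \<le> \<Lambda> \<Longrightarrow>
      eigenbasis X (add_diag A W) \<psi> E \<Longrightarrow> real (card {k \<in> X. E k \<in> B}) \<le> \<kappa> * card X"
    by (rule rareE[OF B]) blast
  have "\<exists>W \<psi> E. eigenbasis X (add_diag A W) \<psi> E \<and> (\<forall>x\<in>X. \<bar>W x - V x\<bar> \<le> \<eta>) \<and>
      real (card {v \<in> X. \<exists>e. \<epsilon> < atom_mass X \<psi> E e v}) \<le> \<delta> * card X"
    if XA: "(X, A) \<in> \<S>" and card: "n < card X" and V: "\<forall>x\<in>X. \<bar>V x\<bar> + \<eta> \<le> \<Lambda>" for X A V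
  proof -
    have X: "finite X" using fam XA by (auto simp: symmetric_family_def)
    obtain W \<psi> E where eb: "eigenbasis X (add_diag A W) \<psi> E" and W: "\<forall>x\<in>X. \<bar>W x - V x\<bar> \<le> \<eta>"
      and small: "(\<Sum>h\<leftarrow>hs. \<Sum>v\<in>X. \<bar>local_mean X \<psi> E h v\<bar>) \<le> \<theta> * card X"
      using flat XA unfolding flattenable_def append_Nil2 by fast
    have "\<bar>W x\<bar> \<le> \<Lambda>" if "x \<in> X" for x
      using bspec[OF W that] bspec[OF V that] by linarith
    then have W\<Lambda>: "\<forall>x\<in>X. \<bar>W x\<bar> \<le> \<Lambda>" by blast
    define dev where "dev v = (\<Sum>h\<leftarrow>hs. \<bar>local_mean X \<psi> E h v\<bar>)" for v
    define mB where "mB v = (\<Sum>k\<in>{k \<in> X. E k \<in> B}. (\<psi> k v)\<^sup>2)" for v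
    have dev0: "0 \<le> dev v" for v unfolding dev_def by (rule sum_list_nonneg) auto
    have mB0: "0 \<le> mB v" for v unfolding mB_def by (rule sum_nonneg) auto
    define bad1 where "bad1 = {v \<in> X. (1 / 2) ^ r < dev v}"
    define bad2 where "bad2 = {v \<in> X. \<epsilon> < mB v}"
    have "(1 / 2) ^ r * card bad1 \<le> (\<Sum>v\<in>X. dev v)"
      unfolding bad1_def by (rule card_mult_le_sum[OF X dev0])
    also have "\<dots> \<le> \<theta> * card X" unfolding dev_def sum_sum_list_swap by (rule small)
    finally have bad1: "real (card bad1) \<le> \<delta> / 2 * card X"
      by (simp add: \<theta>_def field_simps power_one_over)
    have "\<epsilon> * card bad2 \<le> (\<Sum>v\<in>X. mB v)"
      unfolding bad2_def by (rule card_mult_le_sum[OF X mB0])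
    \<comment> \<open>Eigenvectors are normalized, so the mass of the rare set, summed over all
      sites, counts the eigenvalues in it.\<close>
    also have "(\<Sum>v\<in>X. mB v) = (\<Sum>k\<in>{k \<in> X. E k \<in> B}. \<Sum>v\<in>X. \<psi> k v * \<psi> k v)"
      unfolding mB_def power2_eq_square by (rule sum.swap)
    also have "\<dots> = (\<Sum>k\<in>{k \<in> X. E k \<in> B}. 1)"
      using eb by (intro sum.cong refl) (simp add: eigenbasis_def)
    also have "\<dots> = real (card {k \<in> X. E k \<in> B})" by simp
    also have "\<dots> \<le> \<kappa> * card X" by (rule n[OF XA card W\<Lambda> eb])
    finally have "\<epsilon> * card bad2 \<le> \<epsilon> * (\<delta> / 2 * card X)" by (simp add: \<kappa>_def)
    then have bad2: "real (card bad2) \<le> \<delta> / 2 * card X" using \<epsilon> by (simp only: mult_le_cancel_left_pos)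
    have good: "atom_mass X \<psi> E e v \<le> \<epsilon>" if v: "v \<in> X" "v \<notin> bad1" "v \<notin> bad2" for e v
    proof (cases "{k \<in> X. E k = e} = {}")
      case True
      then show ?thesis using \<epsilon> unfolding atom_mass_def by (simp only: True) simp
    next
      case False
      then have eC: "e \<in> {-C..C}" using spec[OF XA W\<Lambda> eb] by blast
      show ?thesis
      proof (cases "e \<in> B")
        case True
        have "atom_mass X \<psi> E e v \<le> mB v"
          unfolding atom_mass_def mB_def using X True by (intro sum_mono2) auto
        then show ?thesis using v by (simp add: bad2_def)
      next
        case eB: False
        with eC cover obtain l where l: "l \<in> leaves" "(3 / 4) ^ r \<le> l e" by force
        have p0: "0 \<le> atom_mass X \<psi> E e v" unfolding atom_mass_def by (rule sum_nonneg) auto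
        have one: "weighted_sum X (\<lambda>k. (\<psi> k v)\<^sup>2) E (\<lambda>_. 1) = 1"
          using eb v(1) by (simp add: weighted_sum_def eigenbasis_def power2_eq_square)
        have "atom_mass X \<psi> E e v * (3 / 4) ^ r \<le> atom_mass X \<psi> E e v * l e"
          using l(2) p0 by (rule mult_left_mono)
        also have "\<dots> \<le> local_mean X \<psi> E l v" by (rule atom_mass_le_leaf[OF X leaf(1)[OF l(1)]])
        also have "\<dots> \<le> 1 / 2 ^ r + dev v"
          using leaf(2)[OF l(1), of X "\<lambda>k. (\<psi> k v)\<^sup>2" E] unfolding one local_mean_def dev_def .
        also have "\<dots> \<le> 2 * (1 / 2) ^ r" using v by (simp add: bad1_def power_one_over)
        also have "\<dots> = 2 * (2 / 3) ^ r * (3 / 4) ^ r"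
          by (simp add: mult.assoc power_mult_distrib[symmetric])
        finally have "atom_mass X \<psi> E e v \<le> 2 * (2 / 3) ^ r" by simp
        then show ?thesis using r by simp
      qed
    qed
    have "{v \<in> X. \<exists>e. \<epsilon> < atom_mass X \<psi> E e v} \<subseteq> bad1 \<union> bad2"
      using good by (auto simp: not_le[symmetric])
    then have "card {v \<in> X. \<exists>e. \<epsilon> < atom_mass X \<psi> E e v} \<le> card (bad1 \<union> bad2)"
      using X by (intro card_mono) (auto simp: bad1_def bad2_def)
    also have "\<dots> \<le> card bad1 + card bad2" by (rule card_Un_le)
    finally have "real (card {v \<in> X. \<exists>e. \<epsilon> < atom_mass X \<psi> E e v}) \<le> \<delta> * card X"
      using bad1 bad2 by linarith
    then show ?thesis using eb W by blast
  qed
  then show ?thesis by blast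
qed

section \<open>Box graphs\<close>

lemma sum_square_combination:
  assumes X: "finite X" and eb: "eigenbasis X B \<psi> E" and K: "K \<subseteq> X"
  shows "(\<Sum>x\<in>X. (\<Sum>k\<in>K. c k * \<psi> k x)\<^sup>2) = (\<Sum>k\<in>K. (c k)\<^sup>2)"
proof -
  have fK: "finite K" using X K finite_subset by blast
  have "(\<Sum>x\<in>X. (\<Sum>k\<in>K. c k * \<psi> k x)\<^sup>2) = (\<Sum>x\<in>X. \<Sum>k\<in>K. \<Sum>l\<in>K. c k * c l * (\<psi> k x * \<psi> l x))"
    by (simp add: power2_eq_square sum_product mult_ac)
  also have "\<dots> = (\<Sum>k\<in>K. \<Sum>x\<in>X. \<Sum>l\<in>K. c k * c l * (\<psi> k x * \<psi> l x))"
    by (rule sum.swap)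
  also have "\<dots> = (\<Sum>k\<in>K. \<Sum>l\<in>K. \<Sum>x\<in>X. c k * c l * (\<psi> k x * \<psi> l x))"
    by (intro sum.cong refl sum.swap)
  also have "\<dots> = (\<Sum>k\<in>K. \<Sum>l\<in>K. c k * c l * of_bool (k = l))"
    proof (intro sum.cong refl)
    fix k l assume "k \<in> K" "l \<in> K"
    then have "k \<in> X" "l \<in> X" using K by auto
    then have "(\<Sum>x\<in>X. \<psi> k x * \<psi> l x) = of_bool (k = l)" using eb by (simp add: eigenbasis_def)
    then show "(\<Sum>x\<in>X. c k * c l * (\<psi> k x * \<psi> l x)) = c k * c l * of_bool (k = l)"
      by (simp only: sum_distrib_left[symmetric])
  qed
  also have "\<dots> = (\<Sum>k\<in>K. (c k)\<^sup>2)"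
    using sum_of_bool_mult(3)[OF fK] by (intro sum.cong refl) (simp add: power2_eq_square)
  finally show ?thesis .
qed

text \<open>If more eigenvectors than points of S belonged to the ball, some nontrivial combination
  of them would vanish on S. Its residual at e is at most \<tau> times its norm, so
  \<open>ucp\<close>, the unique continuation hypothesis, forces it to be zero.\<close>

lemma eigenvalue_count_le:
  assumes X: "finite X" and eb: "eigenbasis X B \<psi> E" and S: "S \<subseteq> X"
    and ucp: "\<And>\<phi>. (\<And>x. x \<in> S \<Longrightarrow> \<phi> x = 0) \<Longrightarrow>
      (\<Sum>x\<in>X. ((\<Sum>y\<in>X. B x y * \<phi> y) - e * \<phi> x)\<^sup>2) \<le> \<tau>\<^sup>2 * (\<Sum>x\<in>X. (\<phi> x)\<^sup>2) \<Longrightarrow> (\<Sum>x\<in>X. (\<phi> x)\<^sup>2) = 0"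
  shows "card {k \<in> X. E k \<in> ball e \<tau>} \<le> card S"
proof (rule ccontr)
  let ?K = "{k \<in> X. E k \<in> ball e \<tau>}"
  assume "\<not> ?thesis"
  then have less: "card S < card ?K" by simp
  have fS: "finite S" and fK: "finite ?K" using X S finite_subset by auto
  from homogeneous_system_nontrivial[OF fS fK less, of \<psi>] obtain c where
    c: "\<exists>k\<in>?K. c k \<noteq> 0" "\<And>x. x \<in> S \<Longrightarrow> (\<Sum>k\<in>?K. c k * \<psi> k x) = 0" by blast
  define \<phi> where "\<phi> x = (\<Sum>k\<in>?K. c k * \<psi> k x)" for x
  have KX: "?K \<subseteq> X" by auto
  have n\<phi>: "(\<Sum>x\<in>X. (\<phi> x)\<^sup>2) = (\<Sum>k\<in>?K. (c k)\<^sup>2)"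
    unfolding \<phi>_def by (rule sum_square_combination[OF X eb KX])
  have "(\<Sum>y\<in>X. B x y * \<phi> y) - e * \<phi> x = (\<Sum>k\<in>?K. (c k * (E k - e)) * \<psi> k x)" if x: "x \<in> X" for x
  proof -
    have "(\<Sum>y\<in>X. B x y * \<phi> y) = (\<Sum>k\<in>?K. c k * (\<Sum>y\<in>X. B x y * \<psi> k y))"
      unfolding \<phi>_def sum_distrib_left by (subst sum.swap) (simp add: mult_ac)
    also have "\<dots> = (\<Sum>k\<in>?K. c k * (E k * \<psi> k x))"
      using eb x by (intro sum.cong refl) (auto simp: eigenbasis_def)
    finally show ?thesis
      by (simp add: \<phi>_def sum_distrib_left sum_subtractf[symmetric] algebra_simps)
  qed
  then have "(\<Sum>x\<in>X. ((\<Sum>y\<in>X. B x y * \<phi> y) - e * \<phi> x)\<^sup>2)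
      = (\<Sum>x\<in>X. (\<Sum>k\<in>?K. (c k * (E k - e)) * \<psi> k x)\<^sup>2)" by simp
  also have "\<dots> = (\<Sum>k\<in>?K. (c k * (E k - e))\<^sup>2)"
    by (rule sum_square_combination[OF X eb KX])
  also have "\<dots> \<le> (\<Sum>k\<in>?K. \<tau>\<^sup>2 * (c k)\<^sup>2)"
  proof (rule sum_mono)
    fix k assume "k \<in> ?K"
    then have "\<bar>E k - e\<bar> \<le> \<bar>\<tau>\<bar>" unfolding mem_Collect_eq mem_ball dist_real_def by linarith
    then have "(E k - e)\<^sup>2 \<le> \<tau>\<^sup>2" by (simp only: abs_le_square_iff)
    then show "(c k * (E k - e))\<^sup>2 \<le> \<tau>\<^sup>2 * (c k)\<^sup>2"
      unfolding power_mult_distrib mult.commute[of "(c k)\<^sup>2"] by (rule mult_right_mono) simp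
  qed
  also have "\<dots> = \<tau>\<^sup>2 * (\<Sum>x\<in>X. (\<phi> x)\<^sup>2)" by (simp add: n\<phi> sum_distrib_left)
  finally have "(\<Sum>x\<in>X. (\<phi> x)\<^sup>2) = 0" using c(2) by (intro ucp) (auto simp: \<phi>_def)
  then show False using c(1) fK by (auto simp: n\<phi> sum_nonneg_eq_0_iff)
qed

section \<open>Geometry and spectral bounds of the box Laplacian\<close>

definition neighbours :: "nat \<Rightarrow> nat \<Rightarrow> (nat \<Rightarrow> int) \<Rightarrow> (nat \<Rightarrow> int) set" where
  "neighbours d N x = {y. (x, y) \<in> parcs (box_graph d N)}"

definition box_laplacian :: "nat \<Rightarrow> nat \<Rightarrow> (nat \<Rightarrow> int) \<Rightarrow> (nat \<Rightarrow> int) \<Rightarrow> real" where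
  "box_laplacian d N x y = of_bool (y \<in> neighbours d N x) - of_bool (x = y) * real (card (neighbours d N x))"

lemma finite_box_vertices: "finite (box_vertices d N)"
  unfolding box_vertices_def by (intro finite_PiE) auto

lemma card_box_vertices: "card (box_vertices d N) = N ^ d"
  by (simp add: box_vertices_def card_PiE)

lemma neighbours_iff:
  "y \<in> neighbours d N x \<longleftrightarrow> x \<in> box_vertices d N \<and> y \<in> box_vertices d N \<and> (\<Sum>i<d. (x i - y i)\<^sup>2) = 1"
proof -
  have "L2_set (\<lambda>i. real_of_int (x i - y i)) {..<d} = 1 \<longleftrightarrow> (\<Sum>i<d. (real_of_int (x i - y i))\<^sup>2) = 1"
    by (simp add: L2_set_def)
  also have "(\<Sum>i<d. (real_of_int (x i - y i))\<^sup>2) = real_of_int (\<Sum>i<d. (x i - y i)\<^sup>2)"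
    by simp
  also have "\<dots> = 1 \<longleftrightarrow> (\<Sum>i<d. (x i - y i)\<^sup>2) = 1" by (simp only: of_int_eq_1_iff)
  finally show ?thesis by (simp add: neighbours_def box_graph_def)
qed

lemma neighbours_sym: "y \<in> neighbours d N x \<longleftrightarrow> x \<in> neighbours d N y"
  by (auto simp: neighbours_iff power2_commute)

lemma neighbours_subset: "neighbours d N x \<subseteq> box_vertices d N"
  by (auto simp: neighbours_iff)

lemma finite_neighbours: "finite (neighbours d N x)"
  by (rule finite_subset[OF neighbours_subset finite_box_vertices])

lemma neighbours_close:
  assumes y: "y \<in> neighbours d N x" and i: "i < d"
  shows "\<bar>x i - y i\<bar> \<le> 1"
proof -
  have "(x i - y i)\<^sup>2 \<le> (\<Sum>i<d. (x i - y i)\<^sup>2)" using i by (intro member_le_sum) auto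
  then have "(x i - y i)\<^sup>2 \<le> 1" using y by (simp add: neighbours_iff)
  then show ?thesis using abs_square_le_1 by blast
qed

text \<open>The step in direction i uses up the whole squared distance 1. So a point has at most one
  neighbour in the next layer, whose value the eigenvalue equation then determines.\<close>

lemma neighbours_unique_in_direction:
  assumes y: "y \<in> neighbours d N x" and i: "i < d" "y i = x i + 1"
  shows "y = x(i := x i + 1)"
proof
  fix j
  have s: "(\<Sum>j<d. (x j - y j)\<^sup>2) = (x i - y i)\<^sup>2 + (\<Sum>j\<in>{..<d} - {i}. (x j - y j)\<^sup>2)"
    using i by (intro sum.remove) auto
  moreover have "(\<Sum>j<d. (x j - y j)\<^sup>2) = 1" using y by (simp add: neighbours_iff)
  ultimately have "(\<Sum>j\<in>{..<d} - {i}. (x j - y j)\<^sup>2) = 0" using i(2) by simp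
  then have "\<forall>j\<in>{..<d} - {i}. (x j - y j)\<^sup>2 = 0" by (subst (asm) sum_nonneg_eq_0_iff) auto
  moreover have "y j = x j" if "\<not> j < d"
    using y that by (simp add: neighbours_iff box_vertices_def PiE_def extensional_def)
  ultimately show "y j = (x(i := x i + 1)) j" using i by (cases "j < d") auto
qed

text \<open>A crude count through the surrounding cube of side 3; what matters is that it is
  independent of N.\<close>

lemma card_neighbours_le: "card (neighbours d N x) \<le> 3 ^ d"
proof -
  have "neighbours d N x \<subseteq> (\<Pi>\<^sub>E i\<in>{..<d}. {x i - 1..x i + 1})"
  proof
    fix y assume y: "y \<in> neighbours d N x"
    then have "y \<in> {..<d} \<rightarrow>\<^sub>E {1..int N}" using neighbours_subset[of d N x] unfolding box_vertices_def by blast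
    then have "y i = undefined" if "i \<notin> {..<d}" for i using that by (rule PiE_arb)
    moreover have "y i \<in> {x i - 1..x i + 1}" if "i \<in> {..<d}" for i
      using neighbours_close[OF y, of i] that by (auto simp: abs_le_iff)
    ultimately show "y \<in> (\<Pi>\<^sub>E i\<in>{..<d}. {x i - 1..x i + 1})" by (intro PiE_I)
  qed
  moreover have "finite (\<Pi>\<^sub>E i\<in>{..<d}. {x i - 1..x i + 1})" by (intro finite_PiE) auto
  ultimately have "card (neighbours d N x) \<le> card (\<Pi>\<^sub>E i\<in>{..<d}. {x i - 1..x i + 1})"
    by (rule card_mono[rotated])
  then show ?thesis by (simp add: card_PiE)
qed

text \<open>Stated for vector values so that it covers both the real eigenvectors and the complex
  Schroedinger operator.\<close>

lemma box_laplacian_apply_scaleR: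
  fixes \<phi> :: "(nat \<Rightarrow> int) \<Rightarrow> 'b::real_vector"
  assumes x: "x \<in> box_vertices d N"
  shows "(\<Sum>y\<in>box_vertices d N. add_diag (box_laplacian d N) W x y *\<^sub>R \<phi> y)
    = (\<Sum>y\<in>neighbours d N x. \<phi> y) + (W x - real (card (neighbours d N x))) *\<^sub>R \<phi> x"
proof -
  let ?X = "box_vertices d N"
  have "(\<Sum>y\<in>?X. add_diag (box_laplacian d N) W x y *\<^sub>R \<phi> y)
      = (\<Sum>y\<in>?X. if y \<in> neighbours d N x then \<phi> y else 0)
        + (\<Sum>y\<in>?X. if x = y then (W x - real (card (neighbours d N x))) *\<^sub>R \<phi> y else 0)"
    unfolding sum.distrib[symmetric]
    by (rule sum.cong) (auto simp: add_diag_def box_laplacian_def algebra_simps)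
  also have "(\<Sum>y\<in>?X. if x = y then (W x - real (card (neighbours d N x))) *\<^sub>R \<phi> y else 0)
      = (W x - real (card (neighbours d N x))) *\<^sub>R \<phi> x"
    using finite_box_vertices x by simp
  also have "(\<Sum>y\<in>?X. if y \<in> neighbours d N x then \<phi> y else 0) = (\<Sum>y\<in>neighbours d N x. \<phi> y)"
    using neighbours_subset finite_box_vertices by (intro sum.mono_neutral_cong_right) auto
  finally show ?thesis .
qed

lemma box_laplacian_apply:
  assumes x: "x \<in> box_vertices d N"
  shows "(\<Sum>y\<in>box_vertices d N. add_diag (box_laplacian d N) W x y * \<phi> y)
    = (\<Sum>y\<in>neighbours d N x. \<phi> y) + (W x - real (card (neighbours d N x))) * \<phi> x"
  using box_laplacian_apply_scaleR[OF x, of W \<phi>] by simp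

text \<open>As in Gershgorin's theorem, the eigenvalue equation is read at a point where the
  eigenvector is largest in absolute value.\<close>

lemma box_eigenvalue_bound:
  assumes W: "\<forall>x\<in>box_vertices d N. \<bar>W x\<bar> \<le> \<Lambda>"
    and eb: "eigenbasis (box_vertices d N) (add_diag (box_laplacian d N) W) \<psi> E" and k: "k \<in> box_vertices d N"
  shows "\<bar>E k\<bar> \<le> 2 * 3 ^ d + \<Lambda>"
proof -
  let ?X = "box_vertices d N"
  have ne: "(\<lambda>x. \<bar>\<psi> k x\<bar>) ` ?X \<noteq> {}" "finite ((\<lambda>x. \<bar>\<psi> k x\<bar>) ` ?X)" using k finite_box_vertices by auto
  from Max_in[OF ne(2,1)] obtain x where x: "x \<in> ?X" "\<bar>\<psi> k x\<bar> = Max ((\<lambda>x. \<bar>\<psi> k x\<bar>) ` ?X)" by auto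
  have mx: "\<bar>\<psi> k y\<bar> \<le> \<bar>\<psi> k x\<bar>" if "y \<in> ?X" for y unfolding x(2) using that ne by (intro Max_ge) auto
  have "\<psi> k x \<noteq> 0"
  proof
    assume "\<psi> k x = 0"
    then have "\<psi> k y = 0" if "y \<in> ?X" for y using mx[OF that] by simp
    then have "(\<Sum>y\<in>?X. \<psi> k y * \<psi> k y) = 0" by simp
    then show False using eb k by (simp add: eigenbasis_def)
  qed
  then have pos: "\<bar>\<psi> k x\<bar> > 0" by simp
  have deg: "real (card (neighbours d N x)) \<le> 3 ^ d"
    using of_nat_mono[OF card_neighbours_le, of d N x, where 'a = real] by simp
  have "E k * \<psi> k x = (\<Sum>y\<in>neighbours d N x. \<psi> k y) + (W x - real (card (neighbours d N x))) * \<psi> k x"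
    unfolding box_laplacian_apply[OF x(1), symmetric] using eb k x(1) by (simp add: eigenbasis_def)
  then have "\<bar>E k\<bar> * \<bar>\<psi> k x\<bar> \<le> \<bar>\<Sum>y\<in>neighbours d N x. \<psi> k y\<bar> + \<bar>W x - real (card (neighbours d N x))\<bar> * \<bar>\<psi> k x\<bar>"
    using abs_triangle_ineq[of "\<Sum>y\<in>neighbours d N x. \<psi> k y" "(W x - real (card (neighbours d N x))) * \<psi> k x"]
    by (simp only: abs_mult[symmetric])
  also have "\<bar>\<Sum>y\<in>neighbours d N x. \<psi> k y\<bar> \<le> (\<Sum>y\<in>neighbours d N x. \<bar>\<psi> k y\<bar>)" by (rule sum_abs)
  also have "\<dots> \<le> (\<Sum>y\<in>neighbours d N x. \<bar>\<psi> k x\<bar>)" using mx neighbours_subset by (intro sum_mono) blast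
  also have "\<dots> = card (neighbours d N x) * \<bar>\<psi> k x\<bar>" by simp
  also have "\<dots> \<le> 3 ^ d * \<bar>\<psi> k x\<bar>" using deg by (intro mult_right_mono) auto
  also have "\<bar>W x - real (card (neighbours d N x))\<bar> * \<bar>\<psi> k x\<bar> \<le> (\<Lambda> + 3 ^ d) * \<bar>\<psi> k x\<bar>"
  proof (rule mult_right_mono)
    show "\<bar>W x - real (card (neighbours d N x))\<bar> \<le> \<Lambda> + 3 ^ d" using deg bspec[OF W x(1)] by linarith
  qed simp
  finally have "\<bar>E k\<bar> * \<bar>\<psi> k x\<bar> \<le> (2 * 3 ^ d + \<Lambda>) * \<bar>\<psi> k x\<bar>" by (simp add: algebra_simps)
  then show ?thesis using pos by simp
qed

section \<open>Layers along the first coordinate and unique continuation\<close>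

definition layer :: "nat \<Rightarrow> (nat \<Rightarrow> int) \<Rightarrow> int" where
  "layer L x = (x 0 - 1) mod int L"

text \<open>The blocks of length L are numbered 0 to \<open>N div L\<close>, the last one possibly
  incomplete, and each contributes at most two points.\<close>

lemma card_initial_residues_le:
  assumes L: "L > 0"
  shows "card {j \<in> {1..int N}. (j - 1) mod int L < 2} \<le> 2 * (N div L + 1)"
proof -
  have "{j \<in> {1..int N}. (j - 1) mod int L < 2}
      \<subseteq> (\<lambda>(q, s). 1 + int q * int L + int s) ` ({..N div L} \<times> {..<2})"
  proof
    fix j assume j: "j \<in> {j \<in> {1..int N}. (j - 1) mod int L < 2}"
    define q where "q = (j - 1) div int L"
    define s where "s = (j - 1) mod int L"
    have e: "j = 1 + q * int L + s" by (simp add: q_def s_def)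
    have q0: "q \<ge> 0" using j L by (simp add: q_def pos_imp_zdiv_nonneg_iff)
    have s0: "s \<ge> 0" "s < 2" using j L by (auto simp: s_def)
    have "q \<le> int N div int L" unfolding q_def using j L by (intro zdiv_mono1) auto
    then have "nat q \<le> N div L" using q0 by (simp add: nat_le_iff zdiv_int)
    then have "(nat q, nat s) \<in> {..N div L} \<times> {..<2}" using s0 by auto
    moreover have "j = (\<lambda>(q, s). 1 + int q * int L + int s) (nat q, nat s)" using e q0 s0 by simp
    ultimately show "j \<in> (\<lambda>(q, s). 1 + int q * int L + int s) ` ({..N div L} \<times> {..<2})" by (rule image_eqI[rotated])
  qed
  then have "card {j \<in> {1..int N}. (j - 1) mod int L < 2} \<le> card ({..N div L} \<times> {..<2::nat})"
    by (intro surj_card_le) auto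
  then show ?thesis by simp
qed

lemma card_initial_layers_le:
  assumes d: "d > 0" and L: "L > 0"
  shows "card {x \<in> box_vertices d N. layer L x < 2} \<le> 2 * (N div L + 1) * N ^ (d - 1)"
proof -
  let ?J = "{j \<in> {1..int N}. (j - 1) mod int L < 2}"
  have "{x \<in> box_vertices d N. layer L x < 2} = (\<Pi>\<^sub>E i\<in>{..<d}. if i = 0 then ?J else {1..int N})"
    using d by (auto simp: box_vertices_def layer_def PiE_def Pi_def split: if_splits)
  also have "card \<dots> = (\<Prod>i\<in>{..<d}. card (if i = 0 then ?J else {1..int N}))" by (simp add: card_PiE)
  also have "\<dots> = card ?J * (\<Prod>i\<in>{..<d} - {0}. card (if i = 0 then ?J else {1..int N}))"
    using d by (subst prod.remove[of _ 0]) auto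
  also have "(\<Prod>i\<in>{..<d} - {0}. card (if i = 0 then ?J else {1..int N})) = (\<Prod>i\<in>{..<d} - {0}. N)"
    by (rule prod.cong) auto
  also have "\<dots> = N ^ (d - 1)" using d by (simp add: card_Diff_subset)
  finally show ?thesis
    using mult_right_mono[OF card_initial_residues_le[OF L, of N], of "N ^ (d - 1)"] by simp
qed

text \<open>On the layers congruent to \<open>1, \<dots>, L - 2\<close> the eigenvalue equation determines the next layer
  from the two previous ones, so a quasimode that vanishes on two consecutive layers out of \<open>L\<close>
  is bounded by its residual.\<close>

lemma box_unique_continuation:
  fixes \<phi> :: "(nat \<Rightarrow> int) \<Rightarrow> real"
  defines "X \<equiv> \<lambda>d N. box_vertices d N"
  assumes d: "d > 0" and L: "L > 0"
    and W: "\<And>x. x \<in> X d N \<Longrightarrow> \<bar>W x\<bar> \<le> \<Lambda>"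
    and van: "\<And>x. x \<in> X d N \<Longrightarrow> layer L x < 2 \<Longrightarrow> \<phi> x = 0"
  shows "(\<Sum>x\<in>X d N. (\<phi> x)\<^sup>2) \<le> (4 + 3 * (3 ^ d)\<^sup>2 + 3 * (3 ^ d + \<Lambda> + \<bar>e\<bar>)\<^sup>2) ^ L *
    (\<Sum>x\<in>X d N. ((\<Sum>y\<in>X d N. add_diag (box_laplacian d N) W x y * \<phi> y) - e * \<phi> x)\<^sup>2)"
proof -
  define B where "B = box_vertices d N"
  define D :: real where "D = 3 ^ d"
  define M where "M = D + \<Lambda> + \<bar>e\<bar>"
  define res where "res x = (\<Sum>y\<in>B. add_diag (box_laplacian d N) W x y * \<phi> y) - e * \<phi> x" for x
  define R where "R = (\<Sum>x\<in>B. (res x)\<^sup>2)"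
  \<comment> \<open>The factors 3 come from squaring a sum of three terms. \<open>D\<^sup>2\<close>
    combines Cauchy-Schwarz over at most D neighbours with each point being counted at most D times,
    M bounds the coefficient at the centre, and 4 = 3 + 1 absorbs the R that is added to turn the
    recursion into multiplication by Q.\<close>
  define Q where "Q = 4 + 3 * D\<^sup>2 + 3 * M\<^sup>2"
  define low where "low l = {x \<in> B. layer L x \<le> l}" for l
  define a where "a l = (\<Sum>x\<in>low l. (\<phi> x)\<^sup>2)" for l
  have fB: "finite B" unfolding B_def by (rule finite_box_vertices)
  have flow: "finite (low l)" for l unfolding low_def using fB by simp
  have R0: "R \<ge> 0" unfolding R_def by (intro sum_nonneg) auto
  have a0: "a l \<ge> 0" for l unfolding a_def by (intro sum_nonneg) auto
  have deg: "real (card (neighbours d N x)) \<le> D" for x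
    unfolding D_def using of_nat_mono[OF card_neighbours_le, of d N x, where 'a = real] by simp
  have D0: "D \<ge> 0" by (simp add: D_def)
  have Q1: "Q \<ge> 1" unfolding Q_def by (simp add: add_nonneg_nonneg add_increasing2)
  have step: "a (l + 1) + R \<le> Q * (a l + R)" if l: "l \<ge> 1" for l
  proof -
    define T where "T = {x \<in> B. layer L x = l + 1}"
    \<comment> \<open>The equation is read one layer below x, where x is the only neighbour in the
      next layer.\<close>
    define pred where "pred x = x(0 := x 0 - 1)" for x :: "nat \<Rightarrow> int"
    have pred_inverse: "(pred x)(0 := pred x 0 + 1) = x" for x by (auto simp: pred_def fun_eq_iff)
    have pred: "pred x \<in> B" "layer L (pred x) = l" "x \<in> neighbours d N (pred x)" if x: "x \<in> T" for x
    proof -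
      have xB: "x \<in> {..<d} \<rightarrow>\<^sub>E {1..int N}" and lay: "(x 0 - 1) mod int L = l + 1"
        using x by (auto simp: T_def B_def box_vertices_def layer_def)
      have x0: "x 0 \<in> {1..int N}" using PiE_mem[OF xB] d by simp
      \<comment> \<open>The face x 0 = 1 has residue 0, whereas x has residue at least 2; hence the
        point below lies in the box.\<close>
      have "x 0 - 1 \<noteq> 0" using lay l by auto
      then have x01: "x 0 - 1 \<in> {1..int N}" using x0 by auto
      show pB: "pred x \<in> B"
        unfolding B_def box_vertices_def
      proof (rule PiE_I)
        fix i assume "i \<in> {..<d}"
        with PiE_mem[OF xB this] x01 show "pred x i \<in> {1..int N}"
          by (cases "i = 0") (simp_all add: pred_def)
      next
        fix i assume i: "i \<notin> {..<d}"
        then have "i \<noteq> 0" using d by auto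
        then show "pred x i = undefined" using PiE_arb[OF xB i] by (simp add: pred_def)
      qed
      have "(x 0 - 1 - 1) mod int L = ((x 0 - 1) mod int L - 1) mod int L" by (simp add: mod_diff_left_eq)
      also have "\<dots> = l mod int L" using lay by simp
      also have "\<dots> = l" using lay l L pos_mod_bound[of "int L" "x 0 - 1"] by (intro mod_pos_pos_trivial) auto
      finally show "layer L (pred x) = l" by (simp add: layer_def pred_def)
      have "(\<Sum>i<d. (pred x i - x i)\<^sup>2) = (\<Sum>i<d. of_bool (i = 0))"
        by (intro sum.cong refl) (auto simp: pred_def)
      also have "\<dots> = 1" using d by (simp add: of_bool_def)
      finally show "x \<in> neighbours d N (pred x)"
        using pB x by (simp add: neighbours_iff B_def T_def)
    qed
    have bound: "(\<phi> x)\<^sup>2 \<le> 3 * (res (pred x))\<^sup>2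
        + 3 * D * (\<Sum>y\<in>neighbours d N (pred x) \<inter> low l. (\<phi> y)\<^sup>2) + 3 * M\<^sup>2 * (\<phi> (pred x))\<^sup>2" if x: "x \<in> T" for x
    proof -
      let ?p = "pred x"
      define S where "S = neighbours d N ?p - {x}"
      define v where "v = real (card (neighbours d N ?p)) - W ?p + e"
      note p = pred[OF x]
      \<comment> \<open>The remaining neighbours lie in the layers l and l - 1; since l is at least
        1, subtracting 1 does not wrap around modulo L.\<close>
      have S: "S \<subseteq> neighbours d N ?p \<inter> low l"
      proof
        fix y assume y: "y \<in> S"
        then have yn: "y \<in> neighbours d N ?p" "y \<noteq> x" by (auto simp: S_def)
        have "\<bar>?p 0 - y 0\<bar> \<le> 1" by (rule neighbours_close[OF yn(1) d])
        moreover have "y 0 \<noteq> ?p 0 + 1"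
        proof
          assume "y 0 = ?p 0 + 1"
          from neighbours_unique_in_direction[OF yn(1) d this] have "y = x" by (simp only: pred_inverse)
          with yn show False by simp
        qed
        ultimately have "y 0 = ?p 0 \<or> y 0 = ?p 0 - 1" by linarith
        moreover have "layer L y = l - 1" if "y 0 = ?p 0 - 1"
        proof -
          have "layer L y = ((?p 0 - 1) mod int L - 1) mod int L"
            using that by (simp add: layer_def mod_diff_left_eq)
          also have "\<dots> = (l - 1) mod int L" using p(2) by (simp add: layer_def)
          also have "\<dots> = l - 1"
            using p(2) l L pos_mod_bound[of "int L" "?p 0 - 1"] by (intro mod_pos_pos_trivial) (auto simp: layer_def)
          finally show ?thesis .
        qed
        moreover have "layer L y = l" if "y 0 = ?p 0" using that p(2) by (simp add: layer_def)
        ultimately have "layer L y \<le> l" by auto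
        then show "y \<in> neighbours d N ?p \<inter> low l"
          using yn neighbours_subset[of d N ?p] by (auto simp: low_def B_def)
      qed
      have "res ?p = (\<Sum>y\<in>neighbours d N ?p. \<phi> y) - v * \<phi> ?p"
        unfolding res_def B_def box_laplacian_apply[OF p(1)[unfolded B_def]] v_def by (simp add: algebra_simps)
      also have "(\<Sum>y\<in>neighbours d N ?p. \<phi> y) = \<phi> x + (\<Sum>y\<in>S. \<phi> y)"
        unfolding S_def using p(3) finite_neighbours by (rule sum.remove[rotated])
      finally have eq: "\<phi> x = res ?p - (\<Sum>y\<in>S. \<phi> y) + v * \<phi> ?p" by simp
      have three: "(r - s + t)\<^sup>2 \<le> 3 * r\<^sup>2 + 3 * s\<^sup>2 + 3 * t\<^sup>2" for r s t :: real
      proof -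
        have "0 \<le> (r + s)\<^sup>2 + (r - t)\<^sup>2 + (s + t)\<^sup>2" by simp
        then show ?thesis by (simp add: power2_eq_square algebra_simps)
      qed
      have fS: "finite S" unfolding S_def using finite_neighbours by simp
      have "(\<Sum>y\<in>S. \<phi> y)\<^sup>2 \<le> (\<Sum>y\<in>S. (\<phi> y)\<^sup>2) * card S" by (rule sum_squared_le_sum_of_squares)
      also have "\<dots> \<le> (\<Sum>y\<in>neighbours d N ?p \<inter> low l. (\<phi> y)\<^sup>2) * D"
      proof (rule mult_mono)
        show "(\<Sum>y\<in>S. (\<phi> y)\<^sup>2) \<le> (\<Sum>y\<in>neighbours d N ?p \<inter> low l. (\<phi> y)\<^sup>2)"
          using S flow by (intro sum_mono2) auto
        have "card S \<le> card (neighbours d N ?p)"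
          unfolding S_def using finite_neighbours by (intro card_mono) auto
        then show "real (card S) \<le> D" using deg[of ?p] by linarith
      qed (auto intro: sum_nonneg)
      finally have s: "(\<Sum>y\<in>S. \<phi> y)\<^sup>2 \<le> D * (\<Sum>y\<in>neighbours d N ?p \<inter> low l. (\<phi> y)\<^sup>2)" by (simp add: mult.commute)
      have "\<bar>v\<bar> \<le> M"
        using W[of ?p] p(1) deg[of ?p] unfolding v_def M_def X_def B_def by linarith
      then have "v\<^sup>2 \<le> M\<^sup>2" by (metis abs_ge_zero power2_abs power_mono)
      then have "(v * \<phi> ?p)\<^sup>2 \<le> M\<^sup>2 * (\<phi> ?p)\<^sup>2" unfolding power_mult_distrib by (rule mult_right_mono) simp
      then show ?thesis
        using three[of "res ?p" "\<Sum>y\<in>S. \<phi> y" "v * \<phi> ?p"] s unfolding eq[symmetric] by linarith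
    qed
    have inj: "inj_on pred T"
    proof (rule inj_onI)
      fix x y assume "pred x = pred y"
      then have "(pred x)(0 := pred x 0 + 1) = (pred y)(0 := pred y 0 + 1)" by simp
      then show "x = y" by (simp only: pred_inverse)
    qed
    have fT: "finite T" unfolding T_def using fB by simp
    have over: "(\<Sum>x\<in>T. f (pred x)) \<le> (\<Sum>x\<in>low l. f x)" if "\<And>x. f x \<ge> 0" for f :: "(nat \<Rightarrow> int) \<Rightarrow> real"
    proof -
      have "(\<Sum>x\<in>T. f (pred x)) = (\<Sum>x\<in>pred ` T. f x)" by (simp add: sum.reindex[OF inj])
      also have "\<dots> \<le> (\<Sum>x\<in>low l. f x)"
        using pred that flow by (intro sum_mono2) (auto simp: low_def)
      finally show ?thesis .
    qed
    have "low (l + 1) = low l \<union> T" "low l \<inter> T = {}" by (auto simp: low_def T_def)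
    then have "a (l + 1) = a l + (\<Sum>x\<in>T. (\<phi> x)\<^sup>2)"
      unfolding a_def using flow fT by (simp add: sum.union_disjoint)
    also have "(\<Sum>x\<in>T. (\<phi> x)\<^sup>2) \<le> (\<Sum>x\<in>T. 3 * (res (pred x))\<^sup>2
        + 3 * D * (\<Sum>y\<in>neighbours d N (pred x) \<inter> low l. (\<phi> y)\<^sup>2) + 3 * M\<^sup>2 * (\<phi> (pred x))\<^sup>2)"
      by (intro sum_mono bound)
    also have "\<dots> = 3 * (\<Sum>x\<in>T. (res (pred x))\<^sup>2)
        + 3 * D * (\<Sum>x\<in>T. \<Sum>y\<in>neighbours d N (pred x) \<inter> low l. (\<phi> y)\<^sup>2) + 3 * M\<^sup>2 * (\<Sum>x\<in>T. (\<phi> (pred x))\<^sup>2)"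
      by (simp add: sum.distrib sum_distrib_left)
    also have "\<dots> \<le> 3 * R + 3 * D * (D * a l) + 3 * M\<^sup>2 * a l"
    proof (intro add_mono mult_left_mono)
      have "(\<Sum>x\<in>T. (res (pred x))\<^sup>2) \<le> (\<Sum>x\<in>low l. (res x)\<^sup>2)" by (rule over) simp
      also have "\<dots> \<le> R" unfolding R_def using fB by (intro sum_mono2) (auto simp: low_def)
      finally show "(\<Sum>x\<in>T. (res (pred x))\<^sup>2) \<le> R" .
      show "(\<Sum>x\<in>T. (\<phi> (pred x))\<^sup>2) \<le> a l" unfolding a_def by (rule over) simp
      \<comment> \<open>Exchanging the sums, the symmetry of adjacency shows that each y is counted
        at most D times.\<close>
      have "(\<Sum>x\<in>T. \<Sum>y\<in>neighbours d N (pred x) \<inter> low l. (\<phi> y)\<^sup>2)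
          \<le> (\<Sum>x\<in>low l. \<Sum>y\<in>neighbours d N x \<inter> low l. (\<phi> y)\<^sup>2)"
        by (rule over) (auto intro: sum_nonneg)
      also have "\<dots> = (\<Sum>x\<in>low l. \<Sum>y\<in>low l. of_bool (y \<in> neighbours d N x) * (\<phi> y)\<^sup>2)"
        using flow by (intro sum.cong refl sum.mono_neutral_cong_left) auto
      also have "\<dots> = (\<Sum>y\<in>low l. \<Sum>x\<in>low l. of_bool (y \<in> neighbours d N x) * (\<phi> y)\<^sup>2)" by (rule sum.swap)
      also have "\<dots> \<le> (\<Sum>y\<in>low l. D * (\<phi> y)\<^sup>2)"
      proof (rule sum_mono)
        fix y
        have "(\<Sum>x\<in>low l. of_bool (y \<in> neighbours d N x)) = real (card {x \<in> low l. y \<in> neighbours d N x})"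
          using flow by (simp add: Int_def)
        also have "card {x \<in> low l. y \<in> neighbours d N x} \<le> card (neighbours d N y)"
          using finite_neighbours neighbours_sym by (intro card_mono) blast+
        also have "real (card (neighbours d N y)) \<le> D" by (rule deg)
        finally have "(\<Sum>x\<in>low l. of_bool (y \<in> neighbours d N x)) * (\<phi> y)\<^sup>2 \<le> D * (\<phi> y)\<^sup>2"
          by (intro mult_right_mono) auto
        then show "(\<Sum>x\<in>low l. of_bool (y \<in> neighbours d N x) * (\<phi> y)\<^sup>2) \<le> D * (\<phi> y)\<^sup>2"
          by (simp only: sum_distrib_right)
      qed
      also have "\<dots> = D * a l" by (simp add: a_def sum_distrib_left)
      finally show "(\<Sum>x\<in>T. \<Sum>y\<in>neighbours d N (pred x) \<inter> low l. (\<phi> y)\<^sup>2) \<le> D * a l" .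
    qed (use D0 in auto)
    finally have "a (l + 1) + R \<le> 4 * R + (1 + 3 * D\<^sup>2 + 3 * M\<^sup>2) * a l"
      by (simp add: power2_eq_square algebra_simps)
    also have "\<dots> \<le> Q * (a l + R)"
    proof -
      have "0 \<le> 3 * a l + (3 * D\<^sup>2 + 3 * M\<^sup>2) * R" using a0[of l] R0 by simp
      then show ?thesis by (simp add: Q_def algebra_simps)
    qed
    finally show ?thesis .
  qed
  have iter: "a (int j + 1) + R \<le> Q ^ j * R" for j
  proof (induction j)
    case 0
    have "\<phi> x = 0" if "x \<in> low 1" for x
      using that van[of x] by (auto simp: low_def X_def B_def)
    \<comment> \<open>Layers 0 and 1 are those on which \<phi> vanishes by assumption, which starts
      the recursion.\<close>
    then have "a 1 = 0" unfolding a_def by (intro sum.neutral) auto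
    then show ?case by simp
  next
    case (Suc j)
    have "a (int (Suc j) + 1) + R \<le> Q * (a (int j + 1) + R)"
      using step[of "int j + 1"] by (simp add: add_ac)
    also have "\<dots> \<le> Q * (Q ^ j * R)" using Suc Q1 by (intro mult_left_mono) auto
    finally show ?case by (simp add: mult_ac)
  qed
  have "layer L x \<le> int L + 1" for x
  proof -
    have "(x 0 - 1) mod int L < int L" using L by simp
    then show ?thesis unfolding layer_def by linarith
  qed
  \<comment> \<open>Residues stay below L, so L rounds have reached every layer.\<close>
  then have "low (int L + 1) = B" by (auto simp: low_def)
  then have "(\<Sum>x\<in>B. (\<phi> x)\<^sup>2) \<le> Q ^ L * R"
    using iter[of L] R0 by (simp add: a_def)
  then show ?thesis by (simp add: B_def Q_def R_def res_def X_def M_def D_def)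
qed

section \<open>Short energy windows carry few eigenvalues in boxes\<close>

definition box_family :: "nat \<Rightarrow> ((nat \<Rightarrow> int) set \<times> ((nat \<Rightarrow> int) \<Rightarrow> (nat \<Rightarrow> int) \<Rightarrow> real)) set" where
  "box_family d = range (\<lambda>N. (box_vertices d N, box_laplacian d N))"

lemma symmetric_box_family: "symmetric_family (box_family d)"
proof -
  have "box_laplacian d N x y = box_laplacian d N y x" for N x y
    using neighbours_sym[of y d N x] by (auto simp: box_laplacian_def)
  then show ?thesis by (auto simp: symmetric_family_def box_family_def finite_box_vertices)
qed

text \<open>The slab thickness m is fixed by \<kappa>, and the radius by the loss Q^m of continuing
  through one slab. Neither depends on N, and a quasimode that vanishes on two layers of each slab
  must be zero.\<close>

lemma rare_points_box:
  assumes d: "d > 0"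
  shows "rare_points (box_family d) \<Lambda>"
  unfolding rare_points_def
proof (intro allI impI)
  fix \<kappa> e :: real assume \<kappa>: "\<kappa> > 0"
  \<comment> \<open>Once m is at most N, the two layers per slab fill at most the fraction
    \<open>2 (N / m + 1) / N \<le> 4 / m\<close> of the box, and this is at most \<kappa>.\<close>
  define m where "m = nat \<lceil>4 / \<kappa>\<rceil> + 1"
  have "4 / \<kappa> \<le> real m" unfolding m_def by linarith
  then have m: "m > 0" "4 \<le> \<kappa> * real m" using \<kappa> by (auto simp: m_def field_simps)
  define Q where "Q = 4 + 3 * (3 ^ d)\<^sup>2 + 3 * (3 ^ d + \<Lambda> + \<bar>e\<bar>)\<^sup>2"
  have Q: "Q > 0" unfolding Q_def by (simp add: add_pos_nonneg)
  \<comment> \<open>Then \<open>Q ^ m * \<tau>\<^sup>2\<close> is 1/2, so the squared norm of such a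
    quasimode is at most half of itself.\<close>
  define \<tau> where "\<tau> = sqrt (1 / (2 * Q ^ m))"
  have \<tau>: "\<tau> > 0" "\<tau>\<^sup>2 = 1 / (2 * Q ^ m)" using Q by (auto simp: \<tau>_def)
  have count: "real (card {k \<in> box_vertices d N. E k \<in> ball e \<tau>}) \<le> \<kappa> * card (box_vertices d N)"
    if N: "m ^ d < card (box_vertices d N)" and W: "\<forall>x\<in>box_vertices d N. \<bar>W x\<bar> \<le> \<Lambda>"
      and eb: "eigenbasis (box_vertices d N) (add_diag (box_laplacian d N) W) \<psi> E" for N W \<psi> E
  proof -
    let ?X = "box_vertices d N" and ?S = "{x \<in> box_vertices d N. layer m x < 2}"
    have Nm: "m \<le> N"
    proof (rule ccontr)
      assume "\<not> m \<le> N"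
      then have "N ^ d \<le> m ^ d" by (intro power_mono) auto
      with N show False by (simp add: card_box_vertices)
    qed
    have "card {k \<in> ?X. E k \<in> ball e \<tau>} \<le> card ?S"
    proof (rule eigenvalue_count_le[OF finite_box_vertices eb])
      fix \<phi> :: "(nat \<Rightarrow> int) \<Rightarrow> real"
      assume van: "\<And>x. x \<in> ?S \<Longrightarrow> \<phi> x = 0"
        and qm: "(\<Sum>x\<in>?X. ((\<Sum>y\<in>?X. add_diag (box_laplacian d N) W x y * \<phi> y) - e * \<phi> x)\<^sup>2)
          \<le> \<tau>\<^sup>2 * (\<Sum>x\<in>?X. (\<phi> x)\<^sup>2)"
      let ?n = "\<Sum>x\<in>?X. (\<phi> x)\<^sup>2"
      have "?n \<le> Q ^ m * (\<Sum>x\<in>?X. ((\<Sum>y\<in>?X. add_diag (box_laplacian d N) W x y * \<phi> y) - e * \<phi> x)\<^sup>2)"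
        unfolding Q_def using W van by (intro box_unique_continuation[OF d m(1)]) auto
      also have "\<dots> \<le> Q ^ m * (\<tau>\<^sup>2 * ?n)" using qm Q by (intro mult_left_mono) auto
      also have "\<dots> = ?n / 2" using Q by (simp add: \<tau>)
      finally have "?n \<le> 0" by simp
      moreover have "?n \<ge> 0" by (intro sum_nonneg) auto
      ultimately show "?n = 0" by simp
    qed auto
    also have "card ?S \<le> 2 * (N div m + 1) * N ^ (d - 1)" by (rule card_initial_layers_le[OF d m(1)])
    finally have "real (card {k \<in> ?X. E k \<in> ball e \<tau>}) \<le> real (2 * (N div m + 1) * N ^ (d - 1))"
      by (rule of_nat_mono)
    also have "\<dots> = 2 * (real (N div m) + 1) * real N ^ (d - 1)" by (simp add: algebra_simps)
    also have "\<dots> \<le> (\<kappa> * real N) * real N ^ (d - 1)"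
    proof (rule mult_right_mono)
      have "real (N div m) \<le> real N / m" "1 \<le> real N / m"
        using Nm m(1) of_nat_div_le_of_nat[of N m, where 'a = real] by (auto simp: field_simps)
      moreover have "4 * (real N / real m) \<le> \<kappa> * real N"
      proof -
        have "4 * real N \<le> (\<kappa> * real m) * real N" using m by (intro mult_right_mono) auto
        then show ?thesis using m(1) by (simp add: field_simps)
      qed
      moreover have "2 * (a + 1) \<le> c" if "a \<le> b" "1 \<le> b" "4 * b \<le> c" for a b c :: real
        using that by simp
      ultimately show "2 * (real (N div m) + 1) \<le> \<kappa> * real N" by blast
    qed simp
    also have "\<dots> = \<kappa> * card ?X"
      using d by (cases d) (auto simp: card_box_vertices)
    finally show ?thesis .
  qed
  have "rare (box_family d) \<Lambda> \<kappa> (ball e \<tau>)"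
    unfolding rare_def
  proof (rule exI[of _ "m ^ d"], clarify)
    fix X A W \<psi> E
    assume XA: "(X, A) \<in> box_family d" and n: "m ^ d < card X" and W: "\<forall>x\<in>X. \<bar>W x\<bar> \<le> \<Lambda>"
      and eb: "eigenbasis X (add_diag A W) \<psi> E"
    from XA obtain N where "X = box_vertices d N" "A = box_laplacian d N" by (auto simp: box_family_def)
    with count[of N W \<psi> E] n W eb show "real (card {k \<in> X. E k \<in> ball e \<tau>}) \<le> \<kappa> * card X" by simp
  qed
  then show "\<exists>\<tau>>0. rare (box_family d) \<Lambda> \<kappa> (ball e \<tau>)" using \<tau>(1) by blast
qed

section \<open>Spectral measures and eigenbases\<close>

text \<open>Links a real eigenbasis of B to the complex operator H of the definitions: orthonormal
  real vectors also expand every complex function on X.\<close>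

locale spectral_setup =
  fixes X :: "'a set" and B :: "'a \<Rightarrow> 'a \<Rightarrow> real" and \<psi> E
    and H :: "('a \<Rightarrow> complex) \<Rightarrow> 'a \<Rightarrow> complex"
  assumes X: "finite X" and sym: "\<And>x y. x \<in> X \<Longrightarrow> y \<in> X \<Longrightarrow> B x y = B y x"
    and eb: "eigenbasis X B \<psi> E"
    and H: "\<And>\<phi> x. x \<in> X \<Longrightarrow> H \<phi> x = (\<Sum>y\<in>X. of_real (B x y) * \<phi> y)"
begin

lemma on: "k \<in> X \<Longrightarrow> l \<in> X \<Longrightarrow> (\<Sum>x\<in>X. \<psi> k x * \<psi> l x) = of_bool (k = l)"
  and comp: "x \<in> X \<Longrightarrow> y \<in> X \<Longrightarrow> (\<Sum>k\<in>X. \<psi> k x * \<psi> k y) = of_bool (x = y)"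
  and eig: "k \<in> X \<Longrightarrow> x \<in> X \<Longrightarrow> (\<Sum>y\<in>X. B x y * \<psi> k y) = E k * \<psi> k x"
  using eb by (simp_all add: eigenbasis_def)

definition coeff :: "('a \<Rightarrow> complex) \<Rightarrow> 'a \<Rightarrow> complex" where
  "coeff \<phi> k = (\<Sum>x\<in>X. of_real (\<psi> k x) * \<phi> x)"

lemma expansion:
  assumes x: "x \<in> X"
  shows "\<phi> x = (\<Sum>k\<in>X. coeff \<phi> k * of_real (\<psi> k x))"
proof -
  have "(\<Sum>k\<in>X. coeff \<phi> k * of_real (\<psi> k x)) = (\<Sum>k\<in>X. \<Sum>y\<in>X. of_real (\<psi> k y * \<psi> k x) * \<phi> y)"
    unfolding coeff_def sum_distrib_right by (simp add: mult_ac)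
  also have "\<dots> = (\<Sum>y\<in>X. of_real (\<Sum>k\<in>X. \<psi> k y * \<psi> k x) * \<phi> y)"
    by (subst sum.swap) (simp add: sum_distrib_right)
  also have "\<dots> = (\<Sum>y\<in>X. if y = x then \<phi> y else 0)"
    using x by (intro sum.cong refl) (simp add: comp)
  also have "\<dots> = \<phi> x" using X x by simp
  finally show ?thesis by simp
qed

text \<open>Moving H across the pairing with a real eigenvector multiplies the same coefficient by e
  and by E k.\<close>

lemma coeff_eq_0:
  assumes \<phi>: "\<phi> \<in> eigenspace X H e" and k: "k \<in> X" "E k \<noteq> e"
  shows "coeff \<phi> k = 0"
proof -
  have "of_real e * coeff \<phi> k = (\<Sum>x\<in>X. of_real (\<psi> k x) * H \<phi> x)"
    using \<phi> by (simp add: coeff_def eigenspace_def sum_distrib_left mult_ac)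
  also have "\<dots> = (\<Sum>x\<in>X. \<Sum>y\<in>X. of_real (B x y * \<psi> k x) * \<phi> y)"
    by (simp add: H sum_distrib_left mult_ac)
  also have "\<dots> = (\<Sum>y\<in>X. \<Sum>x\<in>X. of_real (B x y * \<psi> k x) * \<phi> y)" by (rule sum.swap)
  also have "\<dots> = (\<Sum>y\<in>X. of_real (\<Sum>x\<in>X. B y x * \<psi> k x) * \<phi> y)"
    by (intro sum.cong refl) (simp add: sum_distrib_right sym)
  also have "\<dots> = of_real (E k) * coeff \<phi> k"
    using k by (simp add: eig coeff_def sum_distrib_left mult_ac)
  finally show ?thesis using k by simp
qed

text \<open>The candidate for the projection of \<open>delta v\<close> to the eigenspace of e. The
  value 0 off X is what \<open>ell2\<close> demands.\<close>

definition proj :: "real \<Rightarrow> 'a \<Rightarrow> 'a \<Rightarrow> complex" where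
  "proj e v x = (if x \<in> X then \<Sum>k\<in>{k \<in> X. E k = e}. of_real (\<psi> k v * \<psi> k x) else 0)"

lemma H_diff: "x \<in> X \<Longrightarrow> H (\<lambda>y. \<phi> y - \<phi>' y) x = H \<phi> x - H \<phi>' x"
  by (simp add: H right_diff_distrib sum_subtractf)

lemma proj_in_eigenspace: "proj e v \<in> eigenspace X H e"
proof -
  have "H (proj e v) x = of_real e * proj e v x" if x: "x \<in> X" for x
  proof -
    have "H (proj e v) x = (\<Sum>y\<in>X. \<Sum>k\<in>{k \<in> X. E k = e}. of_real (\<psi> k v) * of_real (B x y * \<psi> k y))"
      unfolding H[OF x] by (intro sum.cong refl) (simp add: proj_def sum_distrib_left mult_ac)
    also have "\<dots> = (\<Sum>k\<in>{k \<in> X. E k = e}. of_real (\<psi> k v) * of_real (\<Sum>y\<in>X. B x y * \<psi> k y))"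
      by (subst sum.swap) (simp add: sum_distrib_left)
    also have "\<dots> = (\<Sum>k\<in>{k \<in> X. E k = e}. of_real e * of_real (\<psi> k v * \<psi> k x))"
      using x by (intro sum.cong refl) (simp add: eig mult_ac)
    finally show ?thesis using x by (simp add: proj_def sum_distrib_left)
  qed
  then show ?thesis by (simp add: eigenspace_def ell2_def proj_def)
qed

lemma proj_orthogonal:
  assumes \<eta>: "\<eta> \<in> eigenspace X H e" and v: "v \<in> X"
  shows "inner_on X \<eta> (\<lambda>x. delta v x - proj e v x) = 0"
proof -
  have "(\<Sum>x\<in>X. cnj (\<eta> x) * proj e v x)
      = (\<Sum>x\<in>X. \<Sum>k\<in>{k \<in> X. E k = e}. of_real (\<psi> k v) * (of_real (\<psi> k x) * cnj (\<eta> x)))"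
    by (intro sum.cong refl) (simp add: proj_def sum_distrib_left mult_ac)
  also have "\<dots> = (\<Sum>k\<in>{k \<in> X. E k = e}. of_real (\<psi> k v) * cnj (coeff \<eta> k))"
    by (subst sum.swap) (simp add: coeff_def sum_distrib_left)
  also have "\<dots> = (\<Sum>k\<in>X. of_real (\<psi> k v) * cnj (coeff \<eta> k))"
    using X coeff_eq_0[OF \<eta>] by (intro sum.mono_neutral_left) auto
  also have "\<dots> = cnj (\<eta> v)"
    by (subst expansion[OF v]) (simp add: mult.commute)
  finally have 1: "(\<Sum>x\<in>X. cnj (\<eta> x) * proj e v x) = cnj (\<eta> v)" .
  have "(\<Sum>x\<in>X. cnj (\<eta> x) * delta v x) = (\<Sum>x\<in>X. if x = v then cnj (\<eta> x) else 0)"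
    by (intro sum.cong refl) (simp add: delta_def)
  also have "\<dots> = cnj (\<eta> v)" using X v by simp
  finally show ?thesis using 1 by (simp add: inner_on_def right_diff_distrib sum_subtractf)
qed

lemma orth_proj_eq:
  assumes v: "v \<in> X"
  shows "orth_proj X (eigenspace X H e) (delta v) = proj e v"
  unfolding orth_proj_def
proof (rule the_equality)
  show "proj e v \<in> eigenspace X H e \<and>
      (\<forall>\<eta>\<in>eigenspace X H e. inner_on X \<eta> (\<lambda>x. delta v x - proj e v x) = 0)"
    using proj_in_eigenspace proj_orthogonal[OF _ v] by blast
  fix \<phi>
  assume \<phi>: "\<phi> \<in> eigenspace X H e \<and> (\<forall>\<eta>\<in>eigenspace X H e. inner_on X \<eta> (\<lambda>x. delta v x - \<phi> x) = 0)"
  \<comment> \<open>Uniqueness for the definite description: the difference of two candidates lies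
    in the eigenspace and is orthogonal to it, hence to itself.\<close>
  define \<omega> where "\<omega> x = proj e v x - \<phi> x" for x
  have \<omega>: "\<omega> \<in> eigenspace X H e"
    using \<phi> proj_in_eigenspace[of e v]
    by (simp add: eigenspace_def ell2_def \<omega>_def[abs_def] H_diff right_diff_distrib)
  then have "inner_on X \<omega> (\<lambda>x. delta v x - \<phi> x) - inner_on X \<omega> (\<lambda>x. delta v x - proj e v x) = 0"
    using \<phi> proj_orthogonal[OF _ v] by simp
  then have "(\<Sum>x\<in>X. cnj (\<omega> x) * \<omega> x) = 0"
    unfolding inner_on_def sum_subtractf[symmetric] right_diff_distrib[symmetric] by (simp add: \<omega>_def)
  moreover have "cnj (\<omega> x) * \<omega> x = of_real ((cmod (\<omega> x))\<^sup>2)" for x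
    by (simp only: complex_norm_square mult.commute)
  ultimately have "complex_of_real (\<Sum>x\<in>X. (cmod (\<omega> x))\<^sup>2) = 0" by simp
  then have "(\<Sum>x\<in>X. (cmod (\<omega> x))\<^sup>2) = 0" by (simp only: of_real_eq_0_iff)
  then have "\<omega> x = 0" if "x \<in> X" for x using X that by (simp add: sum_nonneg_eq_0_iff)
  moreover have "\<omega> x = 0" if "x \<notin> X" for x using \<omega> that by (simp add: eigenspace_def ell2_def)
  ultimately show "\<phi> = proj e v" unfolding \<omega>_def fun_eq_iff eq_iff_diff_eq_0[of "\<phi> _"] by (metis minus_diff_eq neg_equal_0_iff_equal)
qed

lemma eigenvalues_eq: "eigenvalues X H = E ` X"
proof
  show "eigenvalues X H \<subseteq> E ` X"
  proof
    fix e assume "e \<in> eigenvalues X H"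
    then obtain \<phi> x where \<phi>: "\<phi> \<in> eigenspace X H e" and x: "x \<in> X" "\<phi> x \<noteq> 0"
      by (auto simp: eigenvalues_def)
    have "\<exists>k\<in>X. coeff \<phi> k \<noteq> 0"
    proof (rule ccontr)
      assume "\<not> ?thesis"
      then have "\<phi> x = 0" by (subst expansion[OF x(1)]) simp
      with x show False by simp
    qed
    then show "e \<in> E ` X" using coeff_eq_0[OF \<phi>] by blast
  qed
  show "E ` X \<subseteq> eigenvalues X H"
  proof
    fix e assume "e \<in> E ` X"
    then obtain k where k: "k \<in> X" "e = E k" by blast
    \<comment> \<open>The vector \<psi> k may be nonzero off X, so the eigenfunction in
      \<open>ell2\<close> is taken to be \<open>proj e v\<close> at a point v where \<psi> k does
      not vanish.\<close>
    have "(\<Sum>x\<in>X. \<psi> k x * \<psi> k x) \<noteq> 0" using on[OF k(1) k(1)] by simp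
    then have "\<exists>v\<in>X. \<psi> k v * \<psi> k v \<noteq> 0" by (rule contrapos_np) simp
    then obtain v where v: "v \<in> X" "\<psi> k v \<noteq> 0" by auto
    have "0 < (\<psi> k v)\<^sup>2" using v by simp
    also have "\<dots> \<le> (\<Sum>l\<in>{l \<in> X. E l = e}. (\<psi> l v)\<^sup>2)"
      using k X by (intro member_le_sum) auto
    finally have "(\<Sum>l\<in>{l \<in> X. E l = e}. (\<psi> l v)\<^sup>2) \<noteq> 0" by simp
    moreover have "proj e v v = of_real (\<Sum>l\<in>{l \<in> X. E l = e}. (\<psi> l v)\<^sup>2)"
      using v by (simp add: proj_def power2_eq_square)
    ultimately have "proj e v v \<noteq> 0" by (simp only: of_real_eq_0_iff not_False_eq_True)
    then show "e \<in> eigenvalues X H"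
      unfolding eigenvalues_def using proj_in_eigenspace v(1) by blast
  qed
qed

lemma inner_functional_calculus:
  assumes v: "v \<in> X"
  shows "inner_on X (delta v) (functional_calculus X H g (delta v)) = (\<Sum>k\<in>X. of_real ((\<psi> k v)\<^sup>2) * g (E k))"
proof -
  have "inner_on X (delta v) (functional_calculus X H g (delta v))
      = (\<Sum>x\<in>X. if x = v then functional_calculus X H g (delta v) x else 0)"
    unfolding inner_on_def by (intro sum.cong refl) (simp add: delta_def)
  also have "\<dots> = (\<Sum>e\<in>E ` X. g e * proj e v v)"
    using X v by (simp add: functional_calculus_def eigenvalues_eq orth_proj_eq)
  also have "\<dots> = (\<Sum>e\<in>E ` X. \<Sum>k\<in>{k \<in> X. E k = e}. of_real ((\<psi> k v)\<^sup>2) * g (E k))"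
    using v by (intro sum.cong refl) (simp add: proj_def sum_distrib_left power2_eq_square mult_ac)
  also have "\<dots> = (\<Sum>k\<in>X. of_real ((\<psi> k v)\<^sup>2) * g (E k))"
    by (rule sum.image_gen[OF X, symmetric])
  finally show ?thesis .
qed

text \<open>Indicators are admissible test functions, so the defining property already determines
  the measure on every Borel set.\<close>

lemma spectral_measure_of_set:
  assumes v: "v \<in> X" and \<mu>: "is_spectral_measure X H v \<mu>" and A: "A \<in> sets borel"
  shows "measure \<mu> A = (\<Sum>k\<in>{k \<in> X. E k \<in> A}. (\<psi> k v)\<^sup>2)"
proof -
  define g :: "real \<Rightarrow> complex" where "g x = of_real (indicator A x)" for x
  have sets: "sets \<mu> = sets borel" using \<mu> by (simp add: is_spectral_measure_def)
  have "g \<in> borel_measurable borel" unfolding g_def using A by measurable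
  moreover have "bounded (range g)"
    by (intro boundedI[of _ 1]) (auto simp: g_def indicator_def)
  ultimately have "inner_on X (delta v) (functional_calculus X H g (delta v)) = integral\<^sup>L \<mu> g"
    using \<mu> by (simp add: is_spectral_measure_def)
  then have "(\<Sum>k\<in>X. of_real ((\<psi> k v)\<^sup>2) * g (E k)) = integral\<^sup>L \<mu> g"
    by (simp only: inner_functional_calculus[OF v])
  also have "integral\<^sup>L \<mu> g = of_real (measure \<mu> A)"
    unfolding g_def integral_complex_of_real using sets_eq_imp_space_eq[OF sets] by simp
  also have "(\<Sum>k\<in>X. of_real ((\<psi> k v)\<^sup>2) * g (E k)) = of_real (\<Sum>k\<in>X. (\<psi> k v)\<^sup>2 * indicator A (E k))"
    by (simp add: g_def)
  finally have "(\<Sum>k\<in>X. (\<psi> k v)\<^sup>2 * indicator A (E k)) = measure \<mu> A" by (simp only: of_real_eq_iff)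
  moreover have "(\<Sum>k\<in>X. (\<psi> k v)\<^sup>2 * indicator A (E k)) = (\<Sum>k\<in>{k \<in> X. E k \<in> A}. (\<psi> k v)\<^sup>2)"
    using X by (intro sum.mono_neutral_cong_right) auto
  ultimately show ?thesis by simp
qed

text \<open>The witness is the image under E of the measure that gives the index k the mass of
  \<psi> k at v, squared.\<close>

lemma ex_spectral_measure:
  assumes v: "v \<in> X"
  shows "\<exists>\<mu>. is_spectral_measure X H v \<mu>"
proof -
  define M where "M = point_measure X (\<lambda>k. ennreal ((\<psi> k v)\<^sup>2))"
  have meas: "E \<in> measurable M borel" by (simp add: M_def measurable_def space_point_measure sets_point_measure Pi_def)
  have "finite_measure M"
    by (rule finite_measureI) (use X in \<open>simp add: M_def space_point_measure emeasure_point_measure_finite\<close>)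
  then have "finite_measure (distr M borel E)" by (rule finite_measure.finite_measure_distr[OF _ meas])
  moreover have "inner_on X (delta v) (functional_calculus X H g (delta v)) = integral\<^sup>L (distr M borel E) g"
    if "g \<in> borel_measurable borel" for g :: "real \<Rightarrow> complex"
  proof -
    have "integral\<^sup>L (distr M borel E) g = (\<integral>k. g (E k) \<partial>M)" by (rule integral_distr[OF meas that])
    also have "\<dots> = (\<Sum>k\<in>X. (\<psi> k v)\<^sup>2 *\<^sub>R g (E k))"
      unfolding M_def by (rule lebesgue_integral_point_measure_finite[OF X]) simp
    finally show ?thesis by (simp add: inner_functional_calculus[OF v] scaleR_conv_of_real)
  qed
  ultimately have "is_spectral_measure X H v (distr M borel E)" by (simp add: is_spectral_measure_def)
  then show ?thesis by blast
qed

lemma measure_spectral_measure_singleton: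
  assumes v: "v \<in> X"
  shows "measure (spectral_measure X H v) {e} = atom_mass X \<psi> E e v"
proof -
  have "\<mu> = \<nu>" if \<mu>: "is_spectral_measure X H v \<mu>" and \<nu>: "is_spectral_measure X H v \<nu>" for \<mu> \<nu>
  proof (rule measure_eqI)
    show "sets \<mu> = sets \<nu>" using \<mu> \<nu> by (simp add: is_spectral_measure_def)
    fix A assume "A \<in> sets \<mu>"
    then have "A \<in> sets borel" using \<mu> by (simp add: is_spectral_measure_def)
    then have "measure \<mu> A = measure \<nu> A"
      by (simp add: spectral_measure_of_set[OF v \<mu>] spectral_measure_of_set[OF v \<nu>])
    then show "emeasure \<mu> A = emeasure \<nu> A"
      using \<mu> \<nu> by (simp add: is_spectral_measure_def finite_measure.emeasure_eq_measure)
  qed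
  with ex_spectral_measure[OF v] have "\<exists>!\<mu>. is_spectral_measure X H v \<mu>" by (intro ex_ex1I)
  then have "is_spectral_measure X H v (spectral_measure X H v)"
    unfolding spectral_measure_def by (rule theI')
  from spectral_measure_of_set[OF v this, of "{e}"] show ?thesis by (simp add: atom_mass_def)
qed

end

section \<open>Schroedinger operators on box graphs\<close>

lemma pair_graph_box: "pair_graph (box_graph d N)"
proof -
  have arcs: "parcs (box_graph d N) = {(x, y). y \<in> neighbours d N x}" by (auto simp: neighbours_def)
  have verts: "pverts (box_graph d N) = box_vertices d N" by (simp add: box_graph_def)
  have sub: "parcs (box_graph d N) \<subseteq> box_vertices d N \<times> box_vertices d N"
    unfolding arcs by (auto simp: neighbours_iff)
  have fin: "finite (parcs (box_graph d N))"
    by (rule finite_subset[OF sub]) (simp add: finite_box_vertices)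
  have "sym (parcs (box_graph d N))"
    unfolding arcs by (rule symI) (simp add: neighbours_sym)
  then have "symmetric (box_graph d N)" by (simp add: symmetric_def)
  moreover have "fst e \<noteq> snd e" if "e \<in> parcs (box_graph d N)" for e
    using that unfolding arcs by (auto simp: neighbours_iff)
  ultimately show ?thesis
    using sub fin finite_box_vertices[of d N] by unfold_locales (auto simp: verts)
qed

lemma schroedinger_box:
  assumes x: "x \<in> box_vertices d N"
  shows "schroedinger (box_graph d N) W \<phi> x
    = (\<Sum>y\<in>box_vertices d N. of_real (add_diag (box_laplacian d N) W x y) * \<phi> y)"
proof -
  have "schroedinger (box_graph d N) W \<phi> x = (\<Sum>y\<in>neighbours d N x. \<phi> y - \<phi> x) + of_real (W x) * \<phi> x"
    using x by (simp add: schroedinger_def box_graph_def neighbours_def)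
  also have "\<dots> = (\<Sum>y\<in>neighbours d N x. \<phi> y) + (W x - real (card (neighbours d N x))) *\<^sub>R \<phi> x"
    by (simp add: sum_subtractf scaleR_conv_of_real algebra_simps)
  also have "\<dots> = (\<Sum>y\<in>box_vertices d N. add_diag (box_laplacian d N) W x y *\<^sub>R \<phi> y)"
    by (rule box_laplacian_apply_scaleR[OF x, symmetric])
  finally show ?thesis by (simp add: scaleR_conv_of_real)
qed

lemma measure_box_spectral_measure:
  assumes eb: "eigenbasis (box_vertices d N) (add_diag (box_laplacian d N) W) \<psi> E"
    and v: "v \<in> box_vertices d N"
  shows "measure (schroedinger_spectral_measure (box_graph d N) W v) {e} = atom_mass (box_vertices d N) \<psi> E e v"
proof -
  have sym: "box_laplacian d N x y = box_laplacian d N y x" if "x \<in> box_vertices d N" "y \<in> box_vertices d N" for x y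
    using symmetric_box_family[of d] that by (auto simp: symmetric_family_def box_family_def)
  interpret spectral_setup "box_vertices d N" "add_diag (box_laplacian d N) W" \<psi> E "schroedinger (box_graph d N) W"
    by unfold_locales (auto simp: finite_box_vertices add_diag_def sym eb schroedinger_box)
  show ?thesis
    unfolding schroedinger_spectral_measure_def
    using measure_spectral_measure_singleton[OF v] by (simp add: box_graph_def)
qed

theorem theorem3p1p2:
  fixes d :: nat
  assumes "d > 0"
  shows "asymptotically_dense_delocalization {box_graph d N | N. N \<ge> 1}"
  unfolding asymptotically_dense_delocalization_def
proof (intro conjI ballI allI impI)
  show "pair_graph G" if "G \<in> {box_graph d N | N. N \<ge> 1}" for G
    using that pair_graph_box by auto
next
  fix \<Lambda> \<epsilon> \<delta> :: real
  assume \<Lambda>: "\<Lambda> > 0" and \<epsilon>: "\<epsilon> > 0" and \<delta>: "\<delta> > 0"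
  \<comment> \<open>Clipping V and the perturbation cost \<eta> each, hence 2 \<eta> < \<delta>;
    \<eta> \<le> \<Lambda> keeps the clipping interval nonempty.\<close>
  define \<eta> where "\<eta> = min \<Lambda> (\<delta> / 4)"
  have \<eta>: "\<eta> > 0" "\<eta> \<le> \<Lambda>" "2 * \<eta> < \<delta>" using \<Lambda> \<delta> by (auto simp: \<eta>_def)
  have spectrum: "E k \<in> {- (2 * 3 ^ d + \<Lambda>)..2 * 3 ^ d + \<Lambda>}"
    if XA: "(X, A) \<in> box_family d" and W: "\<forall>x\<in>X. \<bar>W x\<bar> \<le> \<Lambda>"
      and eb: "eigenbasis X (add_diag A W) \<psi> E" and k: "k \<in> X" for X A W \<psi> E k
  proof -
    obtain N where N: "X = box_vertices d N" "A = box_laplacian d N" using XA by (auto simp: box_family_def)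
    have "\<bar>E k\<bar> \<le> 2 * 3 ^ d + \<Lambda>"
      using W eb k unfolding N by (rule box_eigenvalue_bound)
    then show ?thesis by (simp add: abs_le_iff)
  qed
  have "\<exists>n\<^sub>0::nat. \<forall>X A V. (X, A) \<in> box_family d \<longrightarrow> n\<^sub>0 < card X \<longrightarrow> (\<forall>x\<in>X. \<bar>V x\<bar> + \<eta> \<le> \<Lambda>) \<longrightarrow>
    (\<exists>W \<psi> E. eigenbasis X (add_diag A W) \<psi> E \<and> (\<forall>x\<in>X. \<bar>W x - V x\<bar> \<le> \<eta>) \<and>
      real (card {v \<in> X. \<exists>e. \<epsilon> < atom_mass X \<psi> E e v}) \<le> \<delta> * card X)"
    by (rule ex_delocalizing_perturbation[OF symmetric_box_family rare_points_box[OF assms] _ \<epsilon> \<delta> \<eta>(1)]) (rule spectrum)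
  then obtain n\<^sub>0 :: nat where n\<^sub>0: "\<forall>X A V. (X, A) \<in> box_family d \<longrightarrow> n\<^sub>0 < card X \<longrightarrow> (\<forall>x\<in>X. \<bar>V x\<bar> + \<eta> \<le> \<Lambda>) \<longrightarrow>
    (\<exists>W \<psi> E. eigenbasis X (add_diag A W) \<psi> E \<and> (\<forall>x\<in>X. \<bar>W x - V x\<bar> \<le> \<eta>) \<and>
      real (card {v \<in> X. \<exists>e. \<epsilon> < atom_mass X \<psi> E e v}) \<le> \<delta> * card X)" ..
  have main: "\<exists>W. W \<in> pverts G \<rightarrow> {-\<Lambda>..\<Lambda>} \<and> (SUP v\<in>pverts G. \<bar>V v - W v\<bar>) < \<delta> \<and>
      (1 - \<delta>) * real (card (pverts G))
      \<le> real (card {v \<in> pverts G. \<not> (\<exists>E. \<epsilon> < measure (schroedinger_spectral_measure G W v) {E})})"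
    if G: "G \<in> {box_graph d N | N. N \<ge> 1}" and card: "Suc n\<^sub>0 < card (pverts G)"
      and V: "V \<in> pverts G \<rightarrow> {-\<Lambda>..\<Lambda>}" for G V
  proof -
    obtain N where N: "G = box_graph d N" using G by blast
    define X where "X = box_vertices d N"
    have GX: "pverts G = X" by (simp add: N X_def box_graph_def)
    have X: "finite X" unfolding X_def by (rule finite_box_vertices)
    have ne: "X \<noteq> {}" using card GX by auto
    \<comment> \<open>V may touch the bounds \<plusminus>\<Lambda>; clipping it leaves a margin
      \<eta>, so that the perturbed potential is still bounded by \<Lambda>.\<close>
    define V' where "V' x = max (- (\<Lambda> - \<eta>)) (min (\<Lambda> - \<eta>) (V x))" for x
    have Vx: "\<bar>V x\<bar> \<le> \<Lambda>" if "x \<in> X" for x 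
    proof -
      have "V x \<in> {-\<Lambda>..\<Lambda>}" using V that unfolding GX by blast
      then show ?thesis by (auto simp: abs_le_iff)
    qed
    have V': "\<bar>V' x\<bar> + \<eta> \<le> \<Lambda>" "\<bar>V x - V' x\<bar> \<le> \<eta>" if "x \<in> X" for x
      using Vx[OF that] \<eta> by (auto simp: V'_def max_def min_def abs_if)
    have "(X, box_laplacian d N) \<in> box_family d" by (simp add: X_def box_family_def)
    moreover have "n\<^sub>0 < card X" using card by (simp add: GX)
    moreover have "\<forall>x\<in>X. \<bar>V' x\<bar> + \<eta> \<le> \<Lambda>" using V'(1) by blast
    ultimately have "\<exists>W \<psi> E. eigenbasis X (add_diag (box_laplacian d N) W) \<psi> E \<and>
        (\<forall>x\<in>X. \<bar>W x - V' x\<bar> \<le> \<eta>) \<and>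
        real (card {v \<in> X. \<exists>e. \<epsilon> < atom_mass X \<psi> E e v}) \<le> \<delta> * card X"
      using n\<^sub>0[THEN spec[of _ X], THEN spec[of _ "box_laplacian d N"], THEN spec[of _ V']] by simp
    then obtain W \<psi> E where eb: "eigenbasis X (add_diag (box_laplacian d N) W) \<psi> E"
      and W: "\<forall>x\<in>X. \<bar>W x - V' x\<bar> \<le> \<eta>"
      and bad: "real (card {v \<in> X. \<exists>e. \<epsilon> < atom_mass X \<psi> E e v}) \<le> \<delta> * card X"
      by (elim exE conjE)
    have "W \<in> X \<rightarrow> {-\<Lambda>..\<Lambda>}"
    proof
      fix x assume x: "x \<in> X"
      show "W x \<in> {-\<Lambda>..\<Lambda>}" using bspec[OF W x] V'(1)[OF x] by (simp add: abs_le_iff) linarith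
    qed
    moreover have "(SUP v\<in>X. \<bar>V v - W v\<bar>) < \<delta>"
    proof -
      have "(SUP v\<in>X. \<bar>V v - W v\<bar>) \<le> 2 * \<eta>"
      proof (rule cSUP_least[OF ne])
        fix x assume x: "x \<in> X"
        show "\<bar>V x - W x\<bar> \<le> 2 * \<eta>" using bspec[OF W x] V'(2)[OF x] by linarith
      qed
      then show ?thesis using \<eta>(3) by simp
    qed
    moreover have "(1 - \<delta>) * real (card X)
      \<le> real (card {v \<in> X. \<not> (\<exists>e. \<epsilon> < measure (schroedinger_spectral_measure G W v) {e})})"
    proof -
      have "{v \<in> X. \<not> (\<exists>e. \<epsilon> < measure (schroedinger_spectral_measure G W v) {e})}
          = X - {v \<in> X. \<exists>e. \<epsilon> < atom_mass X \<psi> E e v}"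
        using measure_box_spectral_measure[OF eb[unfolded X_def]] by (auto simp: N X_def)
      then have "real (card {v \<in> X. \<not> (\<exists>e. \<epsilon> < measure (schroedinger_spectral_measure G W v) {e})})
          = real (card X) - real (card {v \<in> X. \<exists>e. \<epsilon> < atom_mass X \<psi> E e v})"
        using X by (simp add: card_Diff_subset card_mono of_nat_diff)
      then show ?thesis using bad by (simp add: left_diff_distrib)
    qed
    ultimately show ?thesis unfolding GX by blast
  qed
  \<comment> \<open>The threshold is raised by one because it is required to be positive.\<close>
  then show "\<exists>N\<^sub>0::nat. N\<^sub>0 > 0 \<and>
       (\<forall>G\<in>{box_graph d N | N. N \<ge> 1}. card (pverts G) > N\<^sub>0 \<longrightarrow>
         (\<forall>V. V \<in> pverts G \<rightarrow> {-\<Lambda>..\<Lambda>} \<longrightarrow>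
           (\<exists>W. W \<in> pverts G \<rightarrow> {-\<Lambda>..\<Lambda>} \<and>
             (SUP v\<in>pverts G. \<bar>V v - W v\<bar>) < \<delta> \<and>
             real (card {v \<in> pverts G.
               \<not> (\<exists>E. measure (schroedinger_spectral_measure G W v) {E} > \<epsilon>)})
               \<ge> (1 - \<delta>) * real (card (pverts G)))))"
    by (intro exI[of _ "Suc n\<^sub>0"]) blast
qed

end
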